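(* $\mathsf{HT}^{\exists\{a<b\}}_2$ with apartness is equivalent to $\mathsf{ACA}_0$ over $\mathsf{RCA}_0$.
   Context: $\mathbb{N}$ denotes the positive integers. $\mathsf{RCA}_0$ and $\mathsf{ACA}_0$ are the standard systems of reverse mathematics. For $m\in\mathbb{N}$, $\lambda(m)$ and $\mu(m)$ are the least and greatest exponents in the binary expansion of $m$; $X\subseteq\mathbb{N}$ is apart if for all $x<x'$ in $X$, $\mu(x)<\lambda(x')$. For $A\subseteq\mathbb{N}$, $\mathrm{FS}^{A}(H)$ is the set of all sums of $j$ distinct elements of $H$ for $j\in A$. $\mathsf{HT}^{\exists\{a<b\}}_2$ with apartness: for every $f:\mathbb{N}\to 2$ there exist an infinite apart $H\subseteq\mathbb{N}$ and positive integers $a<b$ such that $\mathrm{FS}^{\{a,b\}}(H)$ is monochromatic for $f$. *)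

theory Defs
  imports Main
begin

section \<open>The language of second-order arithmetic\<close>

text \<open>
  Two-sorted de Bruijn syntax: number variables and set variables have separate index spaces,
  so \<open>All\<close> shifts only number indices and \<open>SAll\<close> only set indices.  The only set terms are set
  variables, given by their index.
\<close>

datatype trm = Var nat | Zero | One | Add trm trm (infixl "\<^bold>+" 65) | Mul trm trm (infixl "\<^bold>*" 70)

datatype fm =
    Fls
  | Eq trm trm (infix "\<^bold>=" 50)
  | Less trm trm (infix "\<^bold><" 50)
  | Mem trm nat (infix "\<^bold>\<in>" 50)
  | Imp fm fm (infixr "\<^bold>\<longrightarrow>" 25)
  | All fm
  | SAll fm

abbreviation Neg :: "fm \<Rightarrow> fm" ("\<^bold>\<not> _" [40] 40) where "\<^bold>\<not> \<phi> \<equiv> (\<phi> \<^bold>\<longrightarrow> Fls)"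
abbreviation Conj :: "fm \<Rightarrow> fm \<Rightarrow> fm" (infixr "\<^bold>\<and>" 35) where "\<phi> \<^bold>\<and> \<psi> \<equiv> \<^bold>\<not> (\<phi> \<^bold>\<longrightarrow> \<^bold>\<not> \<psi>)"
abbreviation Disj :: "fm \<Rightarrow> fm \<Rightarrow> fm" (infixr "\<^bold>\<or>" 30) where "\<phi> \<^bold>\<or> \<psi> \<equiv> (\<^bold>\<not> \<phi> \<^bold>\<longrightarrow> \<psi>)"
abbreviation Iff :: "fm \<Rightarrow> fm \<Rightarrow> fm" (infixr "\<^bold>\<longleftrightarrow>" 25)
  where "\<phi> \<^bold>\<longleftrightarrow> \<psi> \<equiv> (\<phi> \<^bold>\<longrightarrow> \<psi>) \<^bold>\<and> (\<psi> \<^bold>\<longrightarrow> \<phi>)"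
abbreviation Ex :: "fm \<Rightarrow> fm" where "Ex \<phi> \<equiv> \<^bold>\<not> All (\<^bold>\<not> \<phi>)"
abbreviation SEx :: "fm \<Rightarrow> fm" where "SEx \<phi> \<equiv> \<^bold>\<not> SAll (\<^bold>\<not> \<phi>)"

primrec tsub :: "(nat \<Rightarrow> trm) \<Rightarrow> trm \<Rightarrow> trm" where
  "tsub \<sigma> (Var n) = \<sigma> n"
| "tsub \<sigma> Zero = Zero"
| "tsub \<sigma> One = One"
| "tsub \<sigma> (t \<^bold>+ u) = tsub \<sigma> t \<^bold>+ tsub \<sigma> u"
| "tsub \<sigma> (t \<^bold>* u) = tsub \<sigma> t \<^bold>* tsub \<sigma> u"

definition lift :: "nat \<Rightarrow> trm \<Rightarrow> trm" where
  "lift k = tsub (\<lambda>n. Var (n + k))"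

text \<open>Simultaneous capture-avoiding substitution, \<open>\<sigma>\<close> for number and \<open>\<rho>\<close> for set variables.\<close>

primrec fsub :: "(nat \<Rightarrow> trm) \<Rightarrow> (nat \<Rightarrow> nat) \<Rightarrow> fm \<Rightarrow> fm" where
  "fsub \<sigma> \<rho> Fls = Fls"
| "fsub \<sigma> \<rho> (t \<^bold>= u) = (tsub \<sigma> t \<^bold>= tsub \<sigma> u)"
| "fsub \<sigma> \<rho> (t \<^bold>< u) = (tsub \<sigma> t \<^bold>< tsub \<sigma> u)"
| "fsub \<sigma> \<rho> (t \<^bold>\<in> X) = (tsub \<sigma> t \<^bold>\<in> \<rho> X)"
| "fsub \<sigma> \<rho> (\<phi> \<^bold>\<longrightarrow> \<psi>) = (fsub \<sigma> \<rho> \<phi> \<^bold>\<longrightarrow> fsub \<sigma> \<rho> \<psi>)"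
| "fsub \<sigma> \<rho> (All \<phi>) = All (fsub (case_nat (Var 0) (\<lambda>n. lift 1 (\<sigma> n))) \<rho> \<phi>)"
| "fsub \<sigma> \<rho> (SAll \<phi>) = SAll (fsub \<sigma> (case_nat 0 (\<lambda>X. Suc (\<rho> X))) \<phi>)"

definition flift :: "fm \<Rightarrow> fm" where "flift = fsub (\<lambda>n. Var (Suc n)) id"
definition slift :: "fm \<Rightarrow> fm" where "slift = fsub Var Suc"

definition inst :: "trm \<Rightarrow> fm \<Rightarrow> fm" where "inst t = fsub (case_nat t Var) id"
definition sinst :: "nat \<Rightarrow> fm \<Rightarrow> fm" where "sinst X = fsub Var (case_nat X id)"

section \<open>Provability\<close>

text \<open>Natural deduction for classical two-sorted first-order logic with equality on numbers.\<close>

inductive proves :: "fm set \<Rightarrow> fm \<Rightarrow> bool" (infix "\<turnstile>" 20) where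
  Assm: "\<phi> \<in> \<Gamma> \<Longrightarrow> \<Gamma> \<turnstile> \<phi>"
| ImpI: "insert \<phi> \<Gamma> \<turnstile> \<psi> \<Longrightarrow> \<Gamma> \<turnstile> \<phi> \<^bold>\<longrightarrow> \<psi>"
| ImpE: "\<Gamma> \<turnstile> \<phi> \<^bold>\<longrightarrow> \<psi> \<Longrightarrow> \<Gamma> \<turnstile> \<phi> \<Longrightarrow> \<Gamma> \<turnstile> \<psi>"
| Raa: "insert (\<^bold>\<not> \<phi>) \<Gamma> \<turnstile> Fls \<Longrightarrow> \<Gamma> \<turnstile> \<phi>"
| AllI: "flift ` \<Gamma> \<turnstile> \<phi> \<Longrightarrow> \<Gamma> \<turnstile> All \<phi>"
| AllE: "\<Gamma> \<turnstile> All \<phi> \<Longrightarrow> \<Gamma> \<turnstile> inst t \<phi>"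
| SAllI: "slift ` \<Gamma> \<turnstile> \<phi> \<Longrightarrow> \<Gamma> \<turnstile> SAll \<phi>"
| SAllE: "\<Gamma> \<turnstile> SAll \<phi> \<Longrightarrow> \<Gamma> \<turnstile> sinst X \<phi>"
| EqRefl: "\<Gamma> \<turnstile> t \<^bold>= t"
| EqSubst: "\<Gamma> \<turnstile> t \<^bold>= u \<Longrightarrow> \<Gamma> \<turnstile> inst t \<phi> \<Longrightarrow> \<Gamma> \<turnstile> inst u \<phi>"

definition equivalent_over :: "fm set \<Rightarrow> fm set \<Rightarrow> fm set \<Rightarrow> bool" where
  "equivalent_over B S T \<longleftrightarrow> (\<forall>\<phi>\<in>T. B \<union> S \<turnstile> \<phi>) \<and> (\<forall>\<phi>\<in>S. B \<union> T \<turnstile> \<phi>)"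

section \<open>The systems \<open>RCA\<^sub>0\<close> and \<open>ACA\<^sub>0\<close>\<close>

primrec tfits :: "nat \<Rightarrow> trm \<Rightarrow> bool" where
  "tfits p (Var n) \<longleftrightarrow> n < p"
| "tfits p Zero \<longleftrightarrow> True"
| "tfits p One \<longleftrightarrow> True"
| "tfits p (t \<^bold>+ u) \<longleftrightarrow> tfits p t \<and> tfits p u"
| "tfits p (t \<^bold>* u) \<longleftrightarrow> tfits p t \<and> tfits p u"

text \<open>All free number indices are below \<open>p\<close> and all free set indices below \<open>q\<close>.\<close>

primrec fits :: "nat \<Rightarrow> nat \<Rightarrow> fm \<Rightarrow> bool" where
  "fits p q Fls \<longleftrightarrow> True"
| "fits p q (t \<^bold>= u) \<longleftrightarrow> tfits p t \<and> tfits p u"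
| "fits p q (t \<^bold>< u) \<longleftrightarrow> tfits p t \<and> tfits p u"
| "fits p q (t \<^bold>\<in> X) \<longleftrightarrow> tfits p t \<and> X < q"
| "fits p q (\<phi> \<^bold>\<longrightarrow> \<psi>) \<longleftrightarrow> fits p q \<phi> \<and> fits p q \<psi>"
| "fits p q (All \<phi>) \<longleftrightarrow> fits (Suc p) q \<phi>"
| "fits p q (SAll \<phi>) \<longleftrightarrow> fits p (Suc q) \<phi>"

text \<open>Axioms are taken as sentences, since the rules do not generalize over variables free in \<open>\<Gamma>\<close>.\<close>

definition closures :: "fm set \<Rightarrow> fm set" where
  "closures S = {(All ^^ p) ((SAll ^^ q) \<phi>) | p q \<phi>. \<phi> \<in> S \<and> fits p q \<phi>}"

definition basic_axioms :: "fm set" where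
  "basic_axioms =
    (let m = Var 0; n = Var 1 in
     {\<^bold>\<not> (n \<^bold>+ One \<^bold>= Zero),
      m \<^bold>+ One \<^bold>= n \<^bold>+ One \<^bold>\<longrightarrow> m \<^bold>= n,
      m \<^bold>+ Zero \<^bold>= m,
      m \<^bold>+ (n \<^bold>+ One) \<^bold>= (m \<^bold>+ n) \<^bold>+ One,
      m \<^bold>* Zero \<^bold>= Zero,
      m \<^bold>* (n \<^bold>+ One) \<^bold>= (m \<^bold>* n) \<^bold>+ m,
      \<^bold>\<not> (m \<^bold>< Zero),
      m \<^bold>< n \<^bold>+ One \<^bold>\<longleftrightarrow> (m \<^bold>< n \<^bold>\<or> m \<^bold>= n)})"

definition AllLess :: "trm \<Rightarrow> fm \<Rightarrow> fm" where
  "AllLess t \<phi> = All (Var 0 \<^bold>< lift 1 t \<^bold>\<longrightarrow> \<phi>)"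

definition ExLess :: "trm \<Rightarrow> fm \<Rightarrow> fm" where
  "ExLess t \<phi> = Ex (Var 0 \<^bold>< lift 1 t \<^bold>\<and> \<phi>)"

inductive_set Delta00 :: "fm set" where
  "Fls \<in> Delta00"
| "(t \<^bold>= u) \<in> Delta00"
| "(t \<^bold>< u) \<in> Delta00"
| "(t \<^bold>\<in> X) \<in> Delta00"
| "\<phi> \<in> Delta00 \<Longrightarrow> \<psi> \<in> Delta00 \<Longrightarrow> (\<phi> \<^bold>\<longrightarrow> \<psi>) \<in> Delta00"
| "\<phi> \<in> Delta00 \<Longrightarrow> AllLess t \<phi> \<in> Delta00"
| "\<phi> \<in> Delta00 \<Longrightarrow> ExLess t \<phi> \<in> Delta00"

definition Sigma01 :: "fm set" where "Sigma01 = {Ex \<theta> | \<theta>. \<theta> \<in> Delta00}"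
definition Pi01 :: "fm set" where "Pi01 = {All \<theta> | \<theta>. \<theta> \<in> Delta00}"

primrec arithmetical :: "fm \<Rightarrow> bool" where
  "arithmetical Fls \<longleftrightarrow> True"
| "arithmetical (t \<^bold>= u) \<longleftrightarrow> True"
| "arithmetical (t \<^bold>< u) \<longleftrightarrow> True"
| "arithmetical (t \<^bold>\<in> X) \<longleftrightarrow> True"
| "arithmetical (\<phi> \<^bold>\<longrightarrow> \<psi>) \<longleftrightarrow> arithmetical \<phi> \<and> arithmetical \<psi>"
| "arithmetical (All \<phi>) \<longleftrightarrow> arithmetical \<phi>"
| "arithmetical (SAll \<phi>) \<longleftrightarrow> False"

text \<open>
  In the schemes below the distinguished number variable of \<open>\<phi>\<close> is \<open>Var 0\<close>; all other free
  variables are parameters.  \<open>slift\<close> keeps the set asserted to exist out of \<open>\<phi>\<close>.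
\<close>

definition induction :: "fm \<Rightarrow> fm" where
  "induction \<phi> =
    (inst Zero \<phi> \<^bold>\<and> All (\<phi> \<^bold>\<longrightarrow> fsub (case_nat (Var 0 \<^bold>+ One) (\<lambda>n. Var (Suc n))) id \<phi>)
     \<^bold>\<longrightarrow> All \<phi>)"

definition comprehension :: "fm \<Rightarrow> fm" where
  "comprehension \<phi> = SEx (All (Var 0 \<^bold>\<in> 0 \<^bold>\<longleftrightarrow> slift \<phi>))"

definition RCA0 :: "fm set" where
  "RCA0 = closures (basic_axioms
      \<union> {induction \<phi> | \<phi>. \<phi> \<in> Sigma01}
      \<union> {All (\<phi> \<^bold>\<longleftrightarrow> \<psi>) \<^bold>\<longrightarrow> comprehension \<phi> | \<phi> \<psi>. \<phi> \<in> Sigma01 \<and> \<psi> \<in> Pi01})"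

definition ACA0 :: "fm set" where
  "ACA0 = closures (basic_axioms
      \<union> {induction (Var 0 \<^bold>\<in> 0)}
      \<union> {comprehension \<phi> | \<phi>. arithmetical \<phi>})"

section \<open>Coding in the language\<close>

text \<open>
  Each formula constructor takes terms for its number arguments and indices for its set arguments;
  arguments are lifted past the quantifiers introduced.  Comments list the bound variables,
  innermost index first.
\<close>

abbreviation Two :: trm where "Two \<equiv> One \<^bold>+ One"

definition pair :: "trm \<Rightarrow> trm \<Rightarrow> trm" where
  "pair i j = (i \<^bold>+ j) \<^bold>* (i \<^bold>+ j) \<^bold>+ i"

text \<open>
  Finite sequences are coded by Goedel's beta function: \<open>(c, d)\<close> codes the sequence whose entry \<open>i\<close>
  is the remainder of \<open>c\<close> modulo \<open>(i + 1) d + 1\<close>, and the length is given separately.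
  \<open>entry c d i x\<close> says that this remainder is \<open>x\<close>.
\<close>

definition entry :: "trm \<Rightarrow> trm \<Rightarrow> trm \<Rightarrow> trm \<Rightarrow> fm" where
  "entry c d i x =
    (let modulus = (i \<^bold>+ One) \<^bold>* d \<^bold>+ One in
     x \<^bold>< modulus \<^bold>\<and> Ex (lift 1 c \<^bold>= Var 0 \<^bold>* lift 1 modulus \<^bold>+ lift 1 x))"

text \<open>The first \<open>l\<close> entries of \<open>(c, d)\<close> add up to \<open>n\<close>, witnessed by the sequence of partial sums.\<close>

definition seq_sum :: "trm \<Rightarrow> trm \<Rightarrow> trm \<Rightarrow> trm \<Rightarrow> fm" where
  "seq_sum c d l n = Ex (Ex ( \<comment> \<open>partial sums \<open>(Var 1, Var 0)\<close>\<close>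
     entry (Var 1) (Var 0) Zero Zero \<^bold>\<and>
     AllLess (lift 2 l) (Ex (Ex ( \<comment> \<open>partial sum, entry, position, code of the partial sums\<close>
       entry (lift 5 c) (lift 5 d) (Var 2) (Var 1) \<^bold>\<and>
       entry (Var 4) (Var 3) (Var 2) (Var 0) \<^bold>\<and>
       entry (Var 4) (Var 3) (Var 2 \<^bold>+ One) (Var 0 \<^bold>+ Var 1)))) \<^bold>\<and>
     entry (Var 1) (Var 0) (lift 2 l) (lift 2 n)))"

text \<open>\<open>n\<close> is a sum of \<open>j\<close> distinct elements of \<open>H\<close>.\<close>

definition in_FS :: "trm \<Rightarrow> nat \<Rightarrow> trm \<Rightarrow> fm" where
  "in_FS j H n = Ex (Ex ( \<comment> \<open>summands \<open>(Var 1, Var 0)\<close>\<close>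
     AllLess (lift 2 j) (Ex ( \<comment> \<open>entry, position\<close>
       entry (Var 3) (Var 2) (Var 1) (Var 0) \<^bold>\<and> Var 0 \<^bold>\<in> H)) \<^bold>\<and>
     AllLess (lift 2 j) (AllLess (lift 3 j) (All ( \<comment> \<open>entry, two positions\<close>
       \<^bold>\<not> (Var 1 \<^bold>= Var 2) \<^bold>\<longrightarrow>
       \<^bold>\<not> (entry (Var 4) (Var 3) (Var 1) (Var 0) \<^bold>\<and> entry (Var 4) (Var 3) (Var 2) (Var 0))))) \<^bold>\<and>
     seq_sum (Var 1) (Var 0) (lift 2 j) (lift 2 n)))"

text \<open>\<open>p = 2\<^sup>e\<close>, by a sequence of successive doublings.\<close>

definition is_pow2 :: "trm \<Rightarrow> trm \<Rightarrow> fm" where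
  "is_pow2 e p = Ex (Ex ( \<comment> \<open>powers \<open>(Var 1, Var 0)\<close>\<close>
     entry (Var 1) (Var 0) Zero One \<^bold>\<and>
     AllLess (lift 2 e) (Ex ( \<comment> \<open>entry, position\<close>
       entry (Var 3) (Var 2) (Var 1) (Var 0) \<^bold>\<and>
       entry (Var 3) (Var 2) (Var 1 \<^bold>+ One) (Two \<^bold>* Var 0))) \<^bold>\<and>
     entry (Var 1) (Var 0) (lift 2 e) (lift 2 p)))"

text \<open>
  The first \<open>k\<close> entries \<open>e\<^sub>0, \<dots>, e\<^sub>k\<^sub>-\<^sub>1\<close> of \<open>(c, d)\<close> satisfy
  \<open>e\<^sub>0 < \<dots> < e\<^sub>k\<^sub>-\<^sub>1\<close> and \<open>m\<close> is the sum of the powers \<open>2\<close> to the \<open>e\<^sub>i\<close>.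
\<close>

definition binary_expansion :: "trm \<Rightarrow> trm \<Rightarrow> trm \<Rightarrow> trm \<Rightarrow> fm" where
  "binary_expansion c d k m =
    (AllLess k (AllLess (Var 0) (All (All ( \<comment> \<open>entry at i, entry at j, j, i, where j < i < k\<close>
       entry (lift 4 c) (lift 4 d) (Var 2) (Var 1) \<^bold>\<and>
       entry (lift 4 c) (lift 4 d) (Var 3) (Var 0) \<^bold>\<longrightarrow> Var 1 \<^bold>< Var 0)))) \<^bold>\<and>
     Ex (Ex ( \<comment> \<open>powers \<open>(Var 1, Var 0)\<close>\<close>
       AllLess (lift 2 k) (Ex (Ex ( \<comment> \<open>power, exponent, position\<close>
         entry (lift 5 c) (lift 5 d) (Var 2) (Var 1) \<^bold>\<and>
         is_pow2 (Var 1) (Var 0) \<^bold>\<and>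
         entry (Var 4) (Var 3) (Var 2) (Var 0)))) \<^bold>\<and>
       seq_sum (Var 1) (Var 0) (lift 2 k) (lift 2 m))))"

text \<open>\<open>\<lambda>(m) = e\<close> and \<open>\<mu>(m) = e\<close>: the first and the last exponent of the expansion of \<open>m\<close>.\<close>

definition is_lambda :: "trm \<Rightarrow> trm \<Rightarrow> fm" where
  "is_lambda m e = Ex (Ex (Ex ( \<comment> \<open>index of the last exponent, expansion \<open>(Var 2, Var 1)\<close>\<close>
     binary_expansion (Var 2) (Var 1) (Var 0 \<^bold>+ One) (lift 3 m) \<^bold>\<and>
     entry (Var 2) (Var 1) Zero (lift 3 e))))"

definition is_mu :: "trm \<Rightarrow> trm \<Rightarrow> fm" where
  "is_mu m e = Ex (Ex (Ex ( \<comment> \<open>index of the last exponent, expansion \<open>(Var 2, Var 1)\<close>\<close>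
     binary_expansion (Var 2) (Var 1) (Var 0 \<^bold>+ One) (lift 3 m) \<^bold>\<and>
     entry (Var 2) (Var 1) (Var 0) (lift 3 e))))"

section \<open>Hindman's theorem for sums of exactly \<open>a\<close> or \<open>b\<close> terms\<close>

text \<open>
  The number sort contains \<open>0\<close>, so the restriction to positive integers is explicit in the
  domain of the colouring, in \<open>H\<close>, and in \<open>a\<close> and \<open>b\<close>.  A function is the set of its pairs
  (argument, value).
\<close>

definition is_colouring :: "nat \<Rightarrow> fm" where
  "is_colouring F =
    (All (Var 0 \<^bold>\<in> F \<^bold>\<longrightarrow> Ex (Ex (Zero \<^bold>< Var 1 \<^bold>\<and> Var 0 \<^bold>< Two \<^bold>\<and> Var 2 \<^bold>= pair (Var 1) (Var 0)))) \<^bold>\<and>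
     All (All (All (pair (Var 2) (Var 1) \<^bold>\<in> F \<^bold>\<and> pair (Var 2) (Var 0) \<^bold>\<in> F \<^bold>\<longrightarrow> Var 1 \<^bold>= Var 0))) \<^bold>\<and>
     All (Zero \<^bold>< Var 0 \<^bold>\<longrightarrow> Ex (pair (Var 1) (Var 0) \<^bold>\<in> F)))"

definition is_positive :: "nat \<Rightarrow> fm" where
  "is_positive H = All (Var 0 \<^bold>\<in> H \<^bold>\<longrightarrow> Zero \<^bold>< Var 0)"

definition is_infinite :: "nat \<Rightarrow> fm" where
  "is_infinite H = All (Ex (Var 1 \<^bold>< Var 0 \<^bold>\<and> Var 0 \<^bold>\<in> H))"

definition is_apart :: "nat \<Rightarrow> fm" where
  "is_apart H = All (All ( \<comment> \<open>greater, smaller element\<close>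
     Var 1 \<^bold>\<in> H \<^bold>\<and> Var 0 \<^bold>\<in> H \<^bold>\<and> Var 1 \<^bold>< Var 0 \<^bold>\<longrightarrow>
     Ex (Ex ( \<comment> \<open>\<open>\<lambda>\<close> of the greater, \<open>\<mu>\<close> of the smaller, greater, smaller element\<close>
       is_mu (Var 3) (Var 1) \<^bold>\<and> is_lambda (Var 2) (Var 0) \<^bold>\<and> Var 1 \<^bold>< Var 0))))"

definition is_monochromatic :: "nat \<Rightarrow> trm \<Rightarrow> trm \<Rightarrow> nat \<Rightarrow> fm" where
  "is_monochromatic F a b H = ExLess Two (All ( \<comment> \<open>sum, colour\<close>
     in_FS (lift 2 a) H (Var 0) \<^bold>\<or> in_FS (lift 2 b) H (Var 0) \<^bold>\<longrightarrow> pair (Var 0) (Var 1) \<^bold>\<in> F))"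

definition HT_exists_ab_apart :: fm where
  "HT_exists_ab_apart = SAll (is_colouring 0 \<^bold>\<longrightarrow>
     SEx ( \<comment> \<open>sets: \<open>H\<close> is 0, the colouring is 1\<close>
       is_positive 0 \<^bold>\<and> is_infinite 0 \<^bold>\<and> is_apart 0 \<^bold>\<and>
       Ex (Ex ( \<comment> \<open>\<open>b\<close> is \<open>Var 0\<close>, \<open>a\<close> is \<open>Var 1\<close>\<close>
         Zero \<^bold>< Var 1 \<^bold>\<and> Var 1 \<^bold>< Var 0 \<^bold>\<and> is_monochromatic 1 (Var 1) (Var 0) 0))))"

end

theory Submission
  imports Defs "HOL-Library.Countable"
begin

text \<open>
  By completeness it suffices to show that every model of \<open>RCA\<^sub>0\<close> satisfies the Hindman principle if
  and only if it satisfies \<open>ACA\<^sub>0\<close>.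

  From the principle to \<open>ACA\<^sub>0\<close>: let \<open>K = {y. \<exists>x. T x y}\<close> be a \<open>\<Sigma>\<^sup>0\<^sub>1\<close> set.  Call the exponent \<open>i\<close> of
  \<open>n\<close> important if some \<open>y < \<lambda>(n)\<close> enters \<open>K\<close> at a stage between the preceding exponent of \<open>n\<close> and \<open>i\<close>,
  and colour \<open>n\<close> by the parity of the number of its important exponents.  If \<open>y < \<lambda>(n)\<close> enters \<open>K\<close>
  only after stage \<open>n\<close>, then adding to \<open>n\<close> any \<open>w\<close> with all exponents sufficiently large creates
  exactly one further important exponent, \<open>\<lambda>(w)\<close>, and so changes the colour.  When \<open>FS\<^bsup>{a,b}\<^esup>(H)\<close> is
  monochromatic and \<open>H\<close> is apart, take for \<open>n\<close> a sum of \<open>a\<close> elements and for \<open>w\<close> a sum of \<open>b - a\<close>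
  later ones: it follows that \<open>y \<in> K\<close> is decided below any sum \<open>n\<close> of \<open>a\<close> elements with
  \<open>y < \<lambda>(n)\<close>, so \<open>K\<close> is \<open>\<Delta>\<^sup>0\<^sub>1\<close> in \<open>H\<close>.

  Conversely, in \<open>ACA\<^sub>0\<close> a Ramsey argument gives an infinite set of powers of \<open>2\<close> on which the sums of
  exactly one, exactly two and exactly three elements are each monochromatic; two of the three
  colours agree.
\<close>

section \<open>Substitution\<close>

text \<open>Models of \<open>RCA0\<close> may be nonstandard and satisfy only induction for
  \<open>\<Sigma>\<^sup>0\<^sub>1\<close> formulas. Hence \<open>a\<close> and \<open>b\<close> can
  be nonstandard, and a sum of \<open>a\<close> elements exists only as a coded sequence; sequence
  coding and recursion therefore have to be developed inside the model. Importance of a digit is a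
  bounded condition, so the colouring exists even where \<open>K\<close> does not. The delicate
  point is the flip of the colour: it needs one bound for the first witnesses of all
  \<open>y < n\<close> that enter \<open>K\<close>, although it is not known which \<open>y\<close>
  these are. Beyond that bound no digit of \<open>w\<close> after its lowest one can become
  important. Apartness provides such \<open>w\<close>, since all sufficiently late elements of
  \<open>H\<close> are divisible by a given power of 2, and it excludes carries. In the converse
  direction apartness is automatic for powers of 2. The models that completeness supplies all have
  terms as carrier, so they range over one type and a single one can be fixed to stand for
  all.\<close>

declare One_nat_def [simp del]

abbreviation up :: "(nat \<Rightarrow> trm) \<Rightarrow> nat \<Rightarrow> trm" where
  "up \<sigma> \<equiv> case_nat (Var 0) (\<lambda>n. lift 1 (\<sigma> n))"
abbreviation sup_ren :: "(nat \<Rightarrow> nat) \<Rightarrow> nat \<Rightarrow> nat" where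
  "sup_ren \<rho> \<equiv> case_nat 0 (\<lambda>X. Suc (\<rho> X))"

lemma tsub_Var [simp]: "tsub Var t = t"
  by (induction t) auto

lemma tsub_tsub: "tsub \<sigma> (tsub \<tau> t) = tsub (\<lambda>n. tsub \<sigma> (\<tau> n)) t"
  by (induction t) auto

lemma up_Var [simp]: "up Var = Var"
  by (auto simp: fun_eq_iff lift_def split: nat.split)

lemma sup_ren_id [simp]: "sup_ren id = id" "sup_ren (\<lambda>x. x) = (\<lambda>x. x)"
  by (auto simp: fun_eq_iff split: nat.split)

lemma fsub_Var_id [simp]: "fsub Var id \<phi> = \<phi>"
  by (induction \<phi>) auto

lemma lift_1: "lift 1 = tsub (\<lambda>n. Var (Suc n))"
  by (simp add: lift_def One_nat_def)

lemma tsub_up: "tsub (up \<sigma>) (up \<tau> n) = up (\<lambda>n. tsub \<sigma> (\<tau> n)) n"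
  by (auto simp: lift_1 tsub_tsub split: nat.split)

lemma sup_ren_comp: "sup_ren \<rho> (sup_ren \<pi> n) = sup_ren (\<lambda>n. \<rho> (\<pi> n)) n"
  by (auto split: nat.split)

lemma fsub_fsub: "fsub \<sigma> \<rho> (fsub \<tau> \<pi> \<phi>) = fsub (\<lambda>n. tsub \<sigma> (\<tau> n)) (\<lambda>n. \<rho> (\<pi> n)) \<phi>"
proof (induction \<phi> arbitrary: \<sigma> \<rho> \<tau> \<pi>)
  case (All \<phi>)
  show ?case by (simp add: All.IH tsub_up)
next
  case (SAll \<phi>)
  show ?case by (simp add: SAll.IH sup_ren_comp)
qed (auto simp: tsub_tsub)

lemma tsub_cong: "tfits p t \<Longrightarrow> (\<And>n. n < p \<Longrightarrow> \<sigma> n = \<tau> n) \<Longrightarrow> tsub \<sigma> t = tsub \<tau> t"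
  by (induction t) auto

lemma fsub_cong:
  "fits p q \<phi> \<Longrightarrow> (\<And>n. n < p \<Longrightarrow> \<sigma> n = \<tau> n) \<Longrightarrow> (\<And>n. n < q \<Longrightarrow> \<rho> n = \<pi> n) \<Longrightarrow>
   fsub \<sigma> \<rho> \<phi> = fsub \<tau> \<pi> \<phi>"
proof (induction \<phi> arbitrary: p q \<sigma> \<tau> \<rho> \<pi>)
  case (Imp \<phi> \<psi>)
  have "fsub \<sigma> \<rho> \<phi> = fsub \<tau> \<pi> \<phi>" by (rule Imp.IH(1)) (use Imp.prems in auto)
  moreover have "fsub \<sigma> \<rho> \<psi> = fsub \<tau> \<pi> \<psi>" by (rule Imp.IH(2)) (use Imp.prems in auto)
  ultimately show ?case by simp
next
  case (All \<phi>)
  have "fsub (up \<sigma>) \<rho> \<phi> = fsub (up \<tau>) \<pi> \<phi>"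
    by (rule All.IH[of "Suc p" q]) (use All.prems in \<open>auto split: nat.split\<close>)
  then show ?case by simp
next
  case (SAll \<phi>)
  have "fsub \<sigma> (sup_ren \<rho>) \<phi> = fsub \<tau> (sup_ren \<pi>) \<phi>"
    by (rule SAll.IH[of p "Suc q"]) (use SAll.prems in \<open>auto split: nat.split\<close>)
  then show ?case by simp
qed (auto intro: tsub_cong)

lemma tfits_mono: "tfits p t \<Longrightarrow> p \<le> p' \<Longrightarrow> tfits p' t"
  by (induction t) auto

lemma fits_mono: "fits p q \<phi> \<Longrightarrow> p \<le> p' \<Longrightarrow> q \<le> q' \<Longrightarrow> fits p' q' \<phi>"
  by (induction \<phi> arbitrary: p q p' q') (auto intro: tfits_mono)

lemma tfits_ex: "\<exists>p. tfits p t"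
proof (induction t)
  case (Add t u)
  then obtain p p' where "tfits p t" "tfits p' u" by blast
  then show ?case by (auto intro!: exI[of _ "max p p'"] elim: tfits_mono)
next
  case (Mul t u)
  then obtain p p' where "tfits p t" "tfits p' u" by blast
  then show ?case by (auto intro!: exI[of _ "max p p'"] elim: tfits_mono)
qed auto

lemma fits_ex: "\<exists>p. fits p p \<phi>"
proof (induction \<phi>)
  case (Eq t u)
  obtain p p' where "tfits p t" "tfits p' u" using tfits_ex by blast
  then show ?case by (auto intro!: exI[of _ "max p p'"] elim: tfits_mono)
next
  case (Less t u)
  obtain p p' where "tfits p t" "tfits p' u" using tfits_ex by blast
  then show ?case by (auto intro!: exI[of _ "max p p'"] elim: tfits_mono)
next
  case (Mem t X)
  obtain p where "tfits p t" using tfits_ex by blast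
  then show ?case by (auto intro!: exI[of _ "max p (Suc X)"] elim: tfits_mono)
next
  case (Imp \<phi> \<psi>)
  then obtain p p' where "fits p p \<phi>" "fits p' p' \<psi>" by blast
  then show ?case by (auto intro!: exI[of _ "max p p'"] elim: fits_mono)
next
  case (All \<phi>)
  then obtain p where "fits p p \<phi>" by blast
  then show ?case by (auto intro!: exI[of _ p] elim: fits_mono)
next
  case (SAll \<phi>)
  then obtain p where "fits p p \<phi>" by blast
  then show ?case by (auto intro!: exI[of _ p] elim: fits_mono)
qed auto

section \<open>Completeness\<close>

lemma weaken: "\<Gamma> \<turnstile> \<phi> \<Longrightarrow> \<Gamma> \<subseteq> \<Gamma>' \<Longrightarrow> \<Gamma>' \<turnstile> \<phi>"
proof (induction arbitrary: \<Gamma>' rule: proves.induct)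
  case (Assm \<phi> \<Gamma>)
  then show ?case by (auto intro: proves.Assm)
next
  case (ImpI \<phi> \<Gamma> \<psi>)
  have "insert \<phi> \<Gamma>' \<turnstile> \<psi>" by (rule ImpI.IH) (use ImpI.prems in blast)
  then show ?case by (rule proves.ImpI)
next
  case (ImpE \<Gamma> \<phi> \<psi>)
  show ?case by (rule proves.ImpE[OF ImpE.IH(1)[OF ImpE.prems] ImpE.IH(2)[OF ImpE.prems]])
next
  case (Raa \<phi> \<Gamma>)
  have "insert (\<^bold>\<not> \<phi>) \<Gamma>' \<turnstile> Fls" by (rule Raa.IH) (use Raa.prems in blast)
  then show ?case by (rule proves.Raa)
next
  case (AllI \<Gamma> \<phi>)
  have "flift ` \<Gamma>' \<turnstile> \<phi>" by (rule AllI.IH) (use AllI.prems in blast)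
  then show ?case by (rule proves.AllI)
next
  case (AllE \<Gamma> \<phi> t)
  show ?case by (rule proves.AllE[OF AllE.IH[OF AllE.prems]])
next
  case (SAllI \<Gamma> \<phi>)
  have "slift ` \<Gamma>' \<turnstile> \<phi>" by (rule SAllI.IH) (use SAllI.prems in blast)
  then show ?case by (rule proves.SAllI)
next
  case (SAllE \<Gamma> \<phi> X)
  show ?case by (rule proves.SAllE[OF SAllE.IH[OF SAllE.prems]])
next
  case (EqRefl \<Gamma> t)
  show ?case by (rule proves.EqRefl)
next
  case (EqSubst \<Gamma> t u \<phi>)
  show ?case by (rule proves.EqSubst[OF EqSubst.IH(1)[OF EqSubst.prems] EqSubst.IH(2)[OF EqSubst.prems]])
qed

lemma compactness: "\<Gamma> \<turnstile> \<phi> \<Longrightarrow> \<exists>\<Gamma>'. finite \<Gamma>' \<and> \<Gamma>' \<subseteq> \<Gamma> \<and> (\<Gamma>' \<turnstile> \<phi>)"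
proof (induction rule: proves.induct)
  case (Assm \<phi> \<Gamma>)
  then show ?case by (intro exI[of _ "{\<phi>}"]) (auto intro: proves.Assm)
next
  case (ImpI \<phi> \<Gamma> \<psi>)
  then obtain \<Gamma>' where "finite \<Gamma>'" "\<Gamma>' \<subseteq> insert \<phi> \<Gamma>" "\<Gamma>' \<turnstile> \<psi>" by blast
  then show ?case
    by (intro exI[of _ "\<Gamma>' - {\<phi>}"]) (auto intro!: proves.ImpI elim!: weaken)
next
  case (ImpE \<Gamma> \<phi> \<psi>)
  then obtain A B where "finite A" "A \<subseteq> \<Gamma>" "A \<turnstile> \<phi> \<^bold>\<longrightarrow> \<psi>" "finite B" "B \<subseteq> \<Gamma>" "B \<turnstile> \<phi>" by blast
  then show ?case
    by (intro exI[of _ "A \<union> B"]) (auto intro: proves.ImpE[OF weaken weaken])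
next
  case (Raa \<phi> \<Gamma>)
  then obtain \<Gamma>' where "finite \<Gamma>'" "\<Gamma>' \<subseteq> insert (\<^bold>\<not> \<phi>) \<Gamma>" "\<Gamma>' \<turnstile> Fls" by blast
  then show ?case
    by (intro exI[of _ "\<Gamma>' - {\<^bold>\<not> \<phi>}"]) (auto intro!: proves.Raa elim!: weaken)
next
  case (AllI \<Gamma> \<phi>)
  then obtain \<Gamma>' where "finite \<Gamma>'" "\<Gamma>' \<subseteq> flift ` \<Gamma>" "\<Gamma>' \<turnstile> \<phi>" by blast
  then show ?case by (metis finite_subset_image proves.AllI)
next
  case (SAllI \<Gamma> \<phi>)
  then obtain \<Gamma>' where "finite \<Gamma>'" "\<Gamma>' \<subseteq> slift ` \<Gamma>" "\<Gamma>' \<turnstile> \<phi>" by blast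
  then show ?case by (metis finite_subset_image proves.SAllI)
next
  case (EqSubst \<Gamma> t u \<phi>)
  then obtain A B where "finite A" "A \<subseteq> \<Gamma>" "A \<turnstile> t \<^bold>= u" "finite B" "B \<subseteq> \<Gamma>" "B \<turnstile> inst t \<phi>" by blast
  then show ?case
    by (intro exI[of _ "A \<union> B"]) (auto intro: proves.EqSubst[OF weaken weaken])
next
  case (AllE \<Gamma> \<phi> t)
  then show ?case by (blast intro: proves.AllE)
next
  case (SAllE \<Gamma> \<phi> X)
  then show ?case by (blast intro: proves.SAllE)
next
  case (EqRefl \<Gamma> t)
  show ?case by (intro exI[of _ "{}"]) (auto intro: proves.EqRefl)
qed

section \<open>Derivability under substitution, and generalization over fresh variables\<close>

lemma fsub_flift: "fsub (up \<sigma>) \<rho> (flift \<phi>) = flift (fsub \<sigma> \<rho> \<phi>)"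
  by (simp add: flift_def fsub_fsub lift_1)

lemma fsub_slift: "fsub \<sigma> (sup_ren \<rho>) (slift \<phi>) = slift (fsub \<sigma> \<rho> \<phi>)"
  by (simp add: slift_def fsub_fsub)

lemma inst_fsub_up: "inst t (fsub (up \<sigma>) \<rho> \<phi>) = fsub (case_nat t \<sigma>) \<rho> \<phi>"
proof -
  have "(\<lambda>n. tsub (case_nat t Var) (up \<sigma> n)) = case_nat t \<sigma>"
    by (auto simp: fun_eq_iff lift_1 tsub_tsub split: nat.split)
  then show ?thesis by (simp add: inst_def fsub_fsub)
qed

lemma fsub_inst: "fsub \<sigma> \<rho> (inst t \<phi>) = inst (tsub \<sigma> t) (fsub (up \<sigma>) \<rho> \<phi>)"
proof -
  have "(\<lambda>n. tsub \<sigma> (case n of 0 \<Rightarrow> t | Suc x \<Rightarrow> Var x)) = case_nat (tsub \<sigma> t) \<sigma>"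
    by (auto simp: fun_eq_iff split: nat.split)
  then show ?thesis by (simp add: inst_fsub_up) (simp add: inst_def fsub_fsub)
qed

lemma sinst_fsub_up: "sinst X (fsub \<sigma> (sup_ren \<rho>) \<phi>) = fsub \<sigma> (case_nat X \<rho>) \<phi>"
proof -
  have "(\<lambda>n. case_nat X id (sup_ren \<rho> n)) = case_nat X \<rho>"
    by (auto simp: fun_eq_iff split: nat.split)
  then show ?thesis by (simp add: sinst_def fsub_fsub)
qed

lemma fsub_sinst: "fsub \<sigma> \<rho> (sinst X \<phi>) = sinst (\<rho> X) (fsub \<sigma> (sup_ren \<rho>) \<phi>)"
proof -
  have "(\<lambda>n. \<rho> (case_nat X id n)) = case_nat (\<rho> X) \<rho>"
    by (auto simp: fun_eq_iff split: nat.split)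
  then show ?thesis by (simp add: sinst_fsub_up) (simp add: sinst_def fsub_fsub)
qed

text \<open>Needed to exchange variables: the quantifier rules bind index 0 and shift the context,
  whereas a Henkin witness is some variable \<open>k\<close> absent from it.\<close>

lemma proves_fsub: "\<Gamma> \<turnstile> \<phi> \<Longrightarrow> fsub \<sigma> \<rho> ` \<Gamma> \<turnstile> fsub \<sigma> \<rho> \<phi>"
proof (induction arbitrary: \<sigma> \<rho> rule: proves.induct)
  case (ImpE \<Gamma> \<phi> \<psi>)
  then show ?case by (metis fsub.simps(5) proves.ImpE)
next
  case (Raa \<phi> \<Gamma>)
  have "insert (\<^bold>\<not> fsub \<sigma> \<rho> \<phi>) (fsub \<sigma> \<rho> ` \<Gamma>) \<turnstile> Fls" using Raa.IH[of \<sigma> \<rho>] by simp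
  then show ?case by (rule proves.Raa)
next
  case (AllI \<Gamma> \<phi>)
  have "flift ` fsub \<sigma> \<rho> ` \<Gamma> \<turnstile> fsub (up \<sigma>) \<rho> \<phi>"
    using AllI.IH[of "up \<sigma>" \<rho>] by (simp add: image_image fsub_flift)
  then show ?case by (simp add: proves.AllI)
next
  case (AllE \<Gamma> \<phi> t)
  show ?case unfolding fsub_inst using AllE.IH[of \<sigma> \<rho>] by (intro proves.AllE) simp
next
  case (SAllI \<Gamma> \<phi>)
  have "slift ` fsub \<sigma> \<rho> ` \<Gamma> \<turnstile> fsub \<sigma> (sup_ren \<rho>) \<phi>"
    using SAllI.IH[of \<sigma> "sup_ren \<rho>"] by (simp add: image_image fsub_slift)
  then show ?case by (simp add: proves.SAllI)
next
  case (SAllE \<Gamma> \<phi> X)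
  show ?case unfolding fsub_sinst using SAllE.IH[of \<sigma> \<rho>] by (intro proves.SAllE) simp
next
  case (EqSubst \<Gamma> t u \<phi>)
  show ?case using EqSubst.IH(1)[of \<sigma> \<rho>] EqSubst.IH(2)[of \<sigma> \<rho>]
    by (simp add: fsub_inst proves.EqSubst)
qed (auto intro: proves.intros)

text \<open>The substitution sending \<open>k\<close> to 0 and shifting all other variables agrees
  with \<open>flift\<close> on \<Gamma>, where \<open>k\<close> does not occur, and turns
  \<open>inst (Var k) \<psi>\<close> back into \<psi>.\<close>

lemma generalize_fresh:
  assumes "\<Gamma> \<turnstile> inst (Var k) \<psi>" "\<And>\<gamma>. \<gamma> \<in> \<Gamma> \<Longrightarrow> \<exists>q. fits k q \<gamma>" "fits (Suc k) q \<psi>"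
  shows "\<Gamma> \<turnstile> All \<psi>"
proof -
  define \<sigma> where "\<sigma> n = (if n = k then Var 0 else Var (Suc n))" for n
  have "fsub \<sigma> id \<gamma> = flift \<gamma>" if "\<gamma> \<in> \<Gamma>" for \<gamma>
    using assms(2)[OF that] unfolding flift_def by (auto intro!: fsub_cong simp: \<sigma>_def)
  then have "fsub \<sigma> id ` \<Gamma> = flift ` \<Gamma>" by (rule image_cong[OF refl])
  moreover have "fsub \<sigma> id (inst (Var k) \<psi>) = \<psi>"
  proof -
    have "fsub \<sigma> id (inst (Var k) \<psi>) = fsub Var id \<psi>"
      unfolding inst_def fsub_fsub
      by (rule fsub_cong[OF assms(3)]) (auto simp: \<sigma>_def split: nat.split)
    then show ?thesis by simp
  qed
  ultimately have "flift ` \<Gamma> \<turnstile> \<psi>" using proves_fsub[OF assms(1), of \<sigma> id] by simp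
  then show ?thesis by (rule proves.AllI)
qed

lemma sgeneralize_fresh:
  assumes "\<Gamma> \<turnstile> sinst k \<psi>" "\<And>\<gamma>. \<gamma> \<in> \<Gamma> \<Longrightarrow> \<exists>p. fits p k \<gamma>" "fits p (Suc k) \<psi>"
  shows "\<Gamma> \<turnstile> SAll \<psi>"
proof -
  define \<rho> where "\<rho> n = (if n = k then 0 else Suc n)" for n
  have "fsub Var \<rho> \<gamma> = slift \<gamma>" if "\<gamma> \<in> \<Gamma>" for \<gamma>
    using assms(2)[OF that] unfolding slift_def by (auto intro!: fsub_cong simp: \<rho>_def)
  then have "fsub Var \<rho> ` \<Gamma> = slift ` \<Gamma>" by (rule image_cong[OF refl])
  moreover have "fsub Var \<rho> (sinst k \<psi>) = \<psi>"
  proof -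
    have "fsub Var \<rho> (sinst k \<psi>) = fsub Var id \<psi>"
      unfolding sinst_def fsub_fsub
      by (rule fsub_cong[OF assms(3)]) (auto simp: \<rho>_def split: nat.split)
    then show ?thesis by simp
  qed
  ultimately have "slift ` \<Gamma> \<turnstile> \<psi>" using proves_fsub[OF assms(1), of Var \<rho>] by simp
  then show ?thesis by (rule proves.SAllI)
qed

section \<open>Complete sets of formulas with witnesses\<close>

instance trm :: countable by countable_datatype
instance fm :: countable by countable_datatype

abbreviation consistent :: "fm set \<Rightarrow> bool" where "consistent \<Gamma> \<equiv> \<not> (\<Gamma> \<turnstile> Fls)"

lemma Fls_elim: "\<Gamma> \<turnstile> Fls \<Longrightarrow> \<Gamma> \<turnstile> \<phi>"
  by (rule proves.Raa) (auto elim: weaken)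

lemma contr: "\<Gamma> \<turnstile> \<phi> \<Longrightarrow> \<Gamma> \<turnstile> \<^bold>\<not> \<phi> \<Longrightarrow> \<Gamma> \<turnstile> Fls"
  by (rule proves.ImpE)

lemma cut: "\<Gamma> \<turnstile> \<phi> \<Longrightarrow> insert \<phi> \<Gamma> \<turnstile> \<psi> \<Longrightarrow> \<Gamma> \<turnstile> \<psi>"
  by (meson proves.ImpE proves.ImpI)

definition sentence :: "fm \<Rightarrow> bool" where "sentence \<phi> \<longleftrightarrow> fits 0 0 \<phi>"

definition henkin_ext :: "fm set \<Rightarrow> fm \<Rightarrow> fm set \<Rightarrow> fm set \<Rightarrow> bool" where
  "henkin_ext \<Gamma> \<phi> F F' \<longleftrightarrow> F \<subseteq> F' \<and> finite F' \<and> consistent (\<Gamma> \<union> F') \<and>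
    (\<phi> \<in> F' \<or> \<not> consistent (insert \<phi> (\<Gamma> \<union> F))) \<and>
    (\<forall>\<psi>. \<phi> = (\<^bold>\<not> All \<psi>) \<and> \<phi> \<in> F' \<longrightarrow> (\<exists>k. (\<^bold>\<not> inst (Var k) \<psi>) \<in> F')) \<and>
    (\<forall>\<psi>. \<phi> = (\<^bold>\<not> SAll \<psi>) \<and> \<phi> \<in> F' \<longrightarrow> (\<exists>k. (\<^bold>\<not> sinst k \<psi>) \<in> F'))"

lemma henkin_step:
  assumes "consistent (\<Gamma> \<union> F)" "finite F" "\<And>\<gamma>. \<gamma> \<in> \<Gamma> \<Longrightarrow> sentence \<gamma>"
  shows "\<exists>F'. henkin_ext \<Gamma> \<phi> F F'"
proof (cases "consistent (insert \<phi> (\<Gamma> \<union> F))")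
  case False
  show ?thesis
  proof (cases "\<phi> \<in> F")
    case True
    then have "insert \<phi> (\<Gamma> \<union> F) = \<Gamma> \<union> F" by blast
    with False assms show ?thesis by simp
  next
    case notin: False
    show ?thesis unfolding henkin_ext_def by (rule exI[of _ F]) (use assms False notin in auto)
  qed
next
  case True
  let ?F = "insert \<phi> F"
  have fin: "finite ?F" using assms by simp
  have "\<exists>k. \<forall>\<gamma>\<in>F. fits k k \<gamma>" if "finite F" for F using that
  proof (induction F)
    case (insert x F)
    obtain k where "\<forall>\<gamma>\<in>F. fits k k \<gamma>" using insert by blast
    moreover obtain k' where "fits k' k' x" using fits_ex by blast
    ultimately have "fits (max k k') (max k k') \<gamma>" if "\<gamma> \<in> insert x F" for \<gamma>
      using that by (auto intro: fits_mono[of k k] fits_mono[of k' k'])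
    then show ?case by blast
  qed auto
  from this[OF fin] obtain k where k: "\<forall>\<gamma>\<in>?F. fits k k \<gamma>" by blast
  then have k': "fits k k \<gamma>" if "\<gamma> \<in> \<Gamma> \<union> ?F" for \<gamma>
    using that assms(3)[unfolded sentence_def] fits_mono[of 0 0 \<gamma> k k] by auto
  consider (all) \<psi> where "\<phi> = (\<^bold>\<not> All \<psi>)" | (sall) \<psi> where "\<phi> = (\<^bold>\<not> SAll \<psi>)"
    | (neither) "\<nexists>\<psi>. \<phi> = (\<^bold>\<not> All \<psi>)" "\<nexists>\<psi>. \<phi> = (\<^bold>\<not> SAll \<psi>)" by blast
  then show ?thesis
  proof cases
    case all
    have "consistent (insert (\<^bold>\<not> inst (Var k) \<psi>) (\<Gamma> \<union> ?F))"
    proof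
      assume "insert (\<^bold>\<not> inst (Var k) \<psi>) (\<Gamma> \<union> ?F) \<turnstile> Fls"
      then have "\<Gamma> \<union> ?F \<turnstile> inst (Var k) \<psi>" by (rule proves.Raa)
      moreover have "fits (Suc k) k \<psi>" using k all by auto
      ultimately have "\<Gamma> \<union> ?F \<turnstile> All \<psi>" using k' by (blast intro: generalize_fresh)
      moreover have "\<Gamma> \<union> ?F \<turnstile> \<^bold>\<not> All \<psi>" using all by (auto intro: proves.Assm)
      ultimately have "\<Gamma> \<union> ?F \<turnstile> Fls" by (rule contr)
      with True show False by simp
    qed
    then show ?thesis unfolding henkin_ext_def
      by (intro exI[of _ "insert (\<^bold>\<not> inst (Var k) \<psi>) ?F"]) (use all fin in auto)
  next
    case sall
    have "consistent (insert (\<^bold>\<not> sinst k \<psi>) (\<Gamma> \<union> ?F))"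
    proof
      assume "insert (\<^bold>\<not> sinst k \<psi>) (\<Gamma> \<union> ?F) \<turnstile> Fls"
      then have "\<Gamma> \<union> ?F \<turnstile> sinst k \<psi>" by (rule proves.Raa)
      moreover have "fits k (Suc k) \<psi>" using k sall by auto
      ultimately have "\<Gamma> \<union> ?F \<turnstile> SAll \<psi>" using k' by (blast intro: sgeneralize_fresh)
      moreover have "\<Gamma> \<union> ?F \<turnstile> \<^bold>\<not> SAll \<psi>" using sall by (auto intro: proves.Assm)
      ultimately have "\<Gamma> \<union> ?F \<turnstile> Fls" by (rule contr)
      with True show False by simp
    qed
    then show ?thesis unfolding henkin_ext_def
      by (intro exI[of _ "insert (\<^bold>\<not> sinst k \<psi>) ?F"]) (use sall fin in auto)
  next
    case neither
    then show ?thesis unfolding henkin_ext_def by (intro exI[of _ ?F]) (use True fin in auto)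
  qed
qed

definition henkin :: "fm set \<Rightarrow> bool" where
  "henkin \<Delta> \<longleftrightarrow> (\<forall>\<phi>. (\<Delta> \<turnstile> \<phi>) \<longleftrightarrow> \<phi> \<in> \<Delta>) \<and> (\<forall>\<phi>. (\<^bold>\<not> \<phi>) \<in> \<Delta> \<longleftrightarrow> \<phi> \<notin> \<Delta>) \<and>
    (\<forall>\<psi>. (\<forall>k. inst (Var k) \<psi> \<in> \<Delta>) \<longrightarrow> All \<psi> \<in> \<Delta>) \<and>
    (\<forall>\<psi>. (\<forall>k. sinst k \<psi> \<in> \<Delta>) \<longrightarrow> SAll \<psi> \<in> \<Delta>)"

lemma henkin_extension:
  assumes "consistent \<Gamma>" "\<And>\<gamma>. \<gamma> \<in> \<Gamma> \<Longrightarrow> sentence \<gamma>"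
  shows "\<exists>\<Delta>. \<Gamma> \<subseteq> \<Delta> \<and> henkin \<Delta>"
proof -
  define nxt where "nxt \<phi> F = (SOME F'. henkin_ext \<Gamma> \<phi> F F')" for \<phi> F
  have nxt: "henkin_ext \<Gamma> \<phi> F (nxt \<phi> F)"
    if "consistent (\<Gamma> \<union> F)" "finite F" for \<phi> F
    unfolding nxt_def by (rule someI_ex) (rule henkin_step[OF that assms(2)])
  define S where "S = rec_nat {} (\<lambda>n F. nxt (from_nat n) F)"
  have S_Suc: "S (Suc n) = nxt (from_nat n) (S n)" for n by (simp add: S_def)
  have S: "consistent (\<Gamma> \<union> S n) \<and> finite (S n)" for n
  proof (induction n)
    case 0 then show ?case using assms by (simp add: S_def)
  next
    case (Suc n) then show ?case using nxt unfolding henkin_ext_def by (simp add: S_Suc)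
  qed
  have "S n \<subseteq> S (Suc n)" for n using S nxt unfolding henkin_ext_def by (simp add: S_Suc)
  then have mono: "n \<le> m \<Longrightarrow> S n \<subseteq> S m" for n m by (rule lift_Suc_mono_le)
  define \<Delta> where "\<Delta> = \<Gamma> \<union> (\<Union>n. S n)"
  have consD: "consistent \<Delta>"
  proof
    assume "\<Delta> \<turnstile> Fls"
    then obtain G where G: "finite G" "G \<subseteq> \<Delta>" "G \<turnstile> Fls" using compactness by blast
    have "\<exists>n. G \<subseteq> \<Gamma> \<union> S n" using G(1,2)
    proof (induction G)
      case (insert x G)
      then obtain n where n: "G \<subseteq> \<Gamma> \<union> S n" by blast
      obtain m where "x \<in> \<Gamma> \<union> S m" using insert unfolding \<Delta>_def by auto
      then have "insert x G \<subseteq> \<Gamma> \<union> S (max n m)"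
        using n mono[of n "max n m"] mono[of m "max n m"] by auto
      then show ?case by blast
    qed auto
    then show False using S G(3) weaken by blast
  qed
  \<comment> \<open>Each formula is treated at the stage given by its code, and is either accepted
    or refuted there.\<close>
  have dec: "\<phi> \<in> \<Delta> \<or> (insert \<phi> \<Delta> \<turnstile> Fls)" for \<phi>
  proof -
    let ?n = "to_nat \<phi>"
    have "\<phi> \<in> S (Suc ?n) \<or> \<not> consistent (insert \<phi> (\<Gamma> \<union> S ?n))"
      using nxt[of "S ?n" \<phi>] S unfolding henkin_ext_def by (simp add: S_Suc)
    moreover have "insert \<phi> (\<Gamma> \<union> S ?n) \<subseteq> insert \<phi> \<Delta>" "S (Suc ?n) \<subseteq> \<Delta>" unfolding \<Delta>_def by auto
    ultimately show ?thesis using weaken by blast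
  qed
  have closed: "(\<Delta> \<turnstile> \<phi>) \<longleftrightarrow> \<phi> \<in> \<Delta>" for \<phi>
    using dec[of \<phi>] consD cut proves.Assm by blast
  have neg: "(\<^bold>\<not> \<phi>) \<in> \<Delta> \<longleftrightarrow> \<phi> \<notin> \<Delta>" for \<phi>
    using dec[of \<phi>] consD closed contr proves.ImpI by metis
  have wit: "\<exists>k. inst (Var k) \<psi> \<notin> \<Delta>" if "All \<psi> \<notin> \<Delta>" for \<psi>
  proof -
    let ?p = "\<^bold>\<not> All \<psi>" let ?n = "to_nat ?p"
    have "?p \<in> \<Delta>" using that neg by blast
    have "?p \<in> S (Suc ?n) \<or> \<not> consistent (insert ?p (\<Gamma> \<union> S ?n))"
      using nxt[of "S ?n" ?p] S unfolding henkin_ext_def by (simp add: S_Suc)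
    moreover have "insert ?p (\<Gamma> \<union> S ?n) \<subseteq> \<Delta>" using \<open>?p \<in> \<Delta>\<close> by (auto simp: \<Delta>_def)
    ultimately have "?p \<in> S (Suc ?n)" using consD weaken by blast
    then obtain k where "(\<^bold>\<not> inst (Var k) \<psi>) \<in> S (Suc ?n)"
      using nxt[of "S ?n" ?p] S unfolding henkin_ext_def by (auto simp: S_Suc)
    then have "(\<^bold>\<not> inst (Var k) \<psi>) \<in> \<Delta>" by (auto simp: \<Delta>_def)
    then show ?thesis using neg by blast
  qed
  have swit: "\<exists>k. sinst k \<psi> \<notin> \<Delta>" if "SAll \<psi> \<notin> \<Delta>" for \<psi>
  proof -
    let ?p = "\<^bold>\<not> SAll \<psi>" let ?n = "to_nat ?p"
    have "?p \<in> \<Delta>" using that neg by blast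
    have "?p \<in> S (Suc ?n) \<or> \<not> consistent (insert ?p (\<Gamma> \<union> S ?n))"
      using nxt[of "S ?n" ?p] S unfolding henkin_ext_def by (simp add: S_Suc)
    moreover have "insert ?p (\<Gamma> \<union> S ?n) \<subseteq> \<Delta>" using \<open>?p \<in> \<Delta>\<close> by (auto simp: \<Delta>_def)
    ultimately have "?p \<in> S (Suc ?n)" using consD weaken by blast
    then obtain k where "(\<^bold>\<not> sinst k \<psi>) \<in> S (Suc ?n)"
      using nxt[of "S ?n" ?p] S unfolding henkin_ext_def by (auto simp: S_Suc)
    then have "(\<^bold>\<not> sinst k \<psi>) \<in> \<Delta>" by (auto simp: \<Delta>_def)
    then show ?thesis using neg by blast
  qed
  have "\<Gamma> \<subseteq> \<Delta>" by (simp add: \<Delta>_def)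
  moreover have "henkin \<Delta>" unfolding henkin_def using closed neg wit swit by blast
  ultimately show ?thesis by blast
qed

section \<open>Structures for second-order arithmetic\<close>

text \<open>Henkin structures: set quantifiers range over \<open>sets\<close>. The equality symbol
  is read as the relation \<open>eqr\<close>, so that a term model can be used as it is; a quotient
  is formed only for the one model fixed later.\<close>

record 'a str =
  zr :: 'a
  un :: 'a
  ad :: "'a \<Rightarrow> 'a \<Rightarrow> 'a"
  ml :: "'a \<Rightarrow> 'a \<Rightarrow> 'a"
  eqr :: "'a \<Rightarrow> 'a \<Rightarrow> bool"
  ls :: "'a \<Rightarrow> 'a \<Rightarrow> bool"
  sets :: "'a set set"

abbreviation cons :: "'a \<Rightarrow> (nat \<Rightarrow> 'a) \<Rightarrow> nat \<Rightarrow> 'a" (infixr "##" 65) where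
  "x ## e \<equiv> case_nat x e"

primrec tv :: "('a, 'b) str_scheme \<Rightarrow> (nat \<Rightarrow> 'a) \<Rightarrow> trm \<Rightarrow> 'a" where
  "tv M e (Var n) = e n"
| "tv M e Zero = zr M"
| "tv M e One = un M"
| "tv M e (t \<^bold>+ u) = ad M (tv M e t) (tv M e u)"
| "tv M e (t \<^bold>* u) = ml M (tv M e t) (tv M e u)"

primrec sat :: "('a, 'b) str_scheme \<Rightarrow> (nat \<Rightarrow> 'a) \<Rightarrow> (nat \<Rightarrow> 'a set) \<Rightarrow> fm \<Rightarrow> bool" where
  "sat M e B Fls \<longleftrightarrow> False"
| "sat M e B (t \<^bold>= u) \<longleftrightarrow> eqr M (tv M e t) (tv M e u)"
| "sat M e B (t \<^bold>< u) \<longleftrightarrow> ls M (tv M e t) (tv M e u)"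
| "sat M e B (t \<^bold>\<in> X) \<longleftrightarrow> tv M e t \<in> B X"
| "sat M e B (\<phi> \<^bold>\<longrightarrow> \<psi>) \<longleftrightarrow> (sat M e B \<phi> \<longrightarrow> sat M e B \<psi>)"
| "sat M e B (All \<phi>) \<longleftrightarrow> (\<forall>x. sat M (x ## e) B \<phi>)"
| "sat M e B (SAll \<phi>) \<longleftrightarrow> (\<forall>X\<in>sets M. sat M e (X ## B) \<phi>)"

lemma tv_tsub: "tv M e (tsub \<sigma> t) = tv M (\<lambda>n. tv M e (\<sigma> n)) t"
  by (induction t) auto

lemma tv_lift [simp]: "tv M e (lift k t) = tv M (\<lambda>n. e (n + k)) t"
  by (simp add: lift_def tv_tsub)

lemma cons_shift [simp]: "(\<lambda>n. (x ## e) (n + 1)) = e" "(\<lambda>n. (x ## e) (Suc n)) = e"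
  by (simp_all add: One_nat_def)

lemma tv_up: "(\<lambda>n. tv M (x ## e) (up \<sigma> n)) = x ## (\<lambda>n. tv M e (\<sigma> n))"
  by (auto simp: fun_eq_iff split: nat.split)

lemma sup_ren_cons: "(\<lambda>n. (X ## B) (sup_ren \<rho> n)) = X ## (\<lambda>n. B (\<rho> n))"
  by (auto simp: fun_eq_iff split: nat.split)

lemma sat_fsub: "sat M e B (fsub \<sigma> \<rho> \<phi>) = sat M (\<lambda>n. tv M e (\<sigma> n)) (\<lambda>n. B (\<rho> n)) \<phi>"
proof (induction \<phi> arbitrary: e B \<sigma> \<rho>)
  case (All \<phi>)
  show ?case by (simp add: All.IH tv_up)
next
  case (SAll \<phi>)
  show ?case by (simp add: SAll.IH sup_ren_cons)
qed (auto simp: tv_tsub)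

lemma tv_cong: "tfits p t \<Longrightarrow> (\<And>n. n < p \<Longrightarrow> e n = e' n) \<Longrightarrow> tv M e t = tv M e' t"
  by (induction t) auto

lemma sat_cong:
  "fits p q \<phi> \<Longrightarrow> (\<And>n. n < p \<Longrightarrow> e n = e' n) \<Longrightarrow> (\<And>n. n < q \<Longrightarrow> B n = B' n) \<Longrightarrow>
   sat M e B \<phi> = sat M e' B' \<phi>"
proof (induction \<phi> arbitrary: p q e e' B B')
  case (Eq t u)
  then show ?case using tv_cong[of p t e e' M] tv_cong[of p u e e' M] by simp
next
  case (Less t u)
  then show ?case using tv_cong[of p t e e' M] tv_cong[of p u e e' M] by simp
next
  case (Mem t X)
  then show ?case using tv_cong[of p t e e' M] by simp
next
  case (Imp \<phi> \<psi>)
  have "sat M e B \<phi> = sat M e' B' \<phi>" by (rule Imp.IH(1)) (use Imp.prems in auto)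
  moreover have "sat M e B \<psi> = sat M e' B' \<psi>" by (rule Imp.IH(2)) (use Imp.prems in auto)
  ultimately show ?case by simp
next
  case (All \<phi>)
  have "sat M (x ## e) B \<phi> = sat M (x ## e') B' \<phi>" for x
    by (rule All.IH[of "Suc p" q]) (use All.prems in \<open>auto split: nat.split\<close>)
  then show ?case by simp
next
  case (SAll \<phi>)
  have "sat M e (X ## B) \<phi> = sat M e' (X ## B') \<phi>" for X
    by (rule SAll.IH[of p "Suc q"]) (use SAll.prems in \<open>auto split: nat.split\<close>)
  then show ?case by simp
qed auto

lemma sat_inst [simp]: "sat M e B (inst t \<phi>) = sat M (tv M e t ## e) B \<phi>"
proof -
  have "(\<lambda>n. tv M e (case_nat t Var n)) = tv M e t ## e"
    by (auto simp: fun_eq_iff split: nat.split)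
  then show ?thesis by (simp add: inst_def sat_fsub)
qed

lemma sat_slift [simp]: "sat M e (X ## B) (slift \<phi>) = sat M e B \<phi>"
  by (simp add: slift_def sat_fsub)

lemma sat_induction: "sat M e B (induction \<phi>) \<longleftrightarrow>
  (sat M (zr M ## e) B \<phi> \<and> (\<forall>x. sat M (x ## e) B \<phi> \<longrightarrow> sat M (ad M x (un M) ## e) B \<phi>) \<longrightarrow>
   (\<forall>x. sat M (x ## e) B \<phi>))"
proof -
  have "(\<lambda>n. tv M (x ## e) (case_nat (Var 0 \<^bold>+ One) (\<lambda>n. Var (Suc n)) n)) = ad M x (un M) ## e" for x
    by (auto simp: fun_eq_iff split: nat.split)
  then show ?thesis by (simp add: induction_def sat_fsub)
qed

lemma sat_comprehension:
  "sat M e B (comprehension \<phi>) \<longleftrightarrow> (\<exists>X\<in>sets M. \<forall>x. x \<in> X \<longleftrightarrow> sat M (x ## e) B \<phi>)"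
  by (auto simp: comprehension_def)

lemma sat_All_pow:
  "sat M e B ((All ^^ p) \<phi>) \<longleftrightarrow> (\<forall>e'. (\<forall>n. e' (n + p) = e n) \<longrightarrow> sat M e' B \<phi>)"
proof (induction p arbitrary: e)
  case 0
  show ?case by simp (metis ext)
next
  case (Suc p)
  have *: "(\<forall>n. e' (n + p) = (x ## e) n) \<longleftrightarrow> e' p = x \<and> (\<forall>n. e' (n + Suc p) = e n)" for e' x
    by (auto split: nat.split)
  show ?case by (simp add: Suc.IH) (metis (no_types, lifting) * add_Suc_right)
qed

lemma sat_SAll_pow:
  "sat M e B ((SAll ^^ q) \<phi>) \<longleftrightarrow>
   (\<forall>B'. (\<forall>n. B' (n + q) = B n) \<longrightarrow> (\<forall>n<q. B' n \<in> sets M) \<longrightarrow> sat M e B' \<phi>)"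
proof (induction q arbitrary: B)
  case 0
  show ?case by simp (metis ext)
next
  case (Suc q)
  have *: "(\<forall>n. B' (n + q) = (X ## B) n) \<longleftrightarrow> B' q = X \<and> (\<forall>n. B' (n + Suc q) = B n)" for B' :: "nat \<Rightarrow> 'a set" and X
    by (auto split: nat.split)
  have "sat M e B ((SAll ^^ Suc q) \<phi>) \<longleftrightarrow> (\<forall>X\<in>sets M. \<forall>B'. B' q = X \<and> (\<forall>n. B' (n + Suc q) = B n) \<longrightarrow>
      (\<forall>n<q. B' n \<in> sets M) \<longrightarrow> sat M e B' \<phi>)"
    by (simp only: funpow.simps comp_apply sat.simps Suc.IH *)
  also have "\<dots> \<longleftrightarrow> (\<forall>B'. (\<forall>n. B' (n + Suc q) = B n) \<longrightarrow> (\<forall>n<Suc q. B' n \<in> sets M) \<longrightarrow> sat M e B' \<phi>)"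
    by (metis less_Suc_eq)
  finally show ?case .
qed

lemma sat_closure:
  fixes M :: "('a, 'b) str_scheme"
  assumes "fits p q \<phi>" "sets M \<noteq> {}"
  shows "sat M e B ((All ^^ p) ((SAll ^^ q) \<phi>)) \<longleftrightarrow>
    (\<forall>e B. (\<forall>n. B n \<in> sets M) \<longrightarrow> sat M e B \<phi>)" (is "?l \<longleftrightarrow> ?r")
proof
  assume l: ?l
  show ?r
  proof (intro allI impI)
    fix e' and B' :: "nat \<Rightarrow> 'a set" assume B': "\<forall>n. B' n \<in> sets M"
    let ?e = "\<lambda>n. if n < p then e' n else e (n - p)"
    let ?B = "\<lambda>n. if n < q then B' n else B (n - q)"
    have "sat M ?e ?B \<phi>" using l B' unfolding sat_All_pow sat_SAll_pow by auto
    moreover have "sat M ?e ?B \<phi> = sat M e' B' \<phi>" by (rule sat_cong[OF assms(1)]) auto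
    ultimately show "sat M e' B' \<phi>" by simp
  qed
next
  assume r: ?r
  obtain X where X: "X \<in> sets M" using assms by blast
  show ?l unfolding sat_All_pow sat_SAll_pow
  proof (intro allI impI)
    fix e' and B' :: "nat \<Rightarrow> 'a set" assume B': "\<forall>n<q. B' n \<in> sets M"
    \<comment> \<open>Only the first \<open>q\<close> sets of \<open>B'\<close> are known to lie in
      the structure; beyond the set variables of \<phi> the member \<open>X\<close> is filled
      in.\<close>
    let ?B = "\<lambda>n. if n < q then B' n else X"
    have "sat M e' ?B \<phi>" using r B' X by auto
    moreover have "sat M e' ?B \<phi> = sat M e' B' \<phi>" by (rule sat_cong[OF assms(1)]) auto
    ultimately show "sat M e' B' \<phi>" by simp
  qed
qed

lemma sat_closures:
  assumes "sets M \<noteq> {}"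
  shows "(\<forall>\<phi>\<in>closures S. sat M e B \<phi>) \<longleftrightarrow>
    (\<forall>\<phi>\<in>S. \<forall>e B. (\<forall>n. B n \<in> sets M) \<longrightarrow> sat M e B \<phi>)" (is "?l \<longleftrightarrow> ?r")
proof
  assume l: ?l
  show ?r
  proof
    fix \<phi> assume "\<phi> \<in> S"
    obtain p where p: "fits p p \<phi>" using fits_ex by blast
    then have "(All ^^ p) ((SAll ^^ p) \<phi>) \<in> closures S"
      using \<open>\<phi> \<in> S\<close> unfolding closures_def by blast
    then show "\<forall>e B. (\<forall>n. B n \<in> sets M) \<longrightarrow> sat M e B \<phi>"
      using l sat_closure[OF p assms] by blast
  qed
next
  assume r: ?r
  show ?l
  proof
    fix \<psi> assume "\<psi> \<in> closures S"
    then obtain p q \<phi> where "\<psi> = (All ^^ p) ((SAll ^^ q) \<phi>)" "\<phi> \<in> S" "fits p q \<phi>"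
      unfolding closures_def by blast
    then show "sat M e B \<psi>" using r sat_closure[OF _ assms] by auto
  qed
qed

lemma fits_All_pow: "fits p' q ((All ^^ p) \<phi>) = fits (p + p') q \<phi>"
  by (induction p arbitrary: p') auto

lemma fits_SAll_pow: "fits p q' ((SAll ^^ q) \<phi>) = fits p (q + q') \<phi>"
  by (induction q arbitrary: q') auto

lemma sentence_closures: "\<phi> \<in> closures S \<Longrightarrow> sentence \<phi>"
  by (auto simp: closures_def sentence_def fits_All_pow fits_SAll_pow)

lemma sat_sentence: "sentence \<phi> \<Longrightarrow> sat M e B \<phi> = sat M e' B' \<phi>"
  unfolding sentence_def by (rule sat_cong) auto

text \<open>The relations and the family of sets are pulled back along \<open>h\<close>, which need
  not be injective. This connects structures on terms with the natural numbers and with the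
  quotient.\<close>

lemma sat_hom:
  assumes h: "surj h" "h (zr M) = zr N" "h (un M) = un N"
    "\<And>x y. h (ad M x y) = ad N (h x) (h y)" "\<And>x y. h (ml M x y) = ml N (h x) (h y)"
    "\<And>x y. eqr M x y = eqr N (h x) (h y)" "\<And>x y. ls M x y = ls N (h x) (h y)"
    "sets M = (\<lambda>X. h -` X) ` sets N"
  shows "sat M e (\<lambda>n. h -` B n) \<phi> = sat N (\<lambda>n. h (e n)) B \<phi>"
proof -
  have tv: "h (tv M e t) = tv N (\<lambda>n. h (e n)) t" for e t
    by (induction t) (simp_all add: h)
  have c: "(\<lambda>n. h ((x ## e) n)) = h x ## (\<lambda>n. h (e n))" for x e
    by (rule ext) (auto split: nat.split)
  have d: "(h -` X) ## (\<lambda>n. h -` B n) = (\<lambda>n. h -` (X ## B) n)" for X B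
    by (rule ext) (auto split: nat.split)
  show ?thesis
  proof (induction \<phi> arbitrary: e B)
    case (All \<phi>)
    have "(\<forall>x. sat N (h x ## (\<lambda>n. h (e n))) B \<phi>) = (\<forall>x. sat N (x ## (\<lambda>n. h (e n))) B \<phi>)"
      using h(1) by (metis surjD)
    then show ?case by (simp add: All.IH c)
  next
    case (SAll \<phi>)
    show ?case by (simp add: h d SAll.IH)
  qed (auto simp: tv h)
qed

section \<open>Term models\<close>

text \<open>All countermodels share the carrier \<open>trm\<close> and differ in three parameters
  only, so that HOL can quantify over them and choose one.\<close>

definition tstr :: "(trm \<Rightarrow> trm \<Rightarrow> bool) \<Rightarrow> (trm \<Rightarrow> trm \<Rightarrow> bool) \<Rightarrow> trm set set \<Rightarrow> trm str" where
  "tstr E L S = \<lparr>zr = Zero, un = One, ad = Add, ml = Mul, eqr = E, ls = L, sets = S\<rparr>"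

lemma tstr_simps [simp]:
  "zr (tstr E L S) = Zero" "un (tstr E L S) = One" "ad (tstr E L S) = Add" "ml (tstr E L S) = Mul"
  "eqr (tstr E L S) = E" "ls (tstr E L S) = L" "sets (tstr E L S) = S"
  by (simp_all add: tstr_def)

definition premodel :: "(trm \<Rightarrow> trm \<Rightarrow> bool) \<Rightarrow> (trm \<Rightarrow> trm \<Rightarrow> bool) \<Rightarrow> trm set set \<Rightarrow> bool" where
  "premodel E L S \<longleftrightarrow> equivp E \<and> (\<forall>t t' u u'. E t t' \<longrightarrow> E u u' \<longrightarrow>
     E (t \<^bold>+ u) (t' \<^bold>+ u') \<and> E (t \<^bold>* u) (t' \<^bold>* u') \<and> (L t u \<longrightarrow> L t' u')) \<and>
     (\<forall>X\<in>S. \<forall>t t'. E t t' \<longrightarrow> t \<in> X \<longrightarrow> t' \<in> X) \<and> S \<noteq> {}"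

lemma tv_tstr: "tv (tstr E L S) e t = tsub e t"
  by (induction t) auto

lemma tsub_case_lift [simp]: "tsub (t ## Var) (lift 1 u) = u"
  by (simp add: lift_1 tsub_tsub)

text \<open>The carrier consists of open terms because the witnesses are variables; likewise the
  sets are the extensions \<open>D n\<close> of the set variables. The truth lemma is proved for all
  substitution instances at once, as the quantifier cases demand.\<close>

lemma henkin_model:
  assumes "henkin \<Delta>"
  obtains E L S where "premodel E L S"
    "\<And>\<phi> e B. sentence \<phi> \<Longrightarrow> sat (tstr E L S) e B \<phi> \<longleftrightarrow> \<phi> \<in> \<Delta>"
proof -
  define E where "E t u \<longleftrightarrow> (t \<^bold>= u) \<in> \<Delta>" for t u
  define L where "L t u \<longleftrightarrow> (t \<^bold>< u) \<in> \<Delta>" for t u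
  define D where "D n = {t. (t \<^bold>\<in> n) \<in> \<Delta>}" for n
  define S where "S = range D"
  have closed: "\<Delta> \<turnstile> \<phi> \<Longrightarrow> \<phi> \<in> \<Delta>" "\<phi> \<in> \<Delta> \<Longrightarrow> \<Delta> \<turnstile> \<phi>"
    and neg: "(\<^bold>\<not> \<phi>) \<in> \<Delta> \<longleftrightarrow> \<phi> \<notin> \<Delta>"
    and wit: "(\<And>k. inst (Var k) \<psi> \<in> \<Delta>) \<Longrightarrow> All \<psi> \<in> \<Delta>"
    and swit: "(\<And>k. sinst k \<psi> \<in> \<Delta>) \<Longrightarrow> SAll \<psi> \<in> \<Delta>" for \<phi> \<psi>
    using assms unfolding henkin_def by blast+
  have subst: "inst u \<phi> \<in> \<Delta>" if "E t u" "inst t \<phi> \<in> \<Delta>" for t u \<phi>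
    using that closed proves.EqSubst unfolding E_def by blast
  have refl: "E t t" for t unfolding E_def by (rule closed(1)) (rule proves.EqRefl)
  have sym: "E u t" if "E t u" for t u
    using subst[OF that, of "Var 0 \<^bold>= lift 1 t"] refl by (simp add: inst_def E_def)
  have trans: "E t v" if "E t u" "E u v" for t u v
    using subst[OF that(2), of "lift 1 t \<^bold>= Var 0"] that(1) by (simp add: inst_def E_def)
  have add: "E (t \<^bold>+ u) (t' \<^bold>+ u')" if "E t t'" "E u u'" for t t' u u'
    using subst[OF that(1), of "lift 1 (t \<^bold>+ u) \<^bold>= Var 0 \<^bold>+ lift 1 u"] refl
      subst[OF that(2), of "lift 1 (t \<^bold>+ u) \<^bold>= lift 1 t' \<^bold>+ Var 0"]
    by (simp add: inst_def E_def)
  have mul: "E (t \<^bold>* u) (t' \<^bold>* u')" if "E t t'" "E u u'" for t t' u u'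
    using subst[OF that(1), of "lift 1 (t \<^bold>* u) \<^bold>= Var 0 \<^bold>* lift 1 u"] refl
      subst[OF that(2), of "lift 1 (t \<^bold>* u) \<^bold>= lift 1 t' \<^bold>* Var 0"]
    by (simp add: inst_def E_def)
  have less: "L t' u'" if "E t t'" "E u u'" "L t u" for t t' u u'
    using subst[OF that(1), of "Var 0 \<^bold>< lift 1 u"] that(3)
      subst[OF that(2), of "lift 1 t' \<^bold>< Var 0"]
    by (simp add: inst_def L_def)
  have mem: "t' \<in> D n" if "E t t'" "t \<in> D n" for t t' n
    using subst[OF that(1), of "Var 0 \<^bold>\<in> n"] that(2) by (simp add: inst_def D_def)
  have "equivp E" using refl sym trans by (blast intro: equivpI reflpI sympI transpI)
  then have pm: "premodel E L S"
    unfolding premodel_def S_def using add mul less mem by blast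
  have imp: "(\<phi> \<^bold>\<longrightarrow> \<psi>) \<in> \<Delta> \<longleftrightarrow> (\<phi> \<in> \<Delta> \<longrightarrow> \<psi> \<in> \<Delta>)" for \<phi> \<psi>
  proof
    assume "(\<phi> \<^bold>\<longrightarrow> \<psi>) \<in> \<Delta>"
    then show "\<phi> \<in> \<Delta> \<longrightarrow> \<psi> \<in> \<Delta>" using closed proves.ImpE by blast
  next
    assume r: "\<phi> \<in> \<Delta> \<longrightarrow> \<psi> \<in> \<Delta>"
    show "(\<phi> \<^bold>\<longrightarrow> \<psi>) \<in> \<Delta>"
    proof (cases "\<phi> \<in> \<Delta>")
      case True
      with r have "\<Delta> \<turnstile> \<psi>" using closed by blast
      then have "insert \<phi> \<Delta> \<turnstile> \<psi>" by (rule weaken) blast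
      then show ?thesis using closed proves.ImpI by blast
    next
      case False
      then have "\<Delta> \<turnstile> \<^bold>\<not> \<phi>" using neg closed by blast
      then have "insert \<phi> \<Delta> \<turnstile> \<^bold>\<not> \<phi>" by (rule weaken) blast
      moreover have "insert \<phi> \<Delta> \<turnstile> \<phi>" by (rule proves.Assm) blast
      ultimately have "insert \<phi> \<Delta> \<turnstile> \<psi>" using contr Fls_elim by blast
      then show ?thesis using closed proves.ImpI by blast
    qed
  qed
  have all: "All \<psi> \<in> \<Delta> \<longleftrightarrow> (\<forall>t. inst t \<psi> \<in> \<Delta>)" for \<psi>
    using closed proves.AllE wit by blast
  have sall: "SAll \<psi> \<in> \<Delta> \<longleftrightarrow> (\<forall>k. sinst k \<psi> \<in> \<Delta>)" for \<psi>
    using closed proves.SAllE swit by blast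
  have c: "(D X ## (\<lambda>n. D (B n))) = (\<lambda>n. D ((X ## B) n))" for X B
    by (rule ext) (auto split: nat.split)
  have truth: "sat (tstr E L S) e (\<lambda>n. D (B n)) \<phi> \<longleftrightarrow> fsub e B \<phi> \<in> \<Delta>" for e B \<phi>
  proof (induction \<phi> arbitrary: e B)
    case Fls
    show ?case using neg[of Fls] imp[of Fls Fls] by auto
  next
    case (All \<phi>)
    show ?case by (simp add: All.IH all inst_fsub_up)
  next
    case (SAll \<phi>)
    have "(\<forall>X\<in>S. P X) \<longleftrightarrow> (\<forall>k. P (D k))" for P by (auto simp: S_def)
    then show ?case by (simp add: SAll.IH sall sinst_fsub_up c)
  qed (auto simp: tv_tstr E_def L_def D_def imp)
  have "sat (tstr E L S) e B \<phi> \<longleftrightarrow> \<phi> \<in> \<Delta>" if "sentence \<phi>" for e B \<phi>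
    using truth[of Var id \<phi>] sat_sentence[OF that, of "tstr E L S" e B Var "\<lambda>n. D (id n)"] by simp
  with pm show ?thesis by (rule that)
qed

theorem completeness:
  assumes "\<not> (\<Gamma> \<turnstile> \<phi>)" "\<And>\<gamma>. \<gamma> \<in> \<Gamma> \<Longrightarrow> sentence \<gamma>" "sentence \<phi>"
  obtains E L S where "premodel E L S" "\<And>\<gamma> e B. \<gamma> \<in> \<Gamma> \<Longrightarrow> sat (tstr E L S) e B \<gamma>"
    "\<And>e B. \<not> sat (tstr E L S) e B \<phi>"
proof -
  let ?G = "insert (\<^bold>\<not> \<phi>) \<Gamma>"
  have "consistent ?G" using assms(1) proves.Raa by blast
  moreover have sent: "sentence \<gamma>" if "\<gamma> \<in> ?G" for \<gamma>
    using that assms by (auto simp: sentence_def)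
  ultimately obtain \<Delta> where D: "?G \<subseteq> \<Delta>" "henkin \<Delta>" using henkin_extension by blast
  obtain E L S where m: "premodel E L S"
    "\<And>\<phi> e B. sentence \<phi> \<Longrightarrow> sat (tstr E L S) e B \<phi> \<longleftrightarrow> \<phi> \<in> \<Delta>"
    using henkin_model[OF D(2)] by blast
  have "sat (tstr E L S) e B \<gamma>" if "\<gamma> \<in> ?G" for \<gamma> e B using m(2)[OF sent[OF that]] that D by blast
  from this[of "\<^bold>\<not> \<phi>"] this show ?thesis by (intro that[OF m(1)]) auto
qed

section \<open>The universal counterexample\<close>

definition Std :: "nat str" where
  "Std = \<lparr>zr = 0, un = 1, ad = (+), ml = (*), eqr = (=), ls = (<), sets = UNIV\<rparr>"

text \<open>Some model of \<open>RCA0\<close> has to exist before one can be chosen; the full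
  standard model is one.\<close>

lemma Std_RCA0: "\<forall>\<phi>\<in>RCA0. sat Std e B \<phi>"
  unfolding RCA0_def
proof (subst sat_closures)
  show "sets Std \<noteq> {}" by (simp add: Std_def)
  have S: "zr Std = 0" "un Std = 1" "ad Std = (+)" "ml Std = (*)" "eqr Std = (=)" "ls Std = (<)"
    "sets Std = UNIV"
    by (simp_all add: Std_def)
  have "sat Std e B \<phi>" if "\<phi> \<in> basic_axioms" for e B \<phi>
    using that by (auto simp: basic_axioms_def Let_def S algebra_simps)
  moreover have "sat Std e B (induction \<phi>)" for e B \<phi>
    unfolding sat_induction S
  proof (intro impI allI)
    fix x assume "sat Std (0 ## e) B \<phi> \<and> (\<forall>x. sat Std (x ## e) B \<phi> \<longrightarrow> sat Std ((x + 1) ## e) B \<phi>)"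
    then show "sat Std (x ## e) B \<phi>" by (induction x) (auto simp: One_nat_def)
  qed
  moreover have "sat Std e B (comprehension \<phi>)" for e B \<phi>
    unfolding sat_comprehension S by (rule bexI[of _ "{x. sat Std (x ## e) B \<phi>}"]) auto
  ultimately show "\<forall>\<phi>\<in>basic_axioms \<union> {induction \<phi> |\<phi>. \<phi> \<in> Sigma01} \<union>
    {All (\<phi> \<^bold>\<longleftrightarrow> \<psi>) \<^bold>\<longrightarrow> comprehension \<phi> |\<phi> \<psi>. \<phi> \<in> Sigma01 \<and> \<psi> \<in> Pi01}.
    \<forall>e B. (\<forall>n. B n \<in> sets Std) \<longrightarrow> sat Std e B \<phi>" by auto
qed

definition RCA0_premodel :: "(trm \<Rightarrow> trm \<Rightarrow> bool) \<Rightarrow> (trm \<Rightarrow> trm \<Rightarrow> bool) \<Rightarrow> trm set set \<Rightarrow> bool" where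
  "RCA0_premodel E L S \<longleftrightarrow> premodel E L S \<and> (\<forall>\<phi>\<in>RCA0. \<forall>e B. sat (tstr E L S) e B \<phi>)"

text \<open>The standard model is carried over to terms by evaluation with all variables 0, which is
  onto because of the numerals.\<close>

lemma RCA0_premodel_ex: "\<exists>E L S. RCA0_premodel E L S"
proof -
  define h where "h = tv Std (\<lambda>_. 0)"
  define E where "E t u \<longleftrightarrow> h t = h u" for t u
  define L where "L t u \<longleftrightarrow> h t < h u" for t u
  define S where "S = range (\<lambda>X. h -` X)"
  have h: "h Zero = 0" "h One = 1" "h (t \<^bold>+ u) = h t + h u" "h (t \<^bold>* u) = h t * h u" for t u
    by (simp_all add: h_def Std_def)
  have "\<exists>t. h t = n" for n
    by (induction n) (metis h(1), metis h(2,3) Suc_eq_plus1)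
  then have surj: "surj h" by (metis surjI)
  have "premodel E L S"
    unfolding premodel_def E_def L_def S_def by (auto intro!: equivpI reflpI sympI transpI simp: h)
  moreover have "sat (tstr E L S) e B \<phi>" if "\<phi> \<in> RCA0" for e B \<phi>
  proof -
    have "sat (tstr E L S) e (\<lambda>n. h -` {}) \<phi> = sat Std (\<lambda>n. h (e n)) (\<lambda>n. {}) \<phi>"
      by (rule sat_hom[OF surj]) (simp_all add: Std_def h E_def L_def S_def)
    moreover have "sentence \<phi>" using that sentence_closures unfolding RCA0_def by blast
    ultimately show ?thesis using Std_RCA0 that sat_sentence by blast
  qed
  ultimately show ?thesis unfolding RCA0_premodel_def by blast
qed

definition separates :: "(trm \<Rightarrow> trm \<Rightarrow> bool) \<Rightarrow> (trm \<Rightarrow> trm \<Rightarrow> bool) \<Rightarrow> trm set set \<Rightarrow> bool" where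
  "separates E L S \<longleftrightarrow> (let s = sat (tstr E L S) (\<lambda>_. Zero) (\<lambda>_. {}) in
     s HT_exists_ab_apart \<noteq> (\<forall>\<phi>\<in>ACA0. s \<phi>))"

text \<open>
  The carrier of one fixed model of \<open>RCA\<^sub>0\<close>, chosen so that it separates the two principles if any
  term model does.  Having it as a type makes the ordered semiring automation available.
\<close>

definition chosen_model ::
    "(trm \<Rightarrow> trm \<Rightarrow> bool) \<times> (trm \<Rightarrow> trm \<Rightarrow> bool) \<times> trm set set" where
  "chosen_model = (SOME m. case m of (E, L, S) \<Rightarrow> RCA0_premodel E L S \<and>
     ((\<exists>E L S. RCA0_premodel E L S \<and> separates E L S) \<longrightarrow> separates E L S))"

definition E0 where "E0 = fst chosen_model"
definition L0 where "L0 = fst (snd chosen_model)"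
definition S0 where "S0 = snd (snd chosen_model)"

lemma chosen_model:
  "RCA0_premodel E0 L0 S0"
  "(\<exists>E L S. RCA0_premodel E L S \<and> separates E L S) \<longrightarrow> separates E0 L0 S0"
proof -
  have "\<exists>m. case m of (E, L, S) \<Rightarrow> RCA0_premodel E L S \<and>
     ((\<exists>E L S. RCA0_premodel E L S \<and> separates E L S) \<longrightarrow> separates E L S)"
    using RCA0_premodel_ex by auto blast
  from someI_ex[OF this, folded chosen_model_def]
  show "RCA0_premodel E0 L0 S0"
    "(\<exists>E L S. RCA0_premodel E L S \<and> separates E L S) \<longrightarrow> separates E0 L0 S0"
    unfolding E0_def L0_def S0_def by (auto simp: split_beta)
qed

lemma premodel0: "premodel E0 L0 S0"
  using chosen_model(1) unfolding RCA0_premodel_def by blast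

quotient_type mnum = trm / E0
  using premodel0 unfolding premodel_def by blast

instantiation mnum :: "{zero, one, plus, times, ord}"
begin

lift_definition zero_mnum :: mnum is Zero .
lift_definition one_mnum :: mnum is One .
lift_definition plus_mnum :: "mnum \<Rightarrow> mnum \<Rightarrow> mnum" is Add
  using premodel0 unfolding premodel_def by blast
lift_definition times_mnum :: "mnum \<Rightarrow> mnum \<Rightarrow> mnum" is Mul
  using premodel0 unfolding premodel_def by blast
lift_definition less_mnum :: "mnum \<Rightarrow> mnum \<Rightarrow> bool" is L0
  using premodel0 equivp_symp[of E0] unfolding premodel_def by metis
definition less_eq_mnum :: "mnum \<Rightarrow> mnum \<Rightarrow> bool" where "x \<le> y \<longleftrightarrow> x < y \<or> x = (y :: mnum)"

instance ..

end

definition NS :: "mnum set set" where "NS = {X. abs_mnum -` X \<in> S0}"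

definition NM :: "mnum str" where
  "NM = \<lparr>zr = 0, un = 1, ad = (+), ml = (*), eqr = (=), ls = (<), sets = NS\<rparr>"

lemma NM_simps [simp]: "zr NM = 0" "un NM = 1" "ad NM = (+)" "ml NM = (*)" "eqr NM = (=)"
  "ls NM = (<)" "sets NM = NS"
  by (simp_all add: NM_def)

lemma NS_image: "S0 = (\<lambda>X. abs_mnum -` X) ` NS"
proof
  show "(\<lambda>X. abs_mnum -` X) ` NS \<subseteq> S0" by (auto simp: NS_def)
  show "S0 \<subseteq> (\<lambda>X. abs_mnum -` X) ` NS"
  proof
    fix X assume X: "X \<in> S0"
    have inv: "t' \<in> X" if "E0 t t'" "t \<in> X" for t t'
      using premodel0 X that unfolding premodel_def by blast
    have "abs_mnum -` abs_mnum ` X = X"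
      using inv mnum.abs_eq_iff by (auto simp: image_iff) (metis)
    then show "X \<in> (\<lambda>X. abs_mnum -` X) ` NS" using X by (auto simp: NS_def intro!: image_eqI[of _ _ "abs_mnum ` X"])
  qed
qed

lemma NS_nonempty: "NS \<noteq> {}"
  using premodel0 NS_image unfolding premodel_def by auto

lemma sat_NM:
  assumes "sentence \<phi>"
  shows "sat NM e B \<phi> = sat (tstr E0 L0 S0) e' B' \<phi>"
proof -
  have "sat (tstr E0 L0 S0) e' (\<lambda>n. abs_mnum -` {}) \<phi> = sat NM (\<lambda>n. abs_mnum (e' n)) (\<lambda>n. {}) \<phi>"
  proof (rule sat_hom)
    show "surj abs_mnum" by (metis Quotient3_abs_rep Quotient3_mnum surjI)
  qed (simp_all add: zero_mnum.abs_eq one_mnum.abs_eq plus_mnum.abs_eq times_mnum.abs_eq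
      less_mnum.abs_eq mnum.abs_eq_iff NS_image)
  then show ?thesis using sat_sentence[OF assms] by metis
qed

lemma RCA0_NM: "\<phi> \<in> RCA0 \<Longrightarrow> sat NM e B \<phi>"
  using chosen_model(1) sat_NM sentence_closures unfolding RCA0_premodel_def RCA0_def by blast

lifting_forget mnum.lifting

lemma sentence_HT: "sentence HT_exists_ab_apart"
  unfolding sentence_def HT_exists_ab_apart_def is_colouring_def is_positive_def is_infinite_def
    is_apart_def is_monochromatic_def is_mu_def is_lambda_def binary_expansion_def is_pow2_def
    in_FS_def seq_sum_def entry_def pair_def AllLess_def ExLess_def lift_def Let_def
  by simp

text \<open>If one implication were unprovable, completeness would give a term model of
  \<open>RCA0\<close> separating the principles. The chosen model would then separate them too,
  contrary to the assumption about its quotient \<open>NM\<close>.\<close>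

lemma equivalence_from_NM:
  assumes "sat NM (\<lambda>_. 0) (\<lambda>_. {}) HT_exists_ab_apart \<longleftrightarrow>
    (\<forall>\<phi>\<in>ACA0. sat NM (\<lambda>_. 0) (\<lambda>_. {}) \<phi>)"
  shows "equivalent_over RCA0 {HT_exists_ab_apart} ACA0"
proof -
  have sent: "sentence \<phi>" if "\<phi> \<in> RCA0 \<or> \<phi> \<in> ACA0 \<or> \<phi> = HT_exists_ab_apart" for \<phi>
    using that sentence_closures sentence_HT unfolding RCA0_def ACA0_def by blast
  have "\<not> separates E0 L0 S0"
    using assms sat_NM sent unfolding separates_def Let_def by blast
  then have nosep: "\<not> separates E L S" if "RCA0_premodel E L S" for E L S
    using that chosen_model(2) by blast
  have "RCA0 \<union> {HT_exists_ab_apart} \<turnstile> \<phi>" if "\<phi> \<in> ACA0" for \<phi>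
  proof (rule ccontr)
    assume "\<not> (RCA0 \<union> {HT_exists_ab_apart} \<turnstile> \<phi>)"
    then show False
    proof (rule completeness)
      show "sentence \<gamma>" if "\<gamma> \<in> RCA0 \<union> {HT_exists_ab_apart}" for \<gamma> using sent that by blast
      show "sentence \<phi>" using sent that by blast
      fix E L S
      assume m: "premodel E L S"
        "\<And>\<gamma> e B. \<gamma> \<in> RCA0 \<union> {HT_exists_ab_apart} \<Longrightarrow> sat (tstr E L S) e B \<gamma>"
        "\<And>e B. \<not> sat (tstr E L S) e B \<phi>"
      then have "RCA0_premodel E L S" unfolding RCA0_premodel_def by simp
      moreover have "separates E L S" unfolding separates_def Let_def
        using m(2)[of HT_exists_ab_apart] m(3) that by blast
      ultimately show False using nosep by blast
    qed
  qed
  moreover have "RCA0 \<union> ACA0 \<turnstile> HT_exists_ab_apart"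
  proof (rule ccontr)
    assume "\<not> (RCA0 \<union> ACA0 \<turnstile> HT_exists_ab_apart)"
    then show False
    proof (rule completeness)
      show "sentence \<gamma>" if "\<gamma> \<in> RCA0 \<union> ACA0" for \<gamma> using sent that by blast
      show "sentence HT_exists_ab_apart" using sent by blast
      fix E L S
      assume m: "premodel E L S"
        "\<And>\<gamma> e B. \<gamma> \<in> RCA0 \<union> ACA0 \<Longrightarrow> sat (tstr E L S) e B \<gamma>"
        "\<And>e B. \<not> sat (tstr E L S) e B HT_exists_ab_apart"
      then have "RCA0_premodel E L S" unfolding RCA0_premodel_def by simp
      moreover have "separates E L S" unfolding separates_def Let_def using m(2,3) by auto
      ultimately show False using nosep by blast
    qed
  qed
  ultimately show ?thesis unfolding equivalent_over_def by auto
qed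

section \<open>Definable predicates\<close>

lemma RCA0_axiom:
  assumes "\<phi> \<in> basic_axioms
      \<union> {induction \<phi> | \<phi>. \<phi> \<in> Sigma01}
      \<union> {All (\<phi> \<^bold>\<longleftrightarrow> \<psi>) \<^bold>\<longrightarrow> comprehension \<phi> | \<phi> \<psi>. \<phi> \<in> Sigma01 \<and> \<psi> \<in> Pi01}" "\<And>n. B n \<in> NS"
  shows "sat NM e B \<phi>"
proof -
  have "\<forall>\<phi>\<in>RCA0. sat NM (\<lambda>_. 0) (\<lambda>_. {}) \<phi>" using RCA0_NM by blast
  then have "\<forall>\<phi>\<in>basic_axioms \<union> {induction \<phi> | \<phi>. \<phi> \<in> Sigma01}
      \<union> {All (\<phi> \<^bold>\<longleftrightarrow> \<psi>) \<^bold>\<longrightarrow> comprehension \<phi> | \<phi> \<psi>. \<phi> \<in> Sigma01 \<and> \<psi> \<in> Pi01}.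
    \<forall>e B. (\<forall>n. B n \<in> sets NM) \<longrightarrow> sat NM e B \<phi>"
    unfolding RCA0_def by (subst (asm) sat_closures) (simp_all add: NS_nonempty)
  then show ?thesis using assms by (simp only: NM_simps) blast
qed

lemma fsub_AllLess: "fsub \<sigma> \<rho> (AllLess t \<phi>) = AllLess (tsub \<sigma> t) (fsub (up \<sigma>) \<rho> \<phi>)"
  by (simp add: AllLess_def lift_1 tsub_tsub)

lemma fsub_ExLess: "fsub \<sigma> \<rho> (ExLess t \<phi>) = ExLess (tsub \<sigma> t) (fsub (up \<sigma>) \<rho> \<phi>)"
  by (simp add: ExLess_def lift_1 tsub_tsub)

lemma Delta00_fsub: "\<phi> \<in> Delta00 \<Longrightarrow> fsub \<sigma> \<rho> \<phi> \<in> Delta00"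
  by (induction arbitrary: \<sigma> \<rho> rule: Delta00.induct)
    (auto simp: fsub_AllLess fsub_ExLess intro: Delta00.intros)

lemma sat_AllLess [simp]: "sat M e B (AllLess t \<phi>) \<longleftrightarrow> (\<forall>x. ls M x (tv M e t) \<longrightarrow> sat M (x ## e) B \<phi>)"
  by (simp add: AllLess_def)

lemma sat_ExLess [simp]: "sat M e B (ExLess t \<phi>) \<longleftrightarrow> (\<exists>x. ls M x (tv M e t) \<and> sat M (x ## e) B \<phi>)"
  by (simp add: ExLess_def)

text \<open>
  Predicates on environments are definable with number and set parameters from the model; the map
  \<open>\<tau>\<close> says which free variable of the formula is a variable of the predicate and which is a parameter.
\<close>

type_synonym env = "nat \<Rightarrow> mnum"

definition atm :: "(env \<Rightarrow> mnum) \<Rightarrow> bool" where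
  "atm f \<longleftrightarrow> (\<exists>m. f = (\<lambda>e. e m)) \<or> (\<exists>k. f = (\<lambda>e. k))"

definition Trep :: "(nat \<Rightarrow> env \<Rightarrow> mnum) \<Rightarrow> trm \<Rightarrow> (env \<Rightarrow> mnum) \<Rightarrow> bool" where
  "Trep \<tau> t f \<longleftrightarrow> (\<forall>n. atm (\<tau> n)) \<and> (\<forall>e. f e = tv NM (\<lambda>n. \<tau> n e) t)"

definition Drep :: "(nat \<Rightarrow> env \<Rightarrow> mnum) \<Rightarrow> (nat \<Rightarrow> mnum set) \<Rightarrow> fm \<Rightarrow> (env \<Rightarrow> bool) \<Rightarrow> bool" where
  "Drep \<tau> B \<theta> P \<longleftrightarrow> (\<forall>n. atm (\<tau> n)) \<and> (\<forall>n. B n \<in> NS) \<and> (\<forall>e. P e \<longleftrightarrow> sat NM (\<lambda>n. \<tau> n e) B \<theta>)"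

definition Tm :: "(env \<Rightarrow> mnum) \<Rightarrow> bool" where "Tm f \<longleftrightarrow> (\<exists>\<tau> t. Trep \<tau> t f)"

definition Dl :: "(env \<Rightarrow> bool) \<Rightarrow> bool" where "Dl P \<longleftrightarrow> (\<exists>\<tau> B. \<exists>\<theta>\<in>Delta00. Drep \<tau> B \<theta> P)"

text \<open>Interleaving puts two representations over one environment, the first on even and the
  second on odd variables, so that their formulas can be combined.\<close>

definition join :: "(nat \<Rightarrow> 'a) \<Rightarrow> (nat \<Rightarrow> 'a) \<Rightarrow> nat \<Rightarrow> 'a" where
  "join a b n = (if even n then a (n div 2) else b (n div 2))"

lemma join_simps [simp]: "join a b (2 * n) = a n" "join a b (Suc (2 * n)) = b n"
  by (simp_all add: join_def)

lemma join_ball: "\<forall>n. P (a n) \<Longrightarrow> \<forall>n. P (b n) \<Longrightarrow> \<forall>n. P (join a b n)"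
  by (simp add: join_def)

lemma Trep_left: "Trep \<tau> t f \<Longrightarrow> \<forall>n. atm (\<tau>' n) \<Longrightarrow> Trep (join \<tau> \<tau>') (tsub (\<lambda>n. Var (2 * n)) t) f"
  by (auto simp: Trep_def tv_tsub join_ball)

lemma Trep_right: "Trep \<tau> t f \<Longrightarrow> \<forall>n. atm (\<tau>' n) \<Longrightarrow> Trep (join \<tau>' \<tau>) (tsub (\<lambda>n. Var (Suc (2 * n))) t) f"
  by (auto simp: Trep_def tv_tsub join_ball)

lemma Drep_left: "Drep \<tau> B \<theta> P \<Longrightarrow> \<forall>n. atm (\<tau>' n) \<Longrightarrow> \<forall>n. B' n \<in> NS \<Longrightarrow>
  Drep (join \<tau> \<tau>') (join B B') (fsub (\<lambda>n. Var (2 * n)) (\<lambda>n. 2 * n) \<theta>) P"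
  by (auto simp: Drep_def sat_fsub join_ball[of "\<lambda>x. x \<in> NS"] join_ball[of atm])

lemma Drep_right: "Drep \<tau> B \<theta> P \<Longrightarrow> \<forall>n. atm (\<tau>' n) \<Longrightarrow> \<forall>n. B' n \<in> NS \<Longrightarrow>
  Drep (join \<tau>' \<tau>) (join B' B) (fsub (\<lambda>n. Var (Suc (2 * n))) (\<lambda>n. Suc (2 * n)) \<theta>) P"
  by (auto simp: Drep_def sat_fsub join_ball[of "\<lambda>x. x \<in> NS"] join_ball[of atm])

lemma Tm_pair:
  assumes "Tm f" "Tm g"
  obtains \<tau> t u where "Trep \<tau> t f" "Trep \<tau> u g"
proof -
  obtain \<tau> t \<tau>' u where *: "Trep \<tau> t f" "Trep \<tau>' u g" using assms unfolding Tm_def by blast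
  then have "\<forall>n. atm (\<tau> n)" "\<forall>n. atm (\<tau>' n)" unfolding Trep_def by blast+
  then show ?thesis using that Trep_left[OF *(1)] Trep_right[OF *(2)] by blast
qed

named_theorems dl

lemma Tm_var [dl]: "Tm (\<lambda>e. e n)"
  unfolding Tm_def Trep_def by (rule exI[of _ "\<lambda>n e. e n"], rule exI[of _ "Var n"]) (auto simp: atm_def)

lemma Tm_const [dl]: "Tm (\<lambda>e. k)"
  unfolding Tm_def Trep_def by (rule exI[of _ "\<lambda>n e. k"], rule exI[of _ "Var 0"]) (auto simp: atm_def)

lemma Tm_add [dl]: assumes "Tm f" "Tm g" shows "Tm (\<lambda>e. f e + g e)"
proof -
  obtain \<tau> t u where "Trep \<tau> t f" "Trep \<tau> u g" using Tm_pair[OF assms] .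
  then have "Trep \<tau> (t \<^bold>+ u) (\<lambda>e. f e + g e)" by (simp add: Trep_def)
  then show ?thesis unfolding Tm_def by blast
qed

lemma Tm_mul [dl]: assumes "Tm f" "Tm g" shows "Tm (\<lambda>e. f e * g e)"
proof -
  obtain \<tau> t u where "Trep \<tau> t f" "Trep \<tau> u g" using Tm_pair[OF assms] .
  then have "Trep \<tau> (t \<^bold>* u) (\<lambda>e. f e * g e)" by (simp add: Trep_def)
  then show ?thesis unfolding Tm_def by blast
qed

lemma NS_const_env: obtains B :: "nat \<Rightarrow> mnum set" where "\<forall>n. B n \<in> NS"
proof -
  obtain X where "X \<in> NS" using NS_nonempty by blast
  then show ?thesis using that[of "\<lambda>_. X"] by blast
qed

lemma Dl_eq [dl]: assumes "Tm f" "Tm g" shows "Dl (\<lambda>e. f e = g e)"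
proof -
  obtain B where B: "\<forall>n::nat. B n \<in> NS" using NS_const_env .
  obtain \<tau> t u where "Trep \<tau> t f" "Trep \<tau> u g" using Tm_pair[OF assms] .
  then have "Drep \<tau> B (t \<^bold>= u) (\<lambda>e. f e = g e)" using B by (simp add: Trep_def Drep_def)
  then show ?thesis unfolding Dl_def by (blast intro: Delta00.intros)
qed

lemma Dl_less [dl]: assumes "Tm f" "Tm g" shows "Dl (\<lambda>e. f e < g e)"
proof -
  obtain B where B: "\<forall>n::nat. B n \<in> NS" using NS_const_env .
  obtain \<tau> t u where "Trep \<tau> t f" "Trep \<tau> u g" using Tm_pair[OF assms] .
  then have "Drep \<tau> B (t \<^bold>< u) (\<lambda>e. f e < g e)" using B by (simp add: Trep_def Drep_def)
  then show ?thesis unfolding Dl_def by (blast intro: Delta00.intros)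
qed

lemma Dl_mem [dl]: assumes "Tm f" "X \<in> NS" shows "Dl (\<lambda>e. f e \<in> X)"
proof -
  obtain \<tau> t where "Trep \<tau> t f" using assms unfolding Tm_def by blast
  then have "Drep \<tau> (\<lambda>_. X) (t \<^bold>\<in> 0) (\<lambda>e. f e \<in> X)" using assms by (simp add: Trep_def Drep_def)
  then show ?thesis unfolding Dl_def by (blast intro: Delta00.intros)
qed

lemma Dl_False: "Dl (\<lambda>e. False)"
proof -
  obtain B where B: "\<forall>n::nat. B n \<in> NS" using NS_const_env .
  then have "Drep (\<lambda>_ _. 0) B Fls (\<lambda>e. False)" by (auto simp: Drep_def atm_def)
  then show ?thesis unfolding Dl_def by (blast intro: Delta00.intros)
qed

lemma Dl_imp [dl]: assumes "Dl P" "Dl Q" shows "Dl (\<lambda>e. P e \<longrightarrow> Q e)"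
proof -
  obtain \<tau> B \<theta> \<tau>' B' \<theta>' where *: "Drep \<tau> B \<theta> P" "Drep \<tau>' B' \<theta>' Q" "\<theta> \<in> Delta00" "\<theta>' \<in> Delta00"
    using assms unfolding Dl_def by blast
  then have g: "\<forall>n. atm (\<tau> n)" "\<forall>n. atm (\<tau>' n)" "\<forall>n. B n \<in> NS" "\<forall>n. B' n \<in> NS"
    unfolding Drep_def by blast+
  let ?\<phi> = "fsub (\<lambda>n. Var (2 * n)) (\<lambda>n. 2 * n) \<theta> \<^bold>\<longrightarrow> fsub (\<lambda>n. Var (Suc (2 * n))) (\<lambda>n. Suc (2 * n)) \<theta>'"
  have "Drep (join \<tau> \<tau>') (join B B') ?\<phi> (\<lambda>e. P e \<longrightarrow> Q e)"
    using Drep_left[OF *(1) g(2,4)] Drep_right[OF *(2) g(1,3)] unfolding Drep_def by simp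
  moreover have "?\<phi> \<in> Delta00" using * Delta00_fsub Delta00.intros(5) by blast
  ultimately show ?thesis unfolding Dl_def by blast
qed

lemma Dl_not [dl]: "Dl P \<Longrightarrow> Dl (\<lambda>e. \<not> P e)"
  using Dl_imp[OF _ Dl_False, of P] by simp

lemma Dl_and [dl]: "Dl P \<Longrightarrow> Dl Q \<Longrightarrow> Dl (\<lambda>e. P e \<and> Q e)"
  using Dl_not[OF Dl_imp[OF _ Dl_not], of P Q] by simp

lemma Dl_or [dl]: "Dl P \<Longrightarrow> Dl Q \<Longrightarrow> Dl (\<lambda>e. P e \<or> Q e)"
  using Dl_imp[OF Dl_not, of P Q] by (simp add: disj_imp)

lemma cons_eta [simp]: "(e 0 ## (\<lambda>n. e (Suc n))) = e"
  by (auto split: nat.split)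

lemma atm_cons: "atm f \<Longrightarrow> atm (\<lambda>e. f (k ## e))"
  unfolding atm_def by (auto split: nat.split simp: fun_eq_iff) (metis nat.case nat.exhaust)

lemma atm_val: "atm f \<Longrightarrow> (if f = (\<lambda>e. e 0) then x else f (0 ## e)) = f (x ## e)"
  unfolding atm_def by (auto split: nat.split simp: fun_eq_iff)

lemma Dl_ball [dl]:
  assumes P: "Dl (\<lambda>e. P (e 0) (\<lambda>n. e (Suc n)))" and f: "Tm f"
  shows "Dl (\<lambda>e. \<forall>x<f e. P x e)"
proof -
  obtain \<tau> B \<theta> where *: "Drep \<tau> B \<theta> (\<lambda>e. P (e 0) (\<lambda>n. e (Suc n)))" "\<theta> \<in> Delta00"
    using P unfolding Dl_def by blast
  obtain \<tau>' t where t: "Trep \<tau>' t f" using f unfolding Tm_def by blast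
  have a: "atm (\<tau> n)" "atm (\<tau>' n)" for n using * t unfolding Drep_def Trep_def by blast+
  \<comment> \<open>Variables of \<open>\<theta>\<close> that denote the quantified number become
    the bound \<open>Var 0\<close>, the others are shifted past it. The latter do not look at
    position 0, so putting 0 there leaves their values unchanged.\<close>
  define \<tau>1 where "\<tau>1 n e = \<tau> n (0 ## e)" for n e
  define \<iota> where "\<iota> n = (if \<tau> n = (\<lambda>e. e 0) then Var 0 else Var (Suc n))" for n
  have a1: "atm (\<tau>1 n)" for n unfolding \<tau>1_def using atm_cons[OF a(1)[of n], of 0] by simp
  have val: "(\<lambda>n. tv NM (x ## (\<lambda>n. \<tau>1 n e)) (\<iota> n)) = (\<lambda>n. \<tau> n (x ## e))" for x e
  proof
    fix n
    show "tv NM (x ## (\<lambda>n. \<tau>1 n e)) (\<iota> n) = \<tau> n (x ## e)"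
      using atm_val[OF a(1)[of n], of x e] by (simp add: \<iota>_def \<tau>1_def split: if_splits)
  qed
  have 1: "P x e \<longleftrightarrow> sat NM (x ## (\<lambda>n. \<tau>1 n e)) B (fsub \<iota> id \<theta>)" for x e
    using * unfolding Drep_def sat_fsub val by simp (metis cons_shift(2) nat.case(1))
  let ?\<theta> = "fsub (up (\<lambda>n. Var (2 * n))) id (fsub \<iota> id \<theta>)"
  let ?t = "tsub (\<lambda>n. Var (Suc (2 * n))) t"
  have 2: "P x e \<longleftrightarrow> sat NM (x ## (\<lambda>n. join \<tau>1 \<tau>' n e)) B ?\<theta>" for x e
    unfolding 1 by (simp add: sat_fsub[of _ _ _ "up _"] tv_up)
  have 3: "f e = tv NM (\<lambda>n. join \<tau>1 \<tau>' n e) ?t" for e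
    using t by (simp add: Trep_def tv_tsub)
  have "Drep (join \<tau>1 \<tau>') B (AllLess ?t ?\<theta>) (\<lambda>e. \<forall>x<f e. P x e)"
    using * a a1 unfolding Drep_def by (simp add: join_ball 2[symmetric] 3[symmetric])
  moreover have "AllLess ?t ?\<theta> \<in> Delta00" using * by (intro Delta00.intros Delta00_fsub)
  ultimately show ?thesis unfolding Dl_def by blast
qed

lemma Dl_bex [dl]:
  assumes "Dl (\<lambda>e. P (e 0) (\<lambda>n. e (Suc n)))" "Tm f"
  shows "Dl (\<lambda>e. \<exists>x<f e. P x e)"
  using Dl_not[OF Dl_ball[OF Dl_not[OF assms(1)] assms(2)]] by simp

lemma Dl_atm_subst:
  assumes "Dl P" "\<And>n. atm (g n)"
  shows "Dl (\<lambda>e. P (\<lambda>n. g n e))"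
proof -
  obtain \<tau> B \<theta> where *: "Drep \<tau> B \<theta> P" "\<theta> \<in> Delta00" using assms unfolding Dl_def by blast
  have "atm (\<lambda>e. \<tau> n (\<lambda>n. g n e))" for n
  proof -
    have "atm (\<tau> n)" using * unfolding Drep_def by blast
    then consider m where "\<tau> n = (\<lambda>e. e m)" | k where "\<tau> n = (\<lambda>e. k)" unfolding atm_def by blast
    then show ?thesis
    proof cases
      case 1
      then show ?thesis using assms(2) by simp
    next
      case 2
      then show ?thesis by (auto simp: atm_def)
    qed
  qed
  then have "Drep (\<lambda>n e. \<tau> n (\<lambda>n. g n e)) B \<theta> (\<lambda>e. P (\<lambda>n. g n e))"
    using * unfolding Drep_def by simp
  then show ?thesis unfolding Dl_def using * by blast
qed

section \<open>\<open>\<Sigma>\<^sup>0\<^sub>1\<close> predicates: induction and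
  comprehension\<close>

definition Sg :: "(env \<Rightarrow> bool) \<Rightarrow> bool" where
  "Sg P \<longleftrightarrow> (\<exists>R. Dl R \<and> (\<forall>e. P e \<longleftrightarrow> (\<exists>x. R (x ## e))))"

lemma atm_var: "atm (\<lambda>e. e n)" by (auto simp: atm_def)

lemma Dl_Sg: "Dl P \<Longrightarrow> Sg P"
  unfolding Sg_def by (rule exI[of _ "\<lambda>e. P (\<lambda>n. e (Suc n))"]) (auto intro: Dl_atm_subst atm_var)

lemma Dl_ex_Sg: "Dl (\<lambda>e. P (e 0) (\<lambda>n. e (Suc n))) \<Longrightarrow> Sg (\<lambda>e. \<exists>x. P x e)"
  unfolding Sg_def by (rule exI[of _ "\<lambda>e. P (e 0) (\<lambda>n. e (Suc n))"]) simp

text \<open>The axiom schemes speak of formulas with distinguished variable \<open>Var 0\<close>.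
  Here \<open>P\<close> is brought to that form: its variable 0 is kept, and the others are frozen
  at the values in \<open>e\<close> and become parameters.\<close>

lemma Sg_formula:
  assumes "Sg P"
  obtains \<theta> B e' where "\<theta> \<in> Delta00" "\<And>n. B n \<in> NS"
    "\<And>y. P (y ## e) \<longleftrightarrow> sat NM (y ## e') B (Ex \<theta>)"
proof -
  obtain R where R: "Dl R" "\<And>e. P e \<longleftrightarrow> (\<exists>x. R (x ## e))" using assms unfolding Sg_def by blast
  obtain \<tau> B \<theta> where *: "Drep \<tau> B \<theta> R" "\<theta> \<in> Delta00" using R(1) unfolding Dl_def by blast
  define \<iota> where "\<iota> n = (if \<tau> n = (\<lambda>e. e 0) then Var 0 else if \<tau> n = (\<lambda>e. e (Suc 0)) then Var (Suc 0)
    else Var (Suc (Suc n)))" for n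
  define e' where "e' n = \<tau> n (0 ## 0 ## e)" for n
  have "tv NM (x ## y ## e') (\<iota> n) = \<tau> n (x ## y ## e)" for x y n
  proof -
    have "atm (\<tau> n)" using * unfolding Drep_def by blast
    consider "\<tau> n = (\<lambda>e. e 0)" | "\<tau> n \<noteq> (\<lambda>e. e 0)" "\<tau> n = (\<lambda>e. e (Suc 0))"
      | "\<tau> n \<noteq> (\<lambda>e. e 0)" "\<tau> n \<noteq> (\<lambda>e. e (Suc 0))" by blast
    then show ?thesis
    proof cases
      case 3
      then consider m where "\<tau> n = (\<lambda>e. e (Suc (Suc m)))" | k where "\<tau> n = (\<lambda>e. k)"
        using \<open>atm (\<tau> n)\<close> unfolding atm_def by (metis nat.exhaust)
      then show ?thesis by cases (use 3 in \<open>simp_all add: \<iota>_def e'_def\<close>)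
    qed (simp_all add: \<iota>_def)
  qed
  then have "P (y ## e) \<longleftrightarrow> sat NM (y ## e') B (Ex (fsub \<iota> id \<theta>))" for y
    using * unfolding R(2) Drep_def by (simp add: sat_fsub)
  then show ?thesis using that[OF Delta00_fsub[OF *(2)], of B] * unfolding Drep_def by blast
qed

lemma Sg_formula1:
  assumes "Sg (\<lambda>e. P (e 0))"
  obtains \<theta> B e' where "\<theta> \<in> Delta00" "\<And>n. B n \<in> NS" "\<And>y. P y \<longleftrightarrow> sat NM (y ## e') B (Ex \<theta>)"
  by (rule Sg_formula[OF assms, of "\<lambda>_. 0", unfolded nat.case]) (rule that)

lemma Sg_induct [case_names Sg 0 Suc]:
  assumes "Sg (\<lambda>e. P (e 0))" "P 0" "\<And>x. P x \<Longrightarrow> P (x + 1)"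
  shows "P x"
proof -
  obtain \<theta> B e' where *: "\<theta> \<in> Delta00" "\<And>n. B n \<in> NS" "\<And>y. P y \<longleftrightarrow> sat NM (y ## e') B (Ex \<theta>)"
    by (rule Sg_formula1[OF assms(1)]) (rule that)
  have "sat NM e' B (induction (Ex \<theta>))"
    by (rule RCA0_axiom) (use * in \<open>auto simp: Sigma01_def\<close>)
  then show ?thesis using assms(2,3) unfolding sat_induction NM_simps *(3) by blast
qed

lemma comprehension_Sg:
  assumes "Sg (\<lambda>e. P (e 0))" "Sg (\<lambda>e. \<not> P (e 0))"
  shows "{x. P x} \<in> NS"
proof -
  obtain \<theta> B e where *: "\<theta> \<in> Delta00" "\<And>n. B n \<in> NS" "\<And>y. P y \<longleftrightarrow> sat NM (y ## e) B (Ex \<theta>)"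
    by (rule Sg_formula1[OF assms(1)]) (rule that)
  obtain \<theta>' B' e' where **: "\<theta>' \<in> Delta00" "\<And>n. B' n \<in> NS" "\<And>y. \<not> P y \<longleftrightarrow> sat NM (y ## e') B' (Ex \<theta>')"
    by (rule Sg_formula1[OF assms(2)]) (rule that)
  have NS: "join B B' n \<in> NS" for n using *(2) **(2) by (simp add: join_def)
  \<comment> \<open>The two formulas get disjoint parameters, even and odd, while
    \<open>up (up _)\<close> leaves the witness and the argument in place. Negating the second
    formula supplies the \<open>\<Pi>\<^sup>0\<^sub>1\<close> form.\<close>
  define \<sigma> where "\<sigma> = up (up (\<lambda>n. Var (2 * n)))"
  define \<sigma>' where "\<sigma>' = up (up (\<lambda>n. Var (Suc (2 * n))))"
  define \<alpha> where "\<alpha> = fsub \<sigma> (\<lambda>n. 2 * n) \<theta>"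
  define \<beta> where "\<beta> = fsub \<sigma>' (\<lambda>n. Suc (2 * n)) \<theta>'"
  have a: "sat NM (y ## join e e') (join B B') (Ex \<alpha>) \<longleftrightarrow> P y" for y
    by (simp add: *(3) \<alpha>_def sat_fsub \<sigma>_def tv_up)
  have b: "sat NM (y ## join e e') (join B B') (All (\<^bold>\<not> \<beta>)) \<longleftrightarrow> P y" for y
    using **(3)[of y] by (auto simp: \<beta>_def sat_fsub \<sigma>'_def tv_up)
  have "sat NM (join e e') (join B B') (All (Ex \<alpha> \<^bold>\<longleftrightarrow> All (\<^bold>\<not> \<beta>)) \<^bold>\<longrightarrow> comprehension (Ex \<alpha>))"
    by (rule RCA0_axiom)
      (use * ** NS in \<open>auto simp: Sigma01_def Pi01_def \<alpha>_def \<beta>_def intro!: Delta00_fsub Delta00.intros\<close>)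
  moreover have "sat NM (join e e') (join B B') (All (Ex \<alpha> \<^bold>\<longleftrightarrow> All (\<^bold>\<not> \<beta>)))"
    using a b by auto
  ultimately have "sat NM (join e e') (join B B') (comprehension (Ex \<alpha>))" by simp
  then obtain X where "X \<in> NS" "\<And>y. y \<in> X \<longleftrightarrow> P y" unfolding sat_comprehension a by auto
  moreover from this have "X = {x. P x}" by auto
  ultimately show ?thesis by simp
qed

lemma Dl_induct:
  assumes "Dl (\<lambda>e. P (e 0))" "P 0" "\<And>x. P x \<Longrightarrow> P (x + 1)"
  shows "P x"
  using Sg_induct[OF Dl_Sg[OF assms(1)] assms(2,3)] .


section \<open>Arithmetic in the model\<close>

lemma num_axioms:
  fixes m n :: mnum
  shows "n + 1 \<noteq> 0" "m + 1 = n + 1 \<Longrightarrow> m = n" "m + 0 = m" "m + (n + 1) = (m + n) + 1"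
    "m * 0 = 0" "m * (n + 1) = m * n + m" "\<not> m < 0" "m < n + 1 \<longleftrightarrow> m < n \<or> m = n"
proof -
  obtain B where B: "\<forall>n::nat. B n \<in> NS" using NS_const_env .
  have "sat NM (m ## n ## (\<lambda>_. 0)) B \<phi>" if "\<phi> \<in> basic_axioms" for \<phi>
    by (rule RCA0_axiom) (use that B in auto)
  then have *: "\<forall>\<phi>\<in>basic_axioms. sat NM (m ## n ## (\<lambda>_. 0)) B \<phi>" by blast
  show "n + 1 \<noteq> 0" "m + 1 = n + 1 \<Longrightarrow> m = n" "m + 0 = m" "m + (n + 1) = (m + n) + 1"
    "m * 0 = 0" "m * (n + 1) = m * n + m" "\<not> m < 0" "m < n + 1 \<longleftrightarrow> m < n \<or> m = n"
    using * unfolding basic_axioms_def Let_def One_nat_def by auto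
qed

lemma num_zero_add: "0 + x = (x :: mnum)"
  by (rule Dl_induct[where P = "\<lambda>x. 0 + x = x"]) (intro dl, simp_all add: num_axioms)

lemma num_succ_add: "(x + 1) + y = (x + y) + (1 :: mnum)"
  by (rule Dl_induct[where P = "\<lambda>y. (x + 1) + y = (x + y) + 1"]) (intro dl, simp_all add: num_axioms)

lemma num_add_commute: "x + y = y + (x :: mnum)"
proof (induction y rule: Sg_induct)
  case Sg
  show ?case by (rule Dl_Sg) (intro dl)
next
  case (Suc y)
  then show ?case unfolding num_axioms(4) num_succ_add[of y x] by simp
qed (simp add: num_axioms num_zero_add)

lemma num_add_assoc: "(x + y) + z = x + (y + z :: mnum)"
  by (rule Dl_induct[where P = "\<lambda>z. (x + y) + z = x + (y + z)"]) (intro dl, simp_all add: num_axioms)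

instance mnum :: comm_monoid_add
  by standard (simp_all add: num_add_assoc num_zero_add, rule num_add_commute)

lemma num_zero_mul: "0 * x = (0 :: mnum)"
  by (rule Dl_induct[where P = "\<lambda>x. 0 * x = 0"]) (intro dl, simp_all add: num_axioms)

lemma num_succ_mul: "(x + 1) * y = x * y + (y :: mnum)"
  by (rule Dl_induct[where P = "\<lambda>y. (x + 1) * y = x * y + y"])
    (intro dl, simp_all add: num_axioms ac_simps)

lemma num_mul_commute: "x * y = y * (x :: mnum)"
  by (rule Dl_induct[where P = "\<lambda>y. x * y = y * x"])
    (intro dl, simp_all add: num_axioms num_zero_mul num_succ_mul)

lemma num_distrib: "x * (y + z) = x * y + x * (z :: mnum)"
  by (rule Dl_induct[where P = "\<lambda>z. x * (y + z) = x * y + x * z"])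
    (intro dl, simp_all add: num_axioms add.assoc[symmetric])

lemma num_mul_one_right: "x * 1 = (x :: mnum)"
  using num_axioms(6)[of x 0] by (simp add: num_axioms(5))

lemma num_mul_assoc: "(x * y) * z = x * (y * z :: mnum)"
  by (rule Dl_induct[where P = "\<lambda>z. (x * y) * z = x * (y * z)"])
    (intro dl, simp_all add: num_axioms num_distrib num_mul_one_right)

lemma num_mul_one: "1 * x = (x :: mnum)"
  using num_axioms(6)[of x 0] by (simp add: num_axioms(5) num_mul_commute[of 1])

lemma num_add_cancel:
  assumes "x + z = y + (z :: mnum)"
  shows "x = y"
proof -
  have "x + z = y + z \<longrightarrow> x = y"
  proof (induction z rule: Sg_induct)
    case Sg
    show ?case by (rule Dl_Sg) (intro dl)
  next
    case (Suc z)
    then show ?case unfolding add.assoc[symmetric] using num_axioms(2) by blast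
  qed simp
  then show ?thesis using assms by blast
qed

lemma num_cases: "x = 0 \<or> (\<exists>k::mnum. x = k + 1)"
  by (rule Sg_induct[where P = "\<lambda>x. x = 0 \<or> (\<exists>k::mnum. x = k + 1)"])
    (rule Dl_ex_Sg[where P = "\<lambda>k e. e 0 = 0 \<or> e 0 = k + 1", simplified], (intro dl)+, auto)

lemma num_add_eq_0: "x + y = 0 \<Longrightarrow> y = (0 :: mnum)"
  using num_cases[of y] num_axioms(1,4) by metis

text \<open>The order axioms only deal with 0 and successors; this reduces every other property of
  the order to addition.\<close>

lemma num_less_iff: "x < y \<longleftrightarrow> (\<exists>k::mnum. y = x + k + 1)"
proof
  have "\<exists>k. x < y \<longrightarrow> y = x + k + 1"
  proof (induction y rule: Sg_induct)
    case Sg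
    show ?case by (rule Dl_ex_Sg) (intro dl)
  next
    case (Suc y)
    then show ?case unfolding num_axioms(8) by (metis add.assoc add.commute add.right_neutral)
  qed (use num_axioms in auto)
  then show "x < y \<Longrightarrow> \<exists>k. y = x + k + 1" by blast
  have "x < x + k + 1" for k
  proof (induction k rule: Sg_induct)
    case Sg
    show ?case by (rule Dl_Sg) (intro dl)
  next
    case (Suc k)
    have "x + (k + 1) + 1 = (x + k + 1) + 1" by (simp add: add.assoc)
    then show ?case using Suc num_axioms(8) by metis
  qed (simp add: num_axioms(8))
  then show "\<exists>k. y = x + k + 1 \<Longrightarrow> x < y" by blast
qed

lemma num_linear: "x < y \<or> x = y \<or> y < (x :: mnum)"
proof (induction x rule: Sg_induct)
  case Sg
  show ?case by (rule Dl_Sg) (intro dl)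
next
  case 0
  show ?case using num_cases[of y] num_less_iff[of 0 y] by auto
next
  case (Suc x)
  then show ?case
    unfolding num_axioms(8) num_less_iff[of x y] num_less_iff[of "x + 1" y]
    using num_cases by (metis add.assoc add.commute add.right_neutral)
qed

lemma num_less_irrefl: "\<not> x < (x :: mnum)"
proof
  assume "x < x"
  then obtain k where "x = x + k + 1" by (auto simp: num_less_iff)
  then have "0 + x = (k + 1) + x" by (simp add: ac_simps)
  then show False using num_add_cancel num_axioms(1) by metis
qed

lemma num_less_trans: "x < y \<Longrightarrow> y < z \<Longrightarrow> x < (z :: mnum)"
  unfolding num_less_iff by (metis add.assoc)

instance mnum :: linorder
proof
  fix x y z :: mnum
  show "x < y \<longleftrightarrow> x \<le> y \<and> \<not> y \<le> x"
    unfolding less_eq_mnum_def using num_less_irrefl num_less_trans by metis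
  show "x \<le> x" unfolding less_eq_mnum_def by blast
  show "x \<le> y \<Longrightarrow> y \<le> z \<Longrightarrow> x \<le> z" unfolding less_eq_mnum_def using num_less_trans by metis
  show "x \<le> y \<Longrightarrow> y \<le> x \<Longrightarrow> x = y"
    unfolding less_eq_mnum_def using num_less_irrefl num_less_trans by metis
  show "x \<le> y \<or> y \<le> x" unfolding less_eq_mnum_def using num_linear by blast
qed

lemma num_le_iff: "x \<le> y \<longleftrightarrow> (\<exists>k::mnum. y = x + k)"
  unfolding less_eq_mnum_def num_less_iff using num_cases by (metis add.assoc add.right_neutral)

text \<open>Truncated subtraction, demanded by the class \<open>linordered_semidom\<close>. The
  described number is unique because addition cancels.\<close>

instantiation mnum :: minus
begin
definition minus_mnum :: "mnum \<Rightarrow> mnum \<Rightarrow> mnum" where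
  "x - y = (if y \<le> x then THE z. x = y + z else (0::mnum))"
instance ..
end

lemma num_add_diff: "x + y - x = (y :: mnum)"
proof -
  have "(THE z. x + y = x + z) = y" using num_add_cancel by (auto intro: the_equality simp: add.commute[of x])
  then show ?thesis using num_le_iff unfolding minus_mnum_def by auto
qed

lemma num_diff_0: "x \<le> y \<Longrightarrow> x - y = (0 :: mnum)"
  using num_add_diff[of x 0] unfolding minus_mnum_def by auto

instance mnum :: comm_semiring_1
proof
  fix a b c :: mnum
  show "0 \<noteq> (1::mnum)" using num_axioms(1)[of 0] by simp
  show "(a + b) * c = a * c + b * c" by (simp add: num_distrib num_mul_commute[of _ c])
  show "a * b * c = a * (b * c)" by (rule num_mul_assoc)
  show "a * b = b * a" by (rule num_mul_commute)
qed (simp_all add: num_mul_one num_zero_mul num_axioms(5))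

instance mnum :: canonically_ordered_monoid_add
  by standard (rule num_le_iff)

instance mnum :: cancel_comm_monoid_add
proof
  fix a b c :: mnum
  show "a + b - a = b" by (rule num_add_diff)
  show "a - b - c = a - (b + c)"
  proof (cases "b + c \<le> a")
    case True
    then obtain k where "a = b + c + k" unfolding num_le_iff by blast
    then show ?thesis using num_add_diff[of "b + c" k] num_add_diff[of b "c + k"] num_add_diff[of c k]
      by (simp add: add.assoc)
  next
    case False
    then have "a \<le> b + c" by simp
    show ?thesis
    proof (cases "b \<le> a")
      case True
      then obtain k where k: "a = b + k" unfolding num_le_iff by blast
      obtain j where "b + c = a + j" using \<open>a \<le> b + c\<close> unfolding num_le_iff by blast
      then have "c + b = (k + j) + b" using k by (simp add: ac_simps)
      then have "c = k + j" by (rule num_add_cancel)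
      then have "k \<le> c" unfolding num_le_iff by blast
      then show ?thesis using k \<open>a \<le> b + c\<close> by (simp add: num_add_diff num_diff_0)
    next
      case False
      then show ?thesis using \<open>a \<le> b + c\<close> by (simp add: num_diff_0)
    qed
  qed
qed

lemma num_mult_eq_0: "a * b = 0 \<Longrightarrow> a = 0 \<or> b = (0 :: mnum)"
  using num_cases[of a] num_cases[of b] num_axioms(6) num_add_eq_0 by metis

instance mnum :: linordered_semidom
proof
  fix a b c :: mnum
  show "a * (b - c) = a * b - a * c"
  proof (cases "c \<le> b")
    case True
    then obtain k where "b = c + k" unfolding num_le_iff by blast
    then show ?thesis by (simp add: num_add_diff num_distrib)
  next
    case False
    then obtain k where "c = b + k" unfolding num_le_iff using linear num_le_iff by metis
    then show ?thesis by (simp add: num_distrib num_diff_0 num_le_iff)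
  qed
  show "a \<noteq> 0 \<Longrightarrow> b \<noteq> 0 \<Longrightarrow> a * b \<noteq> 0" using num_mult_eq_0 by blast
  show "0 < (1::mnum)" using num_less_iff[of 0 1] by (metis add.left_neutral)
  show "b \<le> a \<Longrightarrow> a - b + b = a" unfolding num_le_iff using num_add_diff by (metis add.commute)
  show "a < b \<Longrightarrow> 0 < c \<Longrightarrow> c * a < c * b"
  proof -
    assume "a < b" "0 < c"
    then obtain k j where k: "b = a + k + 1" and j: "c = j + 1" unfolding num_less_iff by auto
    have "c * b = c * a + (c * k + j) + 1" unfolding k num_distrib j by (simp add: num_distrib ac_simps)
    then show "c * a < c * b" unfolding num_less_iff by blast
  qed
qed

lemma num_less_Suc: "x < y + 1 \<longleftrightarrow> x \<le> (y :: mnum)"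
  by (simp add: num_axioms(8) less_eq_mnum_def)

lemma num_Suc_le: "x < y \<longleftrightarrow> x + 1 \<le> (y :: mnum)"
  by (meson leD leI num_less_Suc)

section \<open>The ring of differences\<close>

text \<open>Linear arithmetic needs an ordered ring, so inequalities of \<open>mnum\<close> are decided in this extension.\<close>

quotient_type zz = "mnum \<times> mnum" / "\<lambda>(a, b) (c, d). a + d = c + b"
  morphisms rep_z abs_z
proof (rule equivpI)
  show "reflp (\<lambda>(a, b) (c, d). a + d = c + (b::mnum))" by (auto simp: reflp_def)
  show "symp (\<lambda>(a, b) (c, d). a + d = c + (b::mnum))" by (auto simp: symp_def)
  show "transp (\<lambda>(a, b) (c, d). a + d = c + (b::mnum))"
  proof (rule transpI, clarify)
    fix a b c d e f :: mnum
    assume 1: "a + d = c + b" and 2: "c + f = e + d"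
    have "(a + f) + (c + d) = (a + d) + (c + f)" by (simp add: ac_simps)
    also have "\<dots> = (e + b) + (c + d)" unfolding 1 2 by (simp add: ac_simps)
    finally show "a + f = e + b" by simp
  qed
qed

instantiation zz :: comm_ring_1
begin

lift_definition zero_zz :: zz is "(0, 0)" .
lift_definition one_zz :: zz is "(1, 0)" .
lift_definition plus_zz :: "zz \<Rightarrow> zz \<Rightarrow> zz" is "\<lambda>(a, b) (c, d). (a + c, b + d)"
proof clarify
  fix a b c d a' b' c' d' :: mnum
  assume 1: "a + d = c + b" and 2: "a' + d' = c' + b'"
  have "a + a' + (d + d') = (a + d) + (a' + d')" by (simp add: ac_simps)
  also have "\<dots> = c + c' + (b + b')" unfolding 1 2 by (simp add: ac_simps)
  finally show "a + a' + (d + d') = c + c' + (b + b')" .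
qed
lift_definition uminus_zz :: "zz \<Rightarrow> zz" is "\<lambda>(a, b). (b, a)"
  by (auto simp: ac_simps)
lift_definition minus_zz :: "zz \<Rightarrow> zz \<Rightarrow> zz" is "\<lambda>(a, b) (c, d). (a + d, b + c)"
proof clarify
  fix a b c d a' b' c' d' :: mnum
  assume 1: "a + d = c + b" and 2: "a' + d' = c' + b'"
  have "a + b' + (d + c') = (a + d) + (c' + b')" by (simp add: ac_simps)
  also have "\<dots> = c + d' + (b + a')" unfolding 1 2[symmetric] by (simp add: ac_simps)
  finally show "a + b' + (d + c') = c + d' + (b + a')" .
qed
lift_definition times_zz :: "zz \<Rightarrow> zz \<Rightarrow> zz" is "\<lambda>(a, b) (c, d). (a * c + b * d, a * d + b * c)"
proof clarify
  fix s t u v w x y z :: mnum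
  assume "s + v = u + t" and "w + z = y + x"
  hence "(s + v) * w + (u + t) * x + u * (w + z) + v * (y + x) =
         (u + t) * w + (s + v) * x + u * (y + x) + v * (w + z)" by simp
  then have "s * w + t * x + (u * z + v * y) + (u * w + u * x + v * w + v * x) =
      u * y + v * z + (s * x + t * w) + (u * w + u * x + v * w + v * x)"
    by (simp add: algebra_simps)
  then show "s * w + t * x + (u * z + v * y) = u * y + v * z + (s * x + t * w)"
    by (simp only: add_right_cancel)
qed

instance
  by standard (transfer; clarsimp simp: algebra_simps)+

end

instantiation zz :: linordered_idom
begin

lift_definition less_eq_zz :: "zz \<Rightarrow> zz \<Rightarrow> bool" is "\<lambda>(a, b) (c, d). a + d \<le> c + b"
proof clarify
  fix a b c d a' b' c' d' :: mnum
  assume 1: "a + d = c + b" and 2: "a' + d' = c' + b'"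
  have "a + b' \<le> a' + b \<longleftrightarrow> (a + b') + (d + d') \<le> (a' + b) + (d + d')" by simp
  also have "\<dots> \<longleftrightarrow> (a + d) + (b' + d') \<le> (a' + d') + (b + d)" by (simp add: ac_simps)
  also have "\<dots> \<longleftrightarrow> (c + d') + (b + b') \<le> (c' + d) + (b + b')" unfolding 1 2 by (simp add: ac_simps)
  finally show "(a + b' \<le> a' + b) = (c + d' \<le> c' + d)" by simp
qed
definition less_zz :: "zz \<Rightarrow> zz \<Rightarrow> bool" where "x < y \<longleftrightarrow> x \<le> y \<and> \<not> y \<le> (x::zz)"
definition abs_zz :: "zz \<Rightarrow> zz" where "\<bar>x\<bar> = (if x < 0 then - x else (x::zz))"
definition sgn_zz :: "zz \<Rightarrow> zz" where "sgn x = (if x = 0 then 0 else if 0 < x then 1 else - (1::zz))"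

instance
proof
  fix x y z :: zz
  show "x < y \<longleftrightarrow> x \<le> y \<and> \<not> y \<le> x" by (rule less_zz_def)
  show "x \<le> x" by transfer auto
  show "x \<le> y \<Longrightarrow> y \<le> z \<Longrightarrow> x \<le> z"
  proof (transfer, clarify)
    fix a b c d e f :: mnum
    assume 1: "a + d \<le> c + b" and 2: "c + f \<le> e + d"
    have "(a + f) + (c + d) = (a + d) + (c + f)" by (simp add: ac_simps)
    also have "\<dots> \<le> (c + b) + (e + d)" using 1 2 by (rule add_mono)
    also have "\<dots> = (e + b) + (c + d)" by (simp add: ac_simps)
    finally show "a + f \<le> e + b" by simp
  qed
  show "x \<le> y \<Longrightarrow> y \<le> x \<Longrightarrow> x = y" by transfer (auto simp: ac_simps)
  show "x \<le> y \<or> y \<le> x" by transfer (auto simp: ac_simps linear)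
  show "x \<le> y \<Longrightarrow> z + x \<le> z + y"
  proof (transfer, clarify)
    fix a b c d e f :: mnum
    assume "a + d \<le> c + b"
    then have "(a + d) + (e + f) \<le> (c + b) + (e + f)" by simp
    then show "e + a + (f + d) \<le> e + c + (f + b)" by (simp add: ac_simps)
  qed
  show "\<bar>x\<bar> = (if x < 0 then - x else x)" by (rule abs_zz_def)
  show "sgn x = (if x = 0 then 0 else if 0 < x then 1 else - 1)" by (rule sgn_zz_def)
  show "x < y \<Longrightarrow> 0 < z \<Longrightarrow> z * x < z * y" unfolding less_zz_def
  proof (transfer, clarify, rule conjI)
    fix a b c d e f :: mnum
    assume 1: "a + d \<le> c + b" "\<not> c + b \<le> a + d" and 2: "0 + f \<le> e + 0" "\<not> e + 0 \<le> 0 + f"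
    from 1 have lt: "a + d < c + b" by simp
    obtain g where g: "e = f + g" using 2(1) num_le_iff by auto
    have "g > 0" using 2(2) g by (simp add: pos_add_strict zero_less_iff_neq_zero)
    then have l: "g * (a + d) < g * (c + b)" using lt by (rule mult_strict_left_mono[rotated])
    have A: "e * a + f * b + (e * d + f * c) = g * (a + d) + f * (a + b + c + d)"
      "e * c + f * d + (e * b + f * a) = g * (c + b) + f * (a + b + c + d)"
      by (simp_all add: g algebra_simps)
    show "e * a + f * b + (e * d + f * c) \<le> e * c + f * d + (e * b + f * a)"
      "\<not> e * c + f * d + (e * b + f * a) \<le> e * a + f * b + (e * d + f * c)"
      unfolding A using l by simp_all
  qed
qed

end

lift_definition nn :: "mnum \<Rightarrow> zz" is "\<lambda>x. (x, 0)" .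

lemma nn_nonneg: "0 \<le> nn x" by transfer simp
lemma nn_0: "nn 0 = 0" by transfer simp
lemma nn_1: "nn 1 = 1" by transfer simp
lemma nn_add: "nn (x + y) = nn x + nn y" by transfer simp
lemma nn_mult: "nn (x * y) = nn x * nn y" by transfer simp
lemma nn_eq: "x = y \<longleftrightarrow> nn x = nn y" by transfer simp
lemma nn_le: "x \<le> y \<longleftrightarrow> nn x \<le> nn y" by transfer simp
lemma nn_less: "x < y \<longleftrightarrow> nn x < nn y" by (simp add: less_zz_def less_le_not_le nn_le)
text \<open>Discreteness: it lets linear arithmetic over an ordered ring settle facts such as
  \<open>t < b\<close> from \<open>\<not> b < t + 1\<close>.\<close>

lemma zz_less: "x < y \<longleftrightarrow> x + 1 \<le> (y::zz)"
  unfolding less_zz_def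
proof (transfer, clarify)
  fix a b c d :: mnum
  have "(a + d \<le> c + b \<and> \<not> c + b \<le> a + d) \<longleftrightarrow> a + d < c + b" by auto
  also have "\<dots> \<longleftrightarrow> a + d + 1 \<le> c + b" by (rule num_Suc_le)
  finally show "(a + d \<le> c + b \<and> \<not> c + b \<le> a + d) = (a + 1 + d \<le> c + (b + 0))"
    by (simp add: ac_simps)
qed
lemma nn_numeral: "nn (numeral k) = numeral k"
  by (induction k rule: num_induct) (simp_all only: numeral_inc numeral_One nn_add nn_1)
lemma nn_diff: "y \<le> x \<Longrightarrow> nn (x - y) = nn x - nn y"
  by (metis add_diff_cancel_right' le_add_diff_inverse2 nn_add)

text \<open>The translation forgets that the numbers are nonnegative, which is why
  \<open>nn_nonneg\<close> is supplied at the calls that depend on it.\<close>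

lemmas zify = not_le not_less zz_less nn_0 nn_1 nn_add nn_mult nn_eq nn_less nn_le nn_numeral


section \<open>Recursive predicates and functions\<close>

lemma Sg_cong: "Sg P \<Longrightarrow> (\<And>e. P e \<longleftrightarrow> Q e) \<Longrightarrow> Sg Q"
  by (subgoal_tac "P = Q") auto

lemma Dl_shift: "Dl P \<Longrightarrow> Dl (\<lambda>e. P (\<lambda>n. e (s n)))"
  by (rule Dl_atm_subst) (auto intro: atm_var)

lemma Sg_subst_atm:
  assumes "Sg P" "\<And>n. atm (g n)"
  shows "Sg (\<lambda>e. P (\<lambda>n. g n e))"
proof -
  obtain R where R: "Dl R" "\<And>e. P e \<longleftrightarrow> (\<exists>x. R (x ## e))" using assms unfolding Sg_def by blast
  define h :: "nat \<Rightarrow> env \<Rightarrow> mnum" where "h = (\<lambda>e. e 0) ## (\<lambda>n e. g n (\<lambda>n. e (Suc n)))"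
  have "atm (h n)" for n using assms(2)[of "n - 1"] atm_var unfolding h_def atm_def
    by (auto split: nat.split)
  then have "Dl (\<lambda>e. R (\<lambda>n. h n e))" using R(1) by (rule Dl_atm_subst[rotated])
  moreover have "(\<lambda>n. h n (x ## e)) = x ## (\<lambda>n. g n e)" for x e
    by (rule ext) (auto simp: h_def split: nat.split)
  ultimately show ?thesis unfolding Sg_def R(2) by (intro exI[of _ "\<lambda>e. R (\<lambda>n. h n e)"]) simp
qed

lemma Sg_shift: "Sg P \<Longrightarrow> Sg (\<lambda>e. P (\<lambda>n. e (s n)))"
  by (rule Sg_subst_atm) (auto intro: atm_var)

text \<open>
  \<open>Tm\<close>, \<open>Dl\<close>, \<open>Sg\<close>, \<open>Rc\<close> and \<open>RF\<close> stand for terms, \<open>\<Delta>\<^sup>0\<^sub>0\<close>, \<open>\<Sigma>\<^sup>0\<^sub>1\<close> and \<open>\<Delta>\<^sup>0\<^sub>1\<close> predicates and total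
  functions with \<open>\<Sigma>\<^sup>0\<^sub>1\<close> graph.  Variables are de Bruijn indices into the environment, which lets the
  rules collected in \<open>rc\<close> be applied by resolution.
\<close>

named_theorems rc

text \<open>One number \<open>z\<close> bounds the new witness together with the old one; with both
  quantifiers bounded by \<open>z\<close> the matrix is again
  \<open>\<Delta>\<^sup>0\<^sub>0\<close>. This contracts the quantifiers without a pairing
  function.\<close>

lemma Sg_ex [rc]:
  assumes "Sg (\<lambda>e. P (e 0) (\<lambda>n. e (Suc n)))"
  shows "Sg (\<lambda>e. \<exists>x. P x e)"
proof -
  obtain R where R: "Dl R" "\<And>e. P (e 0) (\<lambda>n. e (Suc n)) \<longleftrightarrow> (\<exists>x. R (x ## e))"
    using assms unfolding Sg_def by blast
  have P: "P x e \<longleftrightarrow> (\<exists>y. R (y ## x ## e))" for x e using R(2)[of "x ## e"] by simp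
  have eq: "(\<exists>x. P x e) \<longleftrightarrow> (\<exists>z. \<exists>x<z. \<exists>y<z. R (y ## x ## e))" for e
  proof
    assume "\<exists>x. P x e"
    then obtain x y where "R (y ## x ## e)" using P by blast
    moreover have "x < x + y + 1" "y < x + y + 1"
      using nn_nonneg[of x] nn_nonneg[of y] by (simp_all add: zify)
    ultimately show "\<exists>z. \<exists>x<z. \<exists>y<z. R (y ## x ## e)" by blast
  qed (use P in blast)
  have "Dl (\<lambda>e. R (\<lambda>n. e ((0 ## Suc 0 ## (\<lambda>n. Suc (Suc (Suc n)))) n)))"
    using R(1) by (rule Dl_shift)
  moreover have "(\<lambda>n. e ((0 ## Suc 0 ## (\<lambda>n. Suc (Suc (Suc n)))) n)) =
    e 0 ## e (Suc 0) ## (\<lambda>n. e (Suc (Suc (Suc n))))" for e :: env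
    by (auto split: nat.split)
  ultimately have "Dl (\<lambda>e. R (e 0 ## e (Suc 0) ## (\<lambda>n. e (Suc (Suc (Suc n))))))" by simp
  then have "Dl (\<lambda>e. \<exists>x<e 0. \<exists>y<e 0. R (y ## x ## (\<lambda>n. e (Suc n))))"
    by (intro dl)
  from Dl_ex_Sg[of "\<lambda>z e. \<exists>x<z. \<exists>y<z. R (y ## x ## e)", OF this]
  show ?thesis unfolding eq .
qed

lemma Sg_and [rc]:
  assumes "Sg P" "Sg Q"
  shows "Sg (\<lambda>e. P e \<and> Q e)"
proof -
  obtain R S where R: "Dl R" "\<And>e. P e \<longleftrightarrow> (\<exists>x. R (x ## e))" and S: "Dl S" "\<And>e. Q e \<longleftrightarrow> (\<exists>x. S (x ## e))"
    using assms unfolding Sg_def by blast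
  have "Dl (\<lambda>e. R (\<lambda>n. e ((Suc 0 ## (\<lambda>n. Suc (Suc n))) n)))" using R(1) by (rule Dl_shift)
  moreover have "Dl (\<lambda>e. S (\<lambda>n. e ((0 ## (\<lambda>n. Suc (Suc n))) n)))" using S(1) by (rule Dl_shift)
  moreover have "(\<lambda>n. e ((k ## (\<lambda>n. Suc (Suc n))) n)) = e k ## (\<lambda>n. e (Suc (Suc n)))" for e :: env and k
    by (auto split: nat.split)
  ultimately have "Dl (\<lambda>e. R (e (Suc 0) ## (\<lambda>n. e (Suc (Suc n)))) \<and> S (e 0 ## (\<lambda>n. e (Suc (Suc n)))))"
    by (simp only: Dl_and)
  then have "Sg (\<lambda>e. \<exists>y. R (e 0 ## (\<lambda>n. e (Suc n))) \<and> S (y ## (\<lambda>n. e (Suc n))))"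
    by (intro Dl_ex_Sg)
  from Sg_ex[of "\<lambda>x e. \<exists>y. R (x ## e) \<and> S (y ## e)", OF this]
  show ?thesis unfolding R(2) S(2) by simp
qed

lemma Sg_or [rc]:
  assumes "Sg P" "Sg Q"
  shows "Sg (\<lambda>e. P e \<or> Q e)"
proof -
  obtain R S where R: "Dl R" "\<And>e. P e \<longleftrightarrow> (\<exists>x. R (x ## e))" and S: "Dl S" "\<And>e. Q e \<longleftrightarrow> (\<exists>x. S (x ## e))"
    using assms unfolding Sg_def by blast
  then show ?thesis unfolding Sg_def by (intro exI[of _ "\<lambda>e. R e \<or> S e"]) (auto intro: Dl_or)
qed

text \<open>Induction on \<open>t\<close> for a bound \<open>c\<close> on the witnesses of all
  \<open>y < t\<close>. The numbers verifying the matrix are bounded by the same \<open>c\<close>,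
  which keeps the induction formula \<open>\<Sigma>\<^sup>0\<^sub>1\<close>; the disjunct
  \<open>b < t\<close> covers the arguments about which nothing is assumed.\<close>

lemma collection:
  assumes "Sg (\<lambda>e. P (e 0) (e (Suc 0)))" "\<And>y. y < b \<Longrightarrow> \<exists>x. P x y"
  shows "\<exists>c. \<forall>y<b. \<exists>x<c. P x y"
proof -
  obtain R where R: "Dl R" "\<And>e. P (e 0) (e (Suc 0)) \<longleftrightarrow> (\<exists>x. R (x ## e))"
    using assms(1) unfolding Sg_def by blast
  let ?R = "\<lambda>z x y. R (z ## x ## y ## (\<lambda>_. 0))"
  have P: "P x y \<longleftrightarrow> (\<exists>z. ?R z x y)" for x y using R(2)[of "x ## y ## (\<lambda>_. 0)"] by simp
  define g :: "nat \<Rightarrow> env \<Rightarrow> mnum" where "g = (\<lambda>e. e 0) ## (\<lambda>e. e (Suc 0)) ## (\<lambda>e. e (Suc (Suc 0))) ## (\<lambda>n e. 0)"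
  have "atm (g n)" for n by (auto simp: g_def atm_def split: nat.split)
  then have "Dl (\<lambda>e. R (\<lambda>n. g n e))" using R(1) by (rule Dl_atm_subst[rotated])
  moreover have "(\<lambda>n. g n e) = e 0 ## e (Suc 0) ## e (Suc (Suc 0)) ## (\<lambda>_. 0)" for e
    by (rule ext) (auto simp: g_def split: nat.split)
  ultimately have D: "Dl (\<lambda>e. ?R (e 0) (e (Suc 0)) (e (Suc (Suc 0))))" by simp
  have "t \<le> b \<Longrightarrow> \<exists>c. \<forall>y<t. \<exists>x<c. \<exists>z<c. ?R z x y" for t
  proof -
    have "\<exists>c. b < t \<or> (\<forall>y<t. \<exists>x<c. \<exists>z<c. ?R z x y)"
    proof (induction t rule: Sg_induct)
      case Sg
      from D have "Dl (\<lambda>e. ?R (e 0) (e (Suc 0)) (e (Suc (Suc 0))))" .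
      from Dl_shift[OF this, of "0 ## Suc 0 ## (\<lambda>_. Suc (Suc 0))"]
      show ?case by (intro Dl_ex_Sg dl) simp
    next
      case 0
      show ?case by simp
    next
      case (Suc t)
      then obtain c where c: "b < t \<or> (\<forall>y<t. \<exists>x<c. \<exists>z<c. ?R z x y)" by blast
      show ?case
      proof (cases "b < t + 1")
        case True
        then show ?thesis by blast
      next
        case False
        then have "t < b" by (simp add: zify)
        then obtain x z where xz: "?R z x t" using assms(2) P by blast
        let ?c = "c + x + z + 1"
        have le: "c \<le> ?c" "x < ?c" "z < ?c"
          using nn_nonneg[of x] nn_nonneg[of z] nn_nonneg[of c] by (simp_all add: zify)
        have "\<exists>x<?c. \<exists>z<?c. ?R z x y" if y: "y < t + 1" for y
        proof (cases "y = t")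
          case True
          then show ?thesis using xz le by blast
        next
          case False
          then have "y < t" using y by (simp add: num_less_Suc)
          then obtain x z where "x < c" "z < c" "?R z x y" using c \<open>t < b\<close> by auto
          then show ?thesis using le(1) by (meson less_le_trans)
        qed
        then show ?thesis by blast
      qed
    qed
    then show "t \<le> b \<Longrightarrow> \<exists>c. \<forall>y<t. \<exists>x<c. \<exists>z<c. ?R z x y" by auto
  qed
  from this[of b] show ?thesis using P by blast
qed

lemma Sg_const_env:
  assumes "Sg (\<lambda>e. P (e 0) (e (Suc 0)) (\<lambda>n. e (Suc (Suc n))))"
  shows "Sg (\<lambda>e. P (e 0) (e (Suc 0)) d)"
proof -
  define g :: "nat \<Rightarrow> env \<Rightarrow> mnum" where "g = (\<lambda>e. e 0) ## (\<lambda>e. e (Suc 0)) ## (\<lambda>n e. d n)"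
  have "atm (g n)" for n by (auto simp: g_def atm_def split: nat.split)
  from Sg_subst_atm[OF assms, of g, OF this] show ?thesis by (simp add: g_def)
qed

lemma cons_eta2: "(e 0 ## e (Suc 0) ## (\<lambda>n. e (Suc (Suc n)))) = e"
  by (auto split: nat.split)

lemma atm_tail: "atm g \<Longrightarrow> atm (\<lambda>e. g (\<lambda>n. e (Suc n)))"
  unfolding atm_def by auto

lemma Tm_tail: assumes "Tm f" shows "Tm (\<lambda>e. f (\<lambda>n. e (Suc n)))"
proof -
  obtain \<tau> t where t: "Trep \<tau> t f" using assms unfolding Tm_def by blast
  have "atm (\<lambda>e. \<tau> n (\<lambda>n. e (Suc n)))" for n using t unfolding Trep_def by (blast intro: atm_tail)
  then have "Trep (\<lambda>n e. \<tau> n (\<lambda>n. e (Suc n))) t (\<lambda>e. f (\<lambda>n. e (Suc n)))" using t by (simp add: Trep_def)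
  then show ?thesis unfolding Tm_def by blast
qed

text \<open>Collection moves the unbounded quantifier in front of the bounded one.\<close>

lemma Sg_ball_Tm:
  assumes "Sg (\<lambda>e. P (e 0) (\<lambda>n. e (Suc n)))" "Tm f"
  shows "Sg (\<lambda>e. \<forall>y<f e. P y e)"
proof -
  obtain R where R: "Dl R" "\<And>e. P (e 0) (\<lambda>n. e (Suc n)) \<longleftrightarrow> (\<exists>x. R (x ## e))"
    using assms(1) unfolding Sg_def by blast
  have P: "P y e \<longleftrightarrow> (\<exists>x. R (x ## y ## e))" for y e using R(2)[of "y ## e"] by simp
  have eq: "(\<forall>y<f e. P y e) \<longleftrightarrow> (\<exists>c. \<forall>y<f e. \<exists>x<c. R (x ## y ## e))" for e
  proof
    assume "\<forall>y<f e. P y e"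
    moreover have "Sg (\<lambda>d. R (d 0 ## d (Suc 0) ## e))"
      by (rule Sg_const_env) (simp add: cons_eta2 Dl_Sg R(1))
    ultimately show "\<exists>c. \<forall>y<f e. \<exists>x<c. R (x ## y ## e)"
      using collection[of "\<lambda>x y. R (x ## y ## e)" "f e"] P by blast
  qed (use P in blast)
  have "Dl (\<lambda>e. R (\<lambda>n. e ((0 ## Suc 0 ## (\<lambda>n. Suc (Suc (Suc n)))) n)))"
    using R(1) by (rule Dl_shift)
  moreover have "(\<lambda>n. e ((0 ## Suc 0 ## (\<lambda>n. Suc (Suc (Suc n)))) n)) =
    e 0 ## e (Suc 0) ## (\<lambda>n. e (Suc (Suc (Suc n))))" for e :: env
    by (auto split: nat.split)
  ultimately have D: "Dl (\<lambda>e. R (e 0 ## e (Suc 0) ## (\<lambda>n. e (Suc (Suc (Suc n))))))" by simp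
  have "Tm (\<lambda>e. f (\<lambda>n. e (Suc n)))" using assms(2) by (rule Tm_tail)
  then have "Dl (\<lambda>e. \<forall>y<f (\<lambda>n. e (Suc n)). \<exists>x<e 0. R (x ## y ## (\<lambda>n. e (Suc n))))"
    using D by (intro dl)
  from Dl_ex_Sg[of "\<lambda>c e. \<forall>y<f e. \<exists>x<c. R (x ## y ## e)", OF this]
  show ?thesis unfolding eq .
qed

section \<open>Composition of recursive functions and predicates\<close>

definition RF :: "(env \<Rightarrow> mnum) \<Rightarrow> bool" where
  "RF f \<longleftrightarrow> Sg (\<lambda>e. e 0 = f (\<lambda>n. e (Suc n)))"

definition Rc :: "(env \<Rightarrow> bool) \<Rightarrow> bool" where
  "Rc P \<longleftrightarrow> Sg P \<and> Sg (\<lambda>e. \<not> P e)"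

lemma Rc_Sg: "Rc P \<Longrightarrow> Sg P" by (simp add: Rc_def)

lemma Sg_subst:
  assumes "Sg (\<lambda>e. P (e 0) (\<lambda>n. e (Suc n)))" "RF f"
  shows "Sg (\<lambda>e. P (f e) e)"
proof -
  have "Sg (\<lambda>e. e 0 = f (\<lambda>n. e (Suc n)) \<and> P (e 0) (\<lambda>n. e (Suc n)))"
    using assms unfolding RF_def by (intro Sg_and)
  from Sg_ex[of "\<lambda>y e. y = f e \<and> P y e", OF this] show ?thesis by simp
qed

text \<open>Totality of \<open>f\<close> lets \<open>\<exists>y. y = f e \<and> \<not> P y e\<close>
  express the negation, so both halves remain \<open>\<Sigma>\<^sup>0\<^sub>1\<close>.\<close>

lemma Rc_subst:
  assumes "Rc (\<lambda>e. P (e 0) (\<lambda>n. e (Suc n)))" "RF f"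
  shows "Rc (\<lambda>e. P (f e) e)"
  using assms Sg_subst[of P f] Sg_subst[of "\<lambda>x e. \<not> P x e" f] unfolding Rc_def by blast

lemma RF_tail: "RF f \<Longrightarrow> RF (\<lambda>e. f (\<lambda>n. e (Suc n)))"
  using Sg_shift[of "\<lambda>e. e 0 = f (\<lambda>n. e (Suc n))" "0 ## (\<lambda>n. Suc (Suc n))"] unfolding RF_def by simp

lemma RF_subst:
  assumes "RF (\<lambda>e. h (e 0) (\<lambda>n. e (Suc n)))" "RF f"
  shows "RF (\<lambda>e. h (f e) e)"
proof -
  have 1: "Sg (\<lambda>e. e (Suc 0) = h (e 0) (\<lambda>n. e (Suc (Suc n))))"
    using Sg_shift[OF assms(1)[unfolded RF_def], of "Suc 0 ## 0 ## (\<lambda>n. Suc (Suc n))"] by simp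
  show ?thesis unfolding RF_def
    by (rule Sg_subst[of "\<lambda>y e. e 0 = h y (\<lambda>n. e (Suc n))", OF 1 RF_tail[OF assms(2)]])
qed

lemma Tm_RF: assumes "Tm f" shows "RF f"
  unfolding RF_def using Tm_tail[OF assms] by (intro Dl_Sg dl)

lemma RF_var [rc]: "RF (\<lambda>e. e n)" by (intro Tm_RF dl)
lemma RF_const [rc]: "RF (\<lambda>e. k)" by (intro Tm_RF dl)

lemma RF_comp1:
  assumes "RF (\<lambda>e. h (e 0))" "RF f"
  shows "RF (\<lambda>e. h (f e))"
  by (rule RF_subst[of "\<lambda>x e. h x", OF assms])

lemma RF_comp2:
  assumes "RF (\<lambda>e. h (e 0) (e (Suc 0)))" "RF f" "RF g"
  shows "RF (\<lambda>e. h (f e) (g e))"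
proof -
  have "RF (\<lambda>e. h (f (\<lambda>n. e (Suc n))) (e 0))"
    by (rule RF_subst[of "\<lambda>x e. h x (e 0)", OF assms(1) RF_tail[OF assms(2)]])
  from RF_subst[of "\<lambda>y e. h (f e) y" g, OF this assms(3)] show ?thesis .
qed

lemma RF_comp3:
  assumes "RF (\<lambda>e. h (e 0) (e (Suc 0)) (e (Suc (Suc 0))))" "RF f" "RF g" "RF k"
  shows "RF (\<lambda>e. h (f e) (g e) (k e))"
proof -
  have "RF (\<lambda>e. h (f (\<lambda>n. e (Suc (Suc n)))) (e 0) (e (Suc 0)))"
    by (rule RF_subst[of "\<lambda>x e. h x (e 0) (e (Suc 0))", OF assms(1) RF_tail[OF RF_tail[OF assms(2)]]])
  from RF_subst[of "\<lambda>y e. h (f (\<lambda>n. e (Suc n))) y (e 0)", OF this RF_tail[OF assms(3)]]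
  have "RF (\<lambda>e. h (f (\<lambda>n. e (Suc n))) (g (\<lambda>n. e (Suc n))) (e 0))" .
  from RF_subst[of "\<lambda>y e. h (f e) (g e) y" k, OF this assms(4)] show ?thesis .
qed

lemma Rc_comp1:
  assumes "Rc (\<lambda>e. P (e 0))" "RF f"
  shows "Rc (\<lambda>e. P (f e))"
  by (rule Rc_subst[of "\<lambda>x e. P x", OF assms])

lemma Rc_comp2:
  assumes "Rc (\<lambda>e. P (e 0) (e (Suc 0)))" "RF f" "RF g"
  shows "Rc (\<lambda>e. P (f e) (g e))"
proof -
  have "Rc (\<lambda>e. P (f (\<lambda>n. e (Suc n))) (e 0))"
    by (rule Rc_subst[of "\<lambda>x e. P x (e 0)", OF assms(1) RF_tail[OF assms(2)]])
  from Rc_subst[of "\<lambda>y e. P (f e) y" g, OF this assms(3)] show ?thesis .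
qed

lemma Sg_comp1:
  assumes "Sg (\<lambda>e. P (e 0))" "RF f"
  shows "Sg (\<lambda>e. P (f e))"
  by (rule Sg_subst[of "\<lambda>x e. P x", OF assms])

lemma Sg_comp2:
  assumes "Sg (\<lambda>e. P (e 0) (e (Suc 0)))" "RF f" "RF g"
  shows "Sg (\<lambda>e. P (f e) (g e))"
proof -
  have "Sg (\<lambda>e. P (f (\<lambda>n. e (Suc n))) (e 0))"
    by (rule Sg_subst[of "\<lambda>x e. P x (e 0)", OF assms(1) RF_tail[OF assms(2)]])
  from Sg_subst[of "\<lambda>y e. P (f e) y" g, OF this assms(3)] show ?thesis .
qed

lemma RF_add [rc]: "RF f \<Longrightarrow> RF g \<Longrightarrow> RF (\<lambda>e. f e + g e)"
  by (rule RF_comp2[of "(+)", OF Tm_RF]) (intro dl)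

lemma RF_mul [rc]: "RF f \<Longrightarrow> RF g \<Longrightarrow> RF (\<lambda>e. f e * g e)"
  by (rule RF_comp2[of "(*)", OF Tm_RF]) (intro dl)

lemma Dl_Rc: "Dl P \<Longrightarrow> Rc P" by (simp add: Rc_def Dl_Sg Dl_not)

lemma Rc_eq [rc]: "RF f \<Longrightarrow> RF g \<Longrightarrow> Rc (\<lambda>e. f e = g e)"
  by (rule Rc_comp2[of "(=)", OF Dl_Rc]) (intro dl)

lemma Rc_less [rc]: "RF f \<Longrightarrow> RF g \<Longrightarrow> Rc (\<lambda>e. f e < g e)"
  by (rule Rc_comp2[of "(<)", OF Dl_Rc]) (intro dl)

lemma Rc_mem [rc]: "X \<in> NS \<Longrightarrow> RF f \<Longrightarrow> Rc (\<lambda>e. f e \<in> X)"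
  by (rule Rc_comp1[of "\<lambda>x. x \<in> X", OF Dl_Rc]) (intro dl)

lemma Rc_not [rc]: "Rc P \<Longrightarrow> Rc (\<lambda>e. \<not> P e)" by (simp add: Rc_def)

lemma Rc_and [rc]: "Rc P \<Longrightarrow> Rc Q \<Longrightarrow> Rc (\<lambda>e. P e \<and> Q e)"
  unfolding Rc_def de_Morgan_conj by (elim conjE, intro conjI Sg_and Sg_or)

lemma Rc_or [rc]: "Rc P \<Longrightarrow> Rc Q \<Longrightarrow> Rc (\<lambda>e. P e \<or> Q e)"
  unfolding Rc_def de_Morgan_disj by (elim conjE, intro conjI Sg_and Sg_or)

lemma Rc_imp [rc]: "Rc P \<Longrightarrow> Rc Q \<Longrightarrow> Rc (\<lambda>e. P e \<longrightarrow> Q e)"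
  unfolding imp_conv_disj by (intro rc)

lemma Sg_imp [rc]: "Rc P \<Longrightarrow> Sg Q \<Longrightarrow> Sg (\<lambda>e. P e \<longrightarrow> Q e)"
  unfolding imp_conv_disj Rc_def by (intro rc) auto

lemma Rc_iff [rc]: "Rc P \<Longrightarrow> Rc Q \<Longrightarrow> Rc (\<lambda>e. P e \<longleftrightarrow> Q e)"
  unfolding iff_conv_conj_imp by (intro rc)

lemma Rc_le [rc]: "RF f \<Longrightarrow> RF g \<Longrightarrow> Rc (\<lambda>e. f e \<le> g e)"
  using Rc_not[OF Rc_less, of g f] by (simp add: not_less)

lemma Sg_eq [rc]: "RF f \<Longrightarrow> RF g \<Longrightarrow> Sg (\<lambda>e. f e = g e)" by (intro Rc_Sg rc)
lemma Sg_less [rc]: "RF f \<Longrightarrow> RF g \<Longrightarrow> Sg (\<lambda>e. f e < g e)" by (intro Rc_Sg rc)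
lemma Sg_le [rc]: "RF f \<Longrightarrow> RF g \<Longrightarrow> Sg (\<lambda>e. f e \<le> g e)" by (intro Rc_Sg rc)
lemma Sg_not [rc]: "Rc P \<Longrightarrow> Sg (\<lambda>e. \<not> P e)" by (simp add: Rc_def)

lemma Sg_ball [rc]:
  assumes "Sg (\<lambda>e. P (e 0) (\<lambda>n. e (Suc n)))" "RF f"
  shows "Sg (\<lambda>e. \<forall>y<f e. P y e)"
proof -
  have "Sg (\<lambda>e. P (e 0) (\<lambda>n. e (Suc (Suc n))))"
    using Sg_shift[OF assms(1), of "0 ## (\<lambda>n. Suc (Suc n))"] by simp
  then have "Sg (\<lambda>e. \<forall>y<e 0. P y (\<lambda>n. e (Suc n)))" by (intro Sg_ball_Tm dl)
  from Sg_subst[of "\<lambda>x e. \<forall>y<x. P y e", OF this assms(2)] show ?thesis .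
qed

lemma Sg_bex [rc]:
  assumes "Sg (\<lambda>e. P (e 0) (\<lambda>n. e (Suc n)))" "RF f"
  shows "Sg (\<lambda>e. \<exists>y<f e. P y e)"
  using assms RF_tail[OF assms(2)] by (intro rc)

lemma Rc_ball [rc]:
  assumes "Rc (\<lambda>e. P (e 0) (\<lambda>n. e (Suc n)))" "RF f"
  shows "Rc (\<lambda>e. \<forall>y<f e. P y e)"
  using assms Sg_ball[of P f] Sg_bex[of "\<lambda>x e. \<not> P x e" f] unfolding Rc_def by simp

lemma Rc_bex [rc]:
  assumes "Rc (\<lambda>e. P (e 0) (\<lambda>n. e (Suc n)))" "RF f"
  shows "Rc (\<lambda>e. \<exists>y<f e. P y e)"
  using assms Sg_bex[of P f] Sg_ball[of "\<lambda>x e. \<not> P x e" f] unfolding Rc_def by simp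

lemma RF_if [rc]:
  assumes "Rc P" "RF f" "RF g"
  shows "RF (\<lambda>e. if P e then f e else g e)"
proof -
  have P: "Rc (\<lambda>e. P (\<lambda>n. e (Suc n)))"
    using assms(1) unfolding Rc_def
    using Sg_shift[of P Suc] Sg_shift[of "\<lambda>e. \<not> P e" Suc] by blast
  have "Sg (\<lambda>e. (P (\<lambda>n. e (Suc n)) \<and> e 0 = f (\<lambda>n. e (Suc n))) \<or>
    (\<not> P (\<lambda>n. e (Suc n)) \<and> e 0 = g (\<lambda>n. e (Suc n))))"
    using P Rc_Sg[OF P] RF_tail[OF assms(2)] RF_tail[OF assms(3)] by (intro rc)
  then show ?thesis unfolding RF_def by (rule Sg_cong) auto
qed

lemma RF_graph:
  assumes "Sg (\<lambda>e. Q (e 0) (\<lambda>n. e (Suc n)))" "\<And>y e. y = f e \<longleftrightarrow> Q y e"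
  shows "RF f"
  unfolding RF_def using assms by simp

lemma RF_diff [rc]:
  assumes "RF f" "RF g" shows "RF (\<lambda>e. f e - g e)"
proof (rule RF_comp2[of "(-)", OF _ assms])
  show "RF (\<lambda>e. e 0 - e (Suc 0))"
  proof (rule RF_graph)
    show "Sg (\<lambda>e. (e 0 + e (Suc (Suc 0)) = e (Suc 0)) \<or> (e (Suc 0) < e (Suc (Suc 0)) \<and> e 0 = 0))"
      by (intro rc)
  next
    show "y = e 0 - e (Suc 0) \<longleftrightarrow> y + e (Suc 0) = e 0 \<or> (e 0 < e (Suc 0) \<and> y = 0)" for y and e :: env
      by (metis add_diff_cancel_right' le_add_diff_inverse2 not_less num_diff_0 order_less_imp_le)
  qed
qed

lemma comprehension_Rc: "Rc (\<lambda>e. P (e 0)) \<Longrightarrow> {x. P x} \<in> NS"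
  unfolding Rc_def by (rule comprehension_Sg) auto

lemma Rc_induct [case_names Rc 0 Suc]:
  assumes "Rc (\<lambda>e. P (e 0))" "P 0" "\<And>x. P x \<Longrightarrow> P (x + 1)"
  shows "P x"
  using Sg_induct[of P] assms unfolding Rc_def by blast

lemma Rc_less_induct [case_names Rc less]:
  assumes "Rc (\<lambda>e. P (e 0))" "\<And>x. (\<And>y. y < x \<Longrightarrow> P y) \<Longrightarrow> P x"
  shows "P x"
proof -
  have "\<forall>y<x+1. P y"
  proof (induction x rule: Rc_induct)
    case Rc
    show ?case by (intro rc) (use assms(1) in \<open>auto intro: Rc_comp1 rc\<close>)
  next
    case 0
    show ?case using assms(2)[of 0] num_less_Suc[of _ 0] by simp
  next
    case (Suc x)
    have "P (x + 1)" by (rule assms(2)) (use Suc in blast)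
    then show ?case unfolding num_less_Suc[of _ "x + 1"] le_less using Suc by blast
  qed
  then show ?thesis by (simp add: num_less_Suc)
qed

lemma Rc_least:
  assumes "Rc (\<lambda>e. P (e 0))" "P x"
  obtains y where "P y" "\<And>z. z < y \<Longrightarrow> \<not> P z"
proof -
  have "\<exists>y. P y \<and> (\<forall>z<y. \<not> P z)"
  proof (rule ccontr)
    assume c: "\<nexists>y. P y \<and> (\<forall>z<y. \<not> P z)"
    have "\<not> P x" for x
    proof (induction x rule: Rc_less_induct)
      case Rc
      show ?case using assms(1) by (rule Rc_not)
    qed (use c in blast)
    then show False using assms(2) by blast
  qed
  then show ?thesis using that by blast
qed

section \<open>Sequence coding and primitive recursion\<close>

lemma num_division:
  assumes "0 < (m::mnum)"
  shows "\<exists>q r. c = q * m + r \<and> r < m"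
proof (induction c rule: Sg_induct)
  case Sg
  show ?case by (intro rc)
next
  case 0
  show ?case by (rule exI[of _ 0], rule exI[of _ 0]) (use assms in simp)
next
  case (Suc c)
  then obtain q r where *: "c = q * m + r" "r < m" by blast
  show ?case
  proof (cases "r + 1 < m")
    case True
    then show ?thesis using *(1) by (metis add.assoc)
  next
    case False
    then have "m = r + 1" using *(2) by (simp add: zify)
    then have "c + 1 = (q + 1) * m + 0" using *(1) by (simp add: algebra_simps)
    then show ?thesis using assms by blast
  qed
qed

lemma num_division_unique:
  assumes "q * m + r = q' * m + (r' :: mnum)" "r < m" "r' < m"
  shows "q = q' \<and> r = r'"
proof -
  have *: "\<not> q < q'" if h: "q * m + r = q' * m + (r' :: mnum)" "r < m" for q q' r r'
  proof
    assume "q < q'"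
    then have "q + 1 \<le> q'" by (simp add: num_Suc_le)
    then have "(q + 1) * m \<le> q' * m" by (rule mult_right_mono) simp
    then have "q * m + m \<le> q' * m" by (simp add: algebra_simps)
    also have "\<dots> \<le> q * m + r" unfolding h(1) by simp
    finally have "q * m + m \<le> q * m + r" .
    then show False using h(2) by simp
  qed
  have "q = q'" using *[OF assms(1,2)] *[OF assms(1)[symmetric] assms(3)] by simp
  then show ?thesis using assms(1) by simp
qed

definition ent :: "mnum \<Rightarrow> mnum \<Rightarrow> mnum \<Rightarrow> mnum \<Rightarrow> bool" where
  "ent c d i x \<longleftrightarrow> x < (i + 1) * d + 1 \<and> (\<exists>q. c = q * ((i + 1) * d + 1) + x)"

definition bt :: "mnum \<Rightarrow> mnum \<Rightarrow> mnum \<Rightarrow> mnum" where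
  "bt c d i = (THE x. ent c d i x)"

text \<open>The modulus \<open>(i + 1) * d + 1\<close> is positive, so a remainder always exists and
  every pair of numbers codes a total sequence.\<close>

lemma ent_bt: "ent c d i x \<longleftrightarrow> x = bt c d i"
proof -
  have "0 < (i + 1) * d + 1" by (simp add: zero_less_iff_neq_zero)
  from num_division[OF this, of c] obtain y where y: "ent c d i y" unfolding ent_def by blast
  have u: "z = y" if "ent c d i z" for z using that y num_division_unique unfolding ent_def by metis
  then have "bt c d i = y" unfolding bt_def using y by blast
  then show ?thesis using u y by blast
qed

lemma RF_bt [rc]: "RF f \<Longrightarrow> RF g \<Longrightarrow> RF h \<Longrightarrow> RF (\<lambda>e. bt (f e) (g e) (h e))"
proof (rule RF_comp3[of bt])
  show "RF (\<lambda>e. bt (e 0) (e (Suc 0)) (e (Suc (Suc 0))))"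
  proof (rule RF_graph)
    show "y = bt (e 0) (e (Suc 0)) (e (Suc (Suc 0))) \<longleftrightarrow> ent (e 0) (e (Suc 0)) (e (Suc (Suc 0))) y"
      for y and e :: env by (simp add: ent_bt)
    show "Sg (\<lambda>e. ent (e (Suc 0)) (e (Suc (Suc 0))) (e (Suc (Suc (Suc 0)))) (e 0))"
      unfolding ent_def by (intro rc)
  qed
qed

text \<open>Replaces the factorial in Goedel's argument, whose definition would presuppose the
  recursion that the coding is to provide.\<close>

lemma common_multiple: "\<exists>d::mnum. 0 < d \<and> (\<forall>k<l. \<exists>q. d = (k + 1) * q)"
proof (induction l rule: Sg_induct)
  case Sg
  show ?case by (intro rc)
next
  case 0
  show ?case by (rule exI[of _ 1]) simp
next
  case (Suc l)
  then obtain d where d: "0 < d" "\<forall>k<l. \<exists>q. d = (k + 1) * q" by blast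
  have "\<exists>q. d * (l + 1) = (k + 1) * q" if "k < l + 1" for k
  proof (cases "k = l")
    case True
    then show ?thesis by (intro exI[of _ d]) (simp add: ac_simps)
  next
    case False
    then have "k < l" using that by (simp add: num_less_Suc)
    then obtain q where "d = (k + 1) * q" using d by blast
    then show ?thesis by (intro exI[of _ "q * (l + 1)"]) (simp add: ac_simps)
  qed
  moreover have "0 < d * (l + 1)" using d(1) by (simp add: zero_less_iff_neq_zero)
  ultimately show ?case by blast
qed

text \<open>Invertibility instead of coprimality: it is visibly
  \<open>\<Sigma>\<^sup>0\<^sub>1\<close>, passes to products, and hands over the multiplier that
  Chinese remaindering needs.\<close>

definition inv_mod :: "mnum \<Rightarrow> mnum \<Rightarrow> bool" where
  "inv_mod P m \<longleftrightarrow> (\<exists>u q. P * u = q * m + 1)"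

lemma inv_mod_mult:
  assumes "inv_mod P m" "inv_mod Q m"
  shows "inv_mod (P * Q) m"
proof -
  obtain u q v r where *: "P * u = q * m + 1" "Q * v = r * m + 1" using assms unfolding inv_mod_def by blast
  have "(P * Q) * (u * v) = (P * u) * (Q * v)" by (simp add: ac_simps)
  also have "\<dots> = (q * r * m + q + r) * m + 1" unfolding * by (simp add: algebra_simps)
  finally show ?thesis unfolding inv_mod_def by blast
qed

text \<open>
  The moduli \<open>(i + 1) d + 1\<close> are invertible modulo each other because \<open>(j - i)\<close> divides \<open>d\<close> and
  \<open>(i + 1) d\<close> is \<open>-1\<close> modulo the smaller modulus.
\<close>

lemma inv_mod_moduli:
  assumes "j = i + k + 1" "d = (k + 1) * q" "0 < d"
  shows "inv_mod ((j + 1) * d + 1) ((i + 1) * d + 1)"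
proof -
  let ?m = "(i + 1) * d + 1" let ?I = "i + 1"
  \<comment> \<open>With \<open>?I * d = z + 1\<close> the modulus \<open>?m\<close> is
    \<open>z + 2\<close>, and \<open>(z + 1) * (z + 1) = z * (z + 2) + 1\<close>. The inverse
    \<open>q * ?I * ?I\<close> is chosen so that its product with \<open>(k + 1) * d\<close> is this
    square.\<close>
  have "0 < ?I * d" using assms(3) by (simp add: zero_less_iff_neq_zero)
  then obtain z where z: "?I * d = z + 1" unfolding num_less_iff by auto
  have "((j + 1) * d + 1) * (q * ?I * ?I) = ?m * (q * ?I * ?I) + (k + 1) * d * (q * ?I * ?I)"
    unfolding assms(1) by (simp add: algebra_simps)
  also have "(k + 1) * d * (q * ?I * ?I) = (?I * d) * (?I * ((k + 1) * q))"
    by (simp only: ac_simps)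
  also have "\<dots> = (?I * d) * (?I * d)" unfolding assms(2)[symmetric] ..
  also have "\<dots> = z * ?m + 1" unfolding z by (simp add: algebra_simps)
  finally have "((j + 1) * d + 1) * (q * ?I * ?I) = (q * ?I * ?I + z) * ?m + 1"
    by (simp add: algebra_simps)
  then show ?thesis unfolding inv_mod_def by blast
qed

text \<open>
  Chinese remaindering, from the last entry down to the first: each new modulus is then the
  smaller one in the preceding lemma.
\<close>

lemma beta_lemma:
  assumes s: "RF (\<lambda>e. s (e 0))"
  shows "\<exists>c d. \<forall>i<l. bt c d i = s i"
proof -
  have s': "RF f \<Longrightarrow> RF (\<lambda>e. s (f e))" for f by (rule RF_comp1[OF s])
  have "\<exists>b. \<forall>i<l. \<exists>x<b. x = s i"
    by (rule collection) (intro rc s', blast)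
  then obtain b where b: "\<And>i. i < l \<Longrightarrow> s i < b" by blast
  obtain d0 where d0: "0 < d0" "\<forall>k<l. \<exists>q. d0 = (k + 1) * q" using common_multiple by blast
  \<comment> \<open>The factor \<open>d0\<close> makes the moduli invertible modulo each other, the
    factor \<open>b + 1\<close> makes them exceed all entries.\<close>
  define d where "d = d0 * (b + 1)"
  have d: "0 < d" "\<exists>q. d = (k + 1) * q" if kl: "k < l" for k
  proof -
    show "0 < d" unfolding d_def using d0(1) by (simp add: zero_less_iff_neq_zero)
    obtain q where "d0 = (k + 1) * q" using d0 kl by blast
    then show "\<exists>q. d = (k + 1) * q" unfolding d_def by (intro exI[of _ "q * (b + 1)"]) (simp add: ac_simps)
  qed
  define m where "m i = (i + 1) * d + 1" for i
  have m': "RF f \<Longrightarrow> RF (\<lambda>e. m (f e))" for f unfolding m_def by (intro rc)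
  have sm: "s i < m i" if "i < l" for i
  proof -
    have "s i < b" using b that .
    also have "b \<le> 1 * (b + 1)" by simp
    also have "\<dots> \<le> d0 * (b + 1)" using d0(1) num_Suc_le[of 0 d0] by (intro mult_right_mono) simp_all
    also have "\<dots> = 1 * d" by (simp add: d_def)
    also have "\<dots> \<le> (i + 1) * d" by (intro mult_right_mono) simp_all
    also have "\<dots> \<le> m i" by (simp add: m_def)
    finally show ?thesis .
  qed
  have inv: "inv_mod (m j) (m i)" if "i < j" "j < l" for i j
  proof -
    obtain k where k: "j = i + k + 1" using \<open>i < j\<close> num_less_iff by auto
    have "k < l" using that(2) k nn_nonneg[of i] nn_nonneg[of k] by (simp add: zify)
    then obtain q where "d = (k + 1) * q" "0 < d" using d by blast
    then show ?thesis unfolding m_def using inv_mod_moduli k by blast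
  qed
  \<comment> \<open>After \<open>i\<close> steps \<open>c\<close> has the last \<open>i\<close>
    entries right, and \<open>P\<close> is a multiple of their moduli and still invertible modulo
    the others.\<close>
  have "\<exists>c P. \<forall>j<l. if l \<le> j + i then (\<exists>q. c = q * m j + s j) \<and> (\<exists>q. P = q * m j) else inv_mod P (m j)"
    (is "?Q i") for i
  proof (induction i rule: Sg_induct)
    case Sg
    have eq: "(if B then X else Y) \<longleftrightarrow> (B \<longrightarrow> X) \<and> (\<not> B \<longrightarrow> Y)" for B X Y by auto
    show ?case unfolding eq inv_mod_def by (intro rc m' s')
  next
    case 0
    show ?case by (rule exI[of _ 0], rule exI[of _ 1]) (auto simp: inv_mod_def intro: exI[of _ 1])
  next
    case (Suc i)
    then obtain c P where cP: "\<And>j. j < l \<Longrightarrow> l \<le> j + i \<Longrightarrow> \<exists>q. c = q * m j + s j"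
      "\<And>j. j < l \<Longrightarrow> l \<le> j + i \<Longrightarrow> \<exists>q. P = q * m j"
      "\<And>j. j < l \<Longrightarrow> \<not> l \<le> j + i \<Longrightarrow> inv_mod P (m j)" by metis
    show ?case
    proof (cases "\<exists>j. l = j + i + 1")
      case False
      have "l \<le> j + (i + 1) \<longleftrightarrow> l \<le> j + i" for j
      proof
        assume h: "l \<le> j + (i + 1)"
        show "l \<le> j + i"
        proof (rule ccontr)
          assume "\<not> l \<le> j + i"
          then have "l = j + i + 1" using h by (simp add: zify)
          then show False using False by blast
        qed
      qed (simp add: add_increasing2 zify)
      then show ?thesis using Suc by simp
    next
      case True
      then obtain k where k: "l = k + i + 1" by blast
      have kl: "k < l" using k nn_nonneg[of i] by (simp add: zify)
      have "inv_mod P (m k)" using cP(3)[OF kl] k by (simp add: zify)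
      then obtain u q where u: "P * u = q * m k + 1" unfolding inv_mod_def by blast
      \<comment> \<open>Modulo \<open>m k\<close>, \<open>P * u\<close> is 1 and
        \<open>(k + 1) * d\<close> is -1, so adding \<open>P * t\<close> turns \<open>c\<close> into
        \<open>s k\<close>; the product with \<open>(k + 1) * d\<close> stands for a subtraction of
        \<open>c\<close>.\<close>
      define t where "t = u * (s k + c * ((k + 1) * d))"
      have "c + P * t = c + (q * m k + 1) * (s k + c * ((k + 1) * d))"
        unfolding t_def using u by (simp add: mult.assoc[symmetric])
      also have "\<dots> = (q * (s k + c * ((k + 1) * d)) + c) * m k + s k"
        unfolding m_def by (simp add: algebra_simps)
      finally have new: "c + P * t = (q * (s k + c * ((k + 1) * d)) + c) * m k + s k" .
      have "if l \<le> j + (i + 1) then (\<exists>q. c + P * t = q * m j + s j) \<and> (\<exists>q. P * m k = q * m j)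
        else inv_mod (P * m k) (m j)" if j: "j < l" for j
      proof (cases "l \<le> j + (i + 1)")
        case True
        show ?thesis
        proof (cases "j = k")
          case eq: True
          show ?thesis using True eq new by auto
        next
          case False
          have li: "l \<le> j + i"
          proof (rule ccontr)
            assume "\<not> l \<le> j + i"
            then have "j = k" using True k by (simp add: zify)
            with False show False ..
          qed
          obtain q1 q2 where "c = q1 * m j + s j" "P = q2 * m j" using cP(1,2)[OF j li] by blast
          then have "c + P * t = (q1 + q2 * t) * m j + s j" "P * m k = (q2 * m k) * m j"
            by (simp_all add: algebra_simps)
          then show ?thesis using True by auto
        qed
      next
        case False
        then have "j < k" unfolding k by (simp add: zify)
        have "inv_mod P (m j)" using False cP(3)[OF j] by (simp add: zify)
        moreover have "inv_mod (m k) (m j)" using inv[OF \<open>j < k\<close> kl] .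
        ultimately show ?thesis using False inv_mod_mult by simp
      qed
      then show ?thesis by blast
    qed
  qed
  from this[of l] obtain c where c: "\<And>j. j < l \<Longrightarrow> \<exists>q. c = q * m j + s j" by (auto simp: add_increasing)
  have "bt c d j = s j" if "j < l" for j
    using c[OF that] sm[OF that] ent_bt[of c d j "s j"] unfolding ent_def m_def by auto
  then show ?thesis by blast
qed

text \<open>\<open>F p i\<close> is the last entry of a coded computation of length
  \<open>i\<close>. Such computations exist by \<open>\<Sigma>\<^sup>0\<^sub>1\<close> induction and
  agree wherever they overlap, so the graph of \<open>F\<close> is
  \<open>\<Sigma>\<^sup>0\<^sub>1\<close>.\<close>

lemma primitive_recursion:
  assumes z: "RF (\<lambda>e. z (e 0))" and G: "RF (\<lambda>e. G (e 0) (e (Suc 0)) (e (Suc (Suc 0))))"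
  obtains F where "RF (\<lambda>e. F (e 0) (e (Suc 0)))" "\<And>p. F p 0 = z p" "\<And>p i. F p (i + 1) = G p i (F p i)"
proof -
  have z': "RF f \<Longrightarrow> RF (\<lambda>e. z (f e))" for f by (rule RF_comp1[OF z])
  have G': "RF f \<Longrightarrow> RF g \<Longrightarrow> RF h \<Longrightarrow> RF (\<lambda>e. G (f e) (g e) (h e))" for f g h by (rule RF_comp3[OF G])
  define run where "run p c d i \<longleftrightarrow> bt c d 0 = z p \<and> (\<forall>j<i. bt c d (j + 1) = G p j (bt c d j))" for p c d i
  have ex: "\<exists>c d. run p c d i" for p i
  proof (induction i rule: Sg_induct)
    case Sg
    show ?case unfolding run_def by (intro rc z' G')
  next
    case 0
    have "\<exists>c d. \<forall>i<1. bt c d i = z p" by (rule beta_lemma) (intro rc)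
    then obtain c d where "bt c d 0 = z p" using zero_less_one by blast
    then show ?case unfolding run_def by auto
  next
    case (Suc i)
    then obtain c d where cd: "run p c d i" by blast
    \<comment> \<open>A code cannot be prolonged in place, so the longer sequence is coded
      anew.\<close>
    have "\<exists>c' d'. \<forall>j<i + 1 + 1. bt c' d' j = (if j < i + 1 then bt c d j else G p i (bt c d i))"
      by (rule beta_lemma) (intro rc G')
    then obtain c' d' where *: "\<And>j. j < i + 1 + 1 \<Longrightarrow> bt c' d' j = (if j < i + 1 then bt c d j else G p i (bt c d i))"
      by blast
    have "bt c' d' 0 = z p" using *[of 0] cd nn_nonneg[of i] by (simp add: run_def zify)
    moreover have "bt c' d' (j + 1) = G p j (bt c' d' j)" if "j < i + 1" for j
    proof (cases "j = i")
      case True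
      have "i < i + 1" "i < i + 1 + 1" "i + 1 < i + 1 + 1" by (simp_all add: zify)
      then show ?thesis using *[of "i + 1"] *[of i] True by simp
    next
      case False
      then have "j < i" using that by (simp add: num_less_Suc)
      then have "j + 1 < i + 1" "j + 1 < i + 1 + 1" "j < i + 1 + 1" by (simp_all add: zify)
      then show ?thesis using *[of "j + 1"] *[of j] cd that \<open>j < i\<close> by (simp add: run_def)
    qed
    ultimately show ?case unfolding run_def by blast
  qed
  have uniq: "bt c d j = bt c' d' j" if "run p c d i" "run p c' d' i'" "j \<le> i" "j \<le> i'" for p c d c' d' i i' j
  proof -
    have "j \<le> i \<longrightarrow> j \<le> i' \<longrightarrow> bt c d j = bt c' d' j"
    proof (induction j rule: Rc_induct)
      case Rc
      show ?case by (intro rc)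
    next
      case 0
      show ?case using that(1,2) by (simp add: run_def)
    next
      case (Suc j)
      then show ?case using that(1,2) unfolding run_def num_Suc_le[symmetric] by (auto simp: less_imp_le)
    qed
    then show ?thesis using that by blast
  qed
  define F where "F p i = (THE x. \<exists>c d. run p c d i \<and> x = bt c d i)" for p i
  have F: "x = F p i \<longleftrightarrow> (\<exists>c d. run p c d i \<and> x = bt c d i)" for x p i
  proof -
    obtain c d where cd: "run p c d i" using ex by blast
    have "F p i = bt c d i" unfolding F_def using cd uniq by (intro the_equality) blast+
    then show ?thesis using cd uniq by (metis order_refl)
  qed
  show ?thesis
  proof (rule that)
    show "RF (\<lambda>e. F (e 0) (e (Suc 0)))"
      by (rule RF_graph[OF _ F]) (unfold run_def, intro rc z' G')
    show "F p 0 = z p" for p using F[of "F p 0" p 0] by (auto simp: run_def)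
    fix p i
    obtain c d where cd: "run p c d (i + 1)" using ex by blast
    then have "run p c d i" unfolding run_def by (auto simp: num_less_Suc less_imp_le)
    then have "F p i = bt c d i" using F by metis
    moreover have "F p (i + 1) = bt c d (i + 1)" using F cd by metis
    ultimately show "F p (i + 1) = G p i (F p i)" using cd unfolding run_def by (simp add: num_less_Suc)
  qed
qed

section \<open>Powers of two and binary digits\<close>

text \<open>Exponentiation is not in the language; recursion yields a suitable function and choice
  names it. Its being recursive is part of what is chosen, because the inductions about
  \<open>pw\<close> rely on it.\<close>

definition pw :: "mnum \<Rightarrow> mnum" where
  "pw = (SOME F. RF (\<lambda>e. F (e 0)) \<and> F 0 = 1 \<and> (\<forall>i. F (i + 1) = 2 * F i))"

lemma pw: "RF (\<lambda>e. pw (e 0))" "pw 0 = 1" "pw (i + 1) = 2 * pw i"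
proof -
  obtain F where F: "RF (\<lambda>e. F (e 0) (e (Suc 0)))" "\<And>p. F p 0 = 1" "\<And>p i. F p (i + 1) = 2 * F p i"
  proof (rule primitive_recursion[of "\<lambda>_. 1" "\<lambda>p i x. 2 * x"])
    show "RF (\<lambda>e. 1)" "RF (\<lambda>e. 2 * e (Suc (Suc 0)))" by (intro rc)+
  qed (rule that)
  have "RF (\<lambda>e. F 0 (e 0))" by (rule RF_comp2[OF F(1)]) (intro rc)+
  then have "\<exists>F. RF (\<lambda>e. F (e 0)) \<and> F 0 = 1 \<and> (\<forall>i. F (i + 1) = 2 * F i)" using F(2,3) by blast
  from someI_ex[OF this, folded pw_def]
  show "RF (\<lambda>e. pw (e 0))" "pw 0 = 1" "pw (i + 1) = 2 * pw i" by blast+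
qed

lemma RF_pw [rc]: "RF f \<Longrightarrow> RF (\<lambda>e. pw (f e))"
  by (rule RF_comp1[OF pw(1)])

lemma pw_pos: "0 < pw i"
proof (induction i rule: Rc_induct)
  case Rc
  show ?case by (intro rc)
qed (simp_all add: pw)

lemma pw_add: "pw (i + j) = pw i * pw j"
proof (induction j rule: Rc_induct)
  case Rc
  show ?case by (intro rc)
next
  case (Suc j)
  then show ?case unfolding add.assoc[symmetric] pw(3) by (simp add: ac_simps)
qed (simp add: pw)

lemma pw_1: "pw 1 = 2"
  using pw(3)[of 0] pw(2) by simp

lemma pw_gt: "i < pw i"
proof (induction i rule: Rc_induct)
  case Rc
  show ?case by (intro rc)
next
  case (Suc i)
  then show ?case unfolding pw(3) using nn_nonneg[of i] by (simp add: zify)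
qed (simp add: pw)

lemma pw_less: "i < j \<Longrightarrow> pw i < pw j"
proof -
  assume "i < j"
  then obtain k where k: "j = i + k + 1" by (auto simp: num_less_iff)
  have *: "pw i < 2 * x" if "pw i \<le> x" for x using that pw_pos[of i] by (simp add: zify)
  have "pw i * 1 \<le> pw i * pw k" using pw_pos[of k] by (intro mult_left_mono) (simp_all add: num_Suc_le[of 0])
  then show ?thesis using *[of "pw i * pw k"] by (simp add: k pw_add pw_1 ac_simps)
qed

lemma pw_le: "i \<le> j \<Longrightarrow> pw i \<le> pw j"
  using pw_less by (auto simp: le_less)

lemma pw_less_iff: "pw i < pw j \<longleftrightarrow> i < j"
  using pw_less pw_le by (meson leD leI)

lemma pw_dvd: "i \<le> j \<Longrightarrow> pw i dvd pw j"
  by (auto simp: num_le_iff pw_add)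

lemma Sg_dvd [rc]: "RF f \<Longrightarrow> RF g \<Longrightarrow> Sg (\<lambda>e. f e dvd g e)"
  unfolding dvd_def by (intro rc RF_tail)

definition od :: "mnum \<Rightarrow> bool" where "od q \<longleftrightarrow> (\<exists>r. q = 2 * r + 1)"

lemma not_od: "\<not> od q \<longleftrightarrow> (\<exists>r. q = 2 * r)"
proof -
  obtain p r where pr: "q = p * 2 + r" "r < 2" using num_division[of 2 q] by auto
  then have r: "r = 0 \<or> r = 1"
    using num_less_Suc[of r 1] num_less_Suc[of r 0] by (auto simp: le_less)
  have "2 * x \<noteq> 2 * y + (1::mnum)" for x y
    using num_division_unique[of x 2 0 y 1] by (auto simp: ac_simps zify)
  then show ?thesis using pr r unfolding od_def by (metis add.right_neutral mult.commute)
qed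

text \<open>Digit 1 at place \<open>k\<close> of the binary expansion, as oddness of the quotient by
  \<open>pw k\<close>. Both this form and the one in \<open>not_dig\<close> are
  \<open>\<Sigma>\<^sup>0\<^sub>1\<close>, so numbers can serve as decidable codes of finite
  sets.\<close>

definition dig :: "mnum \<Rightarrow> mnum \<Rightarrow> bool" where
  "dig n k \<longleftrightarrow> (\<exists>q r. r < pw k \<and> n = (2 * q + 1) * pw k + r)"

lemma dig_iff: "r < pw k \<Longrightarrow> dig (q * pw k + r) k \<longleftrightarrow> od q"
  unfolding dig_def od_def by (metis num_division_unique)

lemma dig_division: obtains q r where "n = q * pw k + r" "r < pw k"
  using num_division[OF pw_pos] by blast

lemma not_dig: "\<not> dig n k \<longleftrightarrow> (\<exists>q r. r < pw k \<and> n = (2 * q) * pw k + r)"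
proof -
  obtain q r where qr: "n = q * pw k + r" "r < pw k" by (rule dig_division)
  show ?thesis
  proof
    assume "\<not> dig n k"
    then have "\<not> od q" using qr dig_iff by blast
    then show "\<exists>q r. r < pw k \<and> n = (2 * q) * pw k + r" using qr unfolding not_od by blast
  next
    assume "\<exists>q r. r < pw k \<and> n = (2 * q) * pw k + r"
    then obtain q r where "r < pw k" "n = (2 * q) * pw k + r" by blast
    moreover have "\<not> od (2 * q)" unfolding not_od by blast
    ultimately show "\<not> dig n k" using dig_iff by blast
  qed
qed

lemma Rc_dig [rc]: "RF f \<Longrightarrow> RF g \<Longrightarrow> Rc (\<lambda>e. dig (f e) (g e))"
proof (rule Rc_comp2[of dig])
  show "Rc (\<lambda>e. dig (e 0) (e (Suc 0)))"
    unfolding Rc_def not_dig unfolding dig_def by (intro conjI rc)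
qed

lemma od_add: "od (q + 2 * x) \<longleftrightarrow> od q"
proof (cases "od q")
  case True
  then obtain r where "q = 2 * r + 1" unfolding od_def by blast
  then have "q + 2 * x = 2 * (r + x) + 1" by (simp add: algebra_simps)
  then show ?thesis using True unfolding od_def by blast
next
  case False
  then obtain r where "q = 2 * r" unfolding not_od by blast
  then have "q + 2 * x = 2 * (r + x)" by (simp add: algebra_simps)
  then have "\<not> od (q + 2 * x)" unfolding not_od by blast
  with False show ?thesis by simp
qed

text \<open>No carry occurs, since the digits of \<open>n\<close> lie below place \<open>v\<close>
  and those of \<open>w\<close> at or above it.\<close>

lemma dig_add:
  assumes n: "n < pw v" and w: "pw v dvd w"
  shows "dig (n + w) k \<longleftrightarrow> (if k < v then dig n k else dig w k)"
proof -
  obtain w' where w': "w = pw v * w'" using w unfolding dvd_def by blast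
  show ?thesis
  proof (cases "k < v")
    case True
    then obtain j where j: "v = k + j + 1" by (auto simp: num_less_iff)
    obtain q r where qr: "n = q * pw k + r" "r < pw k" by (rule dig_division)
    have "n + w = (q + 2 * (pw j * w')) * pw k + r" unfolding w' qr j by (simp add: pw_add pw_1 algebra_simps)
    then show ?thesis using True qr dig_iff od_add by simp
  next
    case False
    then obtain j where j: "k = v + j" using num_le_iff by (auto simp: not_less)
    obtain q r where qr: "w' = q * pw j + r" "r < pw j" by (rule dig_division)
    have "pw v * r + pw v \<le> pw k"
      using mult_left_mono[of "r + 1" "pw j" "pw v"] qr(2) by (simp add: num_Suc_le j pw_add algebra_simps)
    then have lt: "pw v * r + n < pw k" "pw v * r < pw k" using n pw_pos[of v] by (simp_all add: zify)
    have eq: "w = q * pw k + pw v * r" unfolding w' qr(1) j pw_add by (simp add: algebra_simps)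
    then have "n + w = q * pw k + (pw v * r + n)" by (simp add: ac_simps)
    then have "dig (n + w) k \<longleftrightarrow> od q" using dig_iff[OF lt(1)] by simp
    moreover have "dig w k \<longleftrightarrow> od q" using dig_iff[OF lt(2)] eq by simp
    ultimately show ?thesis using False by simp
  qed
qed

lemma not_od_0: "\<not> od 0" unfolding not_od by (rule exI[of _ 0]) simp

lemma dig_ge: "n < pw v \<Longrightarrow> v \<le> k \<Longrightarrow> \<not> dig n k"
  using dig_iff[of n k 0] pw_le[of v k] not_od_0 by auto

lemma dig_bound: "dig n k \<Longrightarrow> k < n"
  using dig_ge[of n k k] pw_gt[of k] by (meson le_less_trans leI less_le_trans order_refl)

lemma dig_pw: "dig (pw k) k"
  using dig_iff[of 0 k 1] pw_pos[of k] od_def by (auto intro: exI[of _ 0])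

lemma dig_dvd: "pw v dvd n \<Longrightarrow> dig n k \<Longrightarrow> v \<le> k"
  using dig_add[of 0 v n k] pw_pos[of v] dig_bound[of 0 k] by (auto split: if_splits)

text \<open>The leading digit will do: it stands at \<open>u - 1\<close> for the least
  \<open>u\<close> with \<open>n < pw u\<close>.\<close>

lemma ex_dig: assumes "0 < n" obtains k where "dig n k"
proof -
  have "Rc (\<lambda>e. n < pw (e 0))" by (intro rc)
  then obtain u where u: "n < pw u" "\<And>z. z < u \<Longrightarrow> \<not> n < pw z"
    using Rc_least[of "\<lambda>u. n < pw u" n] pw_gt by blast
  have "u \<noteq> 0" using assms u(1) pw(2) num_Suc_le[of 0 n] by auto
  then obtain k where k: "u = k + 1" using num_cases by blast
  then have "pw k \<le> n" using u(2)[of k] by (simp add: not_less num_less_Suc)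
  then obtain r where r: "n = 1 * pw k + r" by (auto simp: num_le_iff)
  then have "r < pw k" using u(1) unfolding k pw(3) by (simp add: zify)
  then have "dig n k" using r dig_iff[of r k 1] unfolding od_def by (auto intro: exI[of _ 0])
  then show ?thesis by (rule that)
qed

text \<open>Adding \<open>pw y\<close> where the digit is 0 causes no carry; \<open>s\<close> splits
  into the part \<open>r\<close> below place \<open>y\<close> and the part \<open>w\<close> above
  it.\<close>

lemma dig_set:
  assumes "\<not> dig s y"
  shows "dig (s + pw y) k \<longleftrightarrow> dig s k \<or> k = y" "s < pw h \<Longrightarrow> y < h \<Longrightarrow> s + pw y < pw h"
proof -
  obtain q r where qr: "r < pw y" "s = 2 * q * pw y + r" using assms not_dig by blast
  define w where "w = pw (y + 1) * q"
  have w: "pw (y + 1) dvd w" by (simp add: w_def)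
  have s: "s = r + w" "s + pw y = (r + pw y) + w" using qr(2) unfolding w_def pw(3) by (simp_all add: algebra_simps)
  have lt: "r < pw (y + 1)" "r + pw y < pw (y + 1)" using qr(1) nn_nonneg[of "pw y"] unfolding pw(3) by (simp_all add: zify)
  have r: "dig (r + pw y) k \<longleftrightarrow> (if k < y then dig r k else dig (pw y) k)" by (rule dig_add) (use qr in auto)
  have "\<not> dig r y" by (rule dig_ge[OF qr(1)]) simp
  then show "dig (s + pw y) k \<longleftrightarrow> dig s k \<or> k = y"
    using dig_add[OF lt(1) w, of k, folded s(1)] dig_add[OF lt(2) w, of k, folded s(2)] r dig_pw[of y]
    by (auto simp: num_less_Suc le_less)
  assume h: "s < pw h" "y < h"
  obtain j where j: "h = y + j + 1" using h(2) by (auto simp: num_less_iff)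
  have "q < pw j"
  proof (rule ccontr)
    assume "\<not> q < pw j"
    then have "pw (y + 1) * pw j \<le> w" unfolding w_def by (intro mult_left_mono) simp_all
    moreover have "pw h = pw (y + 1) * pw j" unfolding j by (simp add: pw_1 pw_add ac_simps)
    ultimately show False using h(1) s(1) nn_nonneg[of r] by (simp add: zify)
  qed
  then have "w + pw (y + 1) \<le> pw (y + 1) * pw j"
    using mult_left_mono[of "q + 1" "pw j" "pw (y + 1)"] by (simp add: w_def num_Suc_le algebra_simps)
  also have "\<dots> = pw h" unfolding j by (simp add: pw_1 pw_add ac_simps)
  finally show "s + pw y < pw h" unfolding s(2) using lt(2) by (simp add: zify)
qed

text \<open>Without a greatest element, induction on \<open>i\<close> for
  \<open>\<exists>t. i \<le> t \<and> A t\<close> would make \<open>A\<close> unbounded.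
  \<open>Rc_least\<close> does not apply, as \<open>A\<close> is only
  \<open>\<Sigma>\<^sup>0\<^sub>1\<close>.\<close>

lemma Sg_greatest:
  assumes "Sg (\<lambda>e. A (e 0))" "A s" "\<And>s. A s \<Longrightarrow> s < b"
  obtains t where "A t" "\<And>u. t < u \<Longrightarrow> \<not> A u"
proof -
  have "\<exists>t. A t \<and> (\<forall>u>t. \<not> A u)"
  proof (rule ccontr)
    assume c: "\<nexists>t. A t \<and> (\<forall>u>t. \<not> A u)"
    have "\<exists>t. i \<le> t \<and> A t" for i
    proof (induction i rule: Sg_induct)
      case Sg
      show ?case by (intro rc Sg_comp1[OF assms(1)])
    next
      case (Suc i)
      then show ?case using c by (metis le_less_trans num_Suc_le)
    qed (use assms(2) in auto)
    then show False using assms(3) leD by blast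
  qed
  then show ?thesis using that by blast
qed

text \<open>
  The numbers below \<open>h\<close> that have a witness form the digit set of the greatest \<open>s < 2^h\<close> all of
  whose digits have one.
\<close>

lemma strong_collection:
  assumes T: "Sg (\<lambda>e. T (e 0) (e (Suc 0)))"
  shows "\<exists>V. \<forall>y<h. (\<exists>x. T x y) \<longrightarrow> (\<exists>x<V. T x y)"
proof -
  have T': "RF f \<Longrightarrow> RF g \<Longrightarrow> Sg (\<lambda>e. T (f e) (g e))" for f g by (rule Sg_comp2[OF T])
  define A where "A s \<longleftrightarrow> s < pw h \<and> (\<forall>y<h. dig s y \<longrightarrow> (\<exists>x. T x y))" for s
  have 1: "Sg (\<lambda>e. A (e 0))" unfolding A_def by (intro rc T')
  have 2: "A 0" unfolding A_def using pw_pos dig_bound[of 0] by auto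
  have 3: "A s \<Longrightarrow> s < pw h" for s unfolding A_def by blast
  obtain s where s: "A s" "\<And>u. s < u \<Longrightarrow> \<not> A u"
    by (rule Sg_greatest[of A, OF 1 2 3]) (assumption, rule that)
  \<comment> \<open>Otherwise the digit \<open>y\<close> could be added to \<open>s\<close>, against
    maximality. So below \<open>h\<close> the digits of \<open>s\<close> are exactly the numbers
    with a witness, and ordinary collection applies to them.\<close>
  have b: "dig s y" if "y < h" "T x y" for x y
  proof (rule ccontr)
    assume n: "\<not> dig s y"
    have "A (s + pw y)" using s(1) dig_set[OF n] that unfolding A_def by blast
    moreover have "s < s + pw y" using pw_pos[of y] by simp
    ultimately show False using s(2) by blast
  qed
  have "\<exists>V. \<forall>y<h. \<exists>x<V. dig s y \<longrightarrow> T x y"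
    by (rule collection) (intro rc T', use s(1) A_def in blast)
  then show ?thesis using b by blast
qed

section \<open>The meaning of the coded notions\<close>

lemma cons_1 [simp]: "(x ## e) 1 = e 0"
  by (simp add: One_nat_def)

lemma cons_shifts [simp]:
  "(\<lambda>n. (a ## b ## e) (n + 2)) = e"
  "(\<lambda>n. (a ## b ## c ## e) (n + 3)) = e"
  "(\<lambda>n. (a ## b ## c ## d ## e) (n + 4)) = e"
  "(\<lambda>n. (a ## b ## c ## d ## f ## e) (n + 5)) = e"
  by (simp_all add: numeral_eq_Suc)

lemma sat_entry [simp]: "sat NM e B (entry c d i x) \<longleftrightarrow> tv NM e x = bt (tv NM e c) (tv NM e d) (tv NM e i)"
  unfolding entry_def Let_def ent_bt[symmetric] ent_def by simp

definition ssum :: "mnum \<Rightarrow> mnum \<Rightarrow> mnum \<Rightarrow> mnum \<Rightarrow> bool" where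
  "ssum c d l n \<longleftrightarrow> (\<exists>c' d'. bt c' d' 0 = 0 \<and> (\<forall>i<l. bt c' d' (i + 1) = bt c' d' i + bt c d i) \<and> bt c' d' l = n)"

lemma sat_seq_sum [simp]:
  "sat NM e B (seq_sum c d l n) \<longleftrightarrow> ssum (tv NM e c) (tv NM e d) (tv NM e l) (tv NM e n)"
  unfolding seq_sum_def ssum_def by (simp add: eq_commute[of "0::mnum"] eq_commute[of "tv NM e n"] eq_commute[of "bt _ _ _ + bt _ _ _"])

definition fs :: "mnum \<Rightarrow> mnum set \<Rightarrow> mnum \<Rightarrow> bool" where
  "fs j H n \<longleftrightarrow> (\<exists>c d. (\<forall>i<j. bt c d i \<in> H) \<and> (\<forall>i<j. \<forall>k<j. i \<noteq> k \<longrightarrow> bt c d i \<noteq> bt c d k) \<and> ssum c d j n)"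

lemma sat_in_FS [simp]: "sat NM e B (in_FS j H n) \<longleftrightarrow> fs (tv NM e j) (B H) (tv NM e n)"
  unfolding in_FS_def fs_def by (simp, intro iff_exI conj_cong refl, blast)

lemma sat_is_pow2 [simp]: "sat NM e B (is_pow2 k p) \<longleftrightarrow> tv NM e p = pw (tv NM e k)"
proof -
  let ?k = "tv NM e k" let ?p = "tv NM e p"
  have "sat NM e B (is_pow2 k p) \<longleftrightarrow>
    (\<exists>c d. 1 = bt c d 0 \<and> (\<forall>i<?k. 2 * bt c d i = bt c d (i + 1)) \<and> ?p = bt c d ?k)"
    unfolding is_pow2_def by (simp add: one_add_one)
  also have "\<dots> \<longleftrightarrow> ?p = pw ?k"
  proof
    assume "\<exists>c d. 1 = bt c d 0 \<and> (\<forall>i<?k. 2 * bt c d i = bt c d (i + 1)) \<and> ?p = bt c d ?k"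
    then obtain c d where *: "1 = bt c d 0" "\<forall>i<?k. 2 * bt c d i = bt c d (i + 1)" "?p = bt c d ?k" by blast
    have "i \<le> ?k \<longrightarrow> bt c d i = pw i" for i
    proof (induction i rule: Rc_induct)
      case Rc
      show ?case by (intro rc)
    next
      case (Suc i)
      then show ?case unfolding num_Suc_le[symmetric] pw(3) using *(2) less_imp_le[of i ?k] by metis
    qed (simp add: *(1)[symmetric] pw)
    then show "?p = pw ?k" using *(3) by simp
  next
    assume p: "?p = pw ?k"
    have "\<exists>c d. \<forall>i<?k + 1. bt c d i = pw i" by (rule beta_lemma) (intro rc)
    then obtain c d where *: "\<And>i. i \<le> ?k \<Longrightarrow> bt c d i = pw i" unfolding num_less_Suc by blast
    have "2 * bt c d i = bt c d (i + 1)" if "i < ?k" for i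
      using *[of i] *[of "i + 1"] that by (simp add: num_Suc_le[symmetric] pw)
    then show "\<exists>c d. 1 = bt c d 0 \<and> (\<forall>i<?k. 2 * bt c d i = bt c d (i + 1)) \<and> ?p = bt c d ?k"
      using *[of 0] *[of ?k] p pw(2) by (metis order_refl zero_le)
  qed
  finally show ?thesis .
qed

definition bexp :: "mnum \<Rightarrow> mnum \<Rightarrow> mnum \<Rightarrow> mnum \<Rightarrow> bool" where
  "bexp c d k m \<longleftrightarrow> (\<forall>i<k. \<forall>j<i. bt c d j < bt c d i) \<and>
    (\<exists>c' d'. (\<forall>i<k. bt c' d' i = pw (bt c d i)) \<and> ssum c' d' k m)"

lemma sat_binary_expansion [simp]:
  "sat NM e B (binary_expansion c d k m) \<longleftrightarrow> bexp (tv NM e c) (tv NM e d) (tv NM e k) (tv NM e m)"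
  unfolding binary_expansion_def bexp_def by (simp add: eq_commute[of "pw _"])

lemma sat_is_lambda [simp]: "sat NM e B (is_lambda m x) \<longleftrightarrow>
    (\<exists>c d k. bexp c d (k + 1) (tv NM e m) \<and> tv NM e x = bt c d 0)"
  unfolding is_lambda_def by simp

lemma sat_is_mu [simp]: "sat NM e B (is_mu m x) \<longleftrightarrow>
    (\<exists>c d k. bexp c d (k + 1) (tv NM e m) \<and> tv NM e x = bt c d k)"
  unfolding is_mu_def by simp

text \<open>The only facts that are drawn from the apartness of \<open>H\<close>. The partial sums
  stay divisible by the first power and below twice the power added last.\<close>

lemma bexp_bounds:
  assumes "bexp c d (k + 1) m"
  shows "pw (bt c d 0) dvd m" "m < pw (bt c d k + 1)"
proof -
  obtain c' d' c'' d'' where inc: "\<forall>i<k + 1. \<forall>j<i. bt c d j < bt c d i"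
    and pow: "\<forall>i<k + 1. bt c' d' i = pw (bt c d i)"
    and sum: "bt c'' d'' 0 = 0" "\<forall>i<k + 1. bt c'' d'' (i + 1) = bt c'' d'' i + bt c' d' i" "bt c'' d'' (k + 1) = m"
    using assms unfolding bexp_def ssum_def by blast
  let ?e = "bt c d" let ?s = "bt c'' d''"
  have step: "?s (i + 1) = ?s i + pw (?e i)" if "i < k + 1" for i using sum(2) pow that by simp
  have "i \<le> k + 1 \<longrightarrow> pw (?e 0) dvd ?s i" for i
  proof (induction i rule: Sg_induct)
    case Sg
    show ?case by (intro rc)
  next
    case (Suc i)
    show ?case
    proof
      assume "i + 1 \<le> k + 1"
      then have i: "i < k + 1" by (simp add: num_Suc_le)
      have "?e 0 \<le> ?e i" using inc i by (cases "i = 0") (auto simp: less_imp_le zero_less_iff_neq_zero)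
      then have "pw (?e 0) dvd pw (?e i)" by (rule pw_dvd)
      then show "pw (?e 0) dvd ?s (i + 1)" unfolding step[OF i] using Suc i by (simp add: less_imp_le)
    qed
  qed (simp add: sum)
  then show "pw (?e 0) dvd m" using sum(3) by blast
  have "i < k + 1 \<longrightarrow> ?s (i + 1) < pw (?e i + 1)" for i
  proof (induction i rule: Rc_induct)
    case Rc
    show ?case by (intro rc)
  next
    case 0
    show ?case using step[of 0] sum(1) pw_pos[of "?e 0"] by (simp add: pw zify)
  next
    case (Suc i)
    show ?case
    proof
      assume i: "i + 1 < k + 1"
      then have "i < k + 1" by (simp add: zify)
      then have "?s (i + 1) < pw (?e i + 1)" using Suc by blast
      moreover have "?e i < ?e (i + 1)" using inc i by (simp add: zify)
      then have "pw (?e i + 1) \<le> pw (?e (i + 1))" by (intro pw_le) (simp add: num_Suc_le)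
      ultimately show "?s (i + 1 + 1) < pw (?e (i + 1) + 1)" unfolding step[OF i] pw(3) by (simp add: zify)
    qed
  qed
  from this[of k] show "m < pw (?e k + 1)" using sum(3) by (simp add: num_less_Suc)
qed

lemma ssum_1: "ssum c d 1 n \<longleftrightarrow> n = bt c d 0"
proof
  assume "ssum c d 1 n"
  then obtain c' d' where "bt c' d' 0 = 0" "\<forall>i<1. bt c' d' (i + 1) = bt c' d' i + bt c d i" "bt c' d' 1 = n"
    unfolding ssum_def by blast
  then show "n = bt c d 0" using zero_less_one by (metis add_0)
next
  assume n: "n = bt c d 0"
  have "\<exists>c' d'. \<forall>i<1 + 1. bt c' d' i = (if i = 0 then 0 else n)" by (rule beta_lemma) (intro rc)
  then obtain c' d' where *: "\<And>i. i < 1 + 1 \<Longrightarrow> bt c' d' i = (if i = 0 then 0 else n)" by blast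
  have "bt c' d' 0 = 0" "bt c' d' 1 = n" using *[of 0] *[of 1] by simp_all
  moreover have "i = 0" if "i < 1" for i :: mnum using that num_less_Suc[of i 0] by simp
  ultimately show "ssum c d 1 n" unfolding ssum_def using n by (metis add_0)
qed

text \<open>The expansion has one term, so \<lambda> and \<mu> of \<open>pw x\<close> are both
  \<open>x\<close>. The length is written \<open>0 + 1\<close> to fit the \<open>k + 1\<close> in
  the formulas for \<lambda> and \<mu>.\<close>

lemma bexp_pw: "\<exists>c d. bexp c d (0 + 1) (pw x) \<and> bt c d 0 = x"
proof -
  have "\<exists>c d. \<forall>i<1. bt c d i = x" by (rule beta_lemma) (intro rc)
  then obtain c d where cd: "bt c d 0 = x" using zero_less_one by blast
  have "\<exists>c d. \<forall>i<1. bt c d i = pw x" by (rule beta_lemma) (intro rc)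
  then obtain c' d' where cd': "bt c' d' 0 = pw x" using zero_less_one by blast
  have i0: "i = 0" if "i < 1" for i :: mnum using that num_less_Suc[of i 0] by simp
  have "bexp c d 1 (pw x)" unfolding bexp_def
  proof (intro conjI allI impI exI)
    fix i j :: mnum
    assume "i < 1" "j < i"
    then show "bt c d j < bt c d i" using i0[of i] by simp
  next
    fix i :: mnum
    assume "i < 1"
    then show "bt c' d' i = pw (bt c d i)" using i0[of i] cd cd' by simp
  next
    show "ssum c' d' 1 (pw x)" using cd' by (simp add: ssum_1)
  qed
  then show ?thesis using cd by auto
qed

section \<open>Apartness, pairing and colourings in the model\<close>

definition apart :: "mnum set \<Rightarrow> bool" where
  "apart H \<longleftrightarrow> (\<forall>x y. x \<in> H \<and> y \<in> H \<and> x < y \<longrightarrow>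
    (\<exists>u v. (\<exists>c d k. bexp c d (k + 1) x \<and> u = bt c d k) \<and> (\<exists>c d k. bexp c d (k + 1) y \<and> v = bt c d 0) \<and> u < v))"

lemma apart_dvd:
  assumes "apart H" "x \<in> H" "y \<in> H" "x < y"
  shows "\<exists>v. x < pw v \<and> pw v dvd y"
proof -
  obtain c d k c' d' k' where *: "bexp c d (k + 1) x" "bexp c' d' (k' + 1) y" "bt c d k < bt c' d' 0"
    using assms unfolding apart_def by blast
  have "x < pw (bt c d k + 1)" using bexp_bounds(2)[OF *(1)] .
  also have "\<dots> \<le> pw (bt c' d' 0)" using *(3) by (intro pw_le) (simp add: num_Suc_le)
  finally show ?thesis using bexp_bounds(1)[OF *(2)] by blast
qed

lemma apart_pw: "apart (pw ` H)"
  unfolding apart_def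
proof (intro allI impI)
  fix x y assume h: "x \<in> pw ` H \<and> y \<in> pw ` H \<and> x < y"
  then obtain u v where uv: "x = pw u" "y = pw v" "u < v" by (auto simp: pw_less_iff)
  then show "\<exists>u v. (\<exists>c d k. bexp c d (k + 1) x \<and> u = bt c d k) \<and> (\<exists>c d k. bexp c d (k + 1) y \<and> v = bt c d 0) \<and> u < v"
    using bexp_pw[of u] bexp_pw[of v] by metis
qed

definition mpair :: "mnum \<Rightarrow> mnum \<Rightarrow> mnum" where "mpair i j = (i + j) * (i + j) + i"

lemma tv_pair [simp]: "tv NM e (pair t u) = mpair (tv NM e t) (tv NM e u)"
  by (simp add: pair_def mpair_def)

text \<open>The sum \<open>i + j\<close> is the integer square root of \<open>mpair i j\<close>,
  which lies below \<open>(i + j + 1) * (i + j + 1)\<close>.\<close>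

lemma mpair_inj: assumes "mpair i j = mpair i' j'" shows "i = i' \<and> j = j'"
proof -
  have *: "\<not> i + j < i' + j'" if h: "mpair i j = mpair i' j'" for i j i' j'
  proof
    assume "i + j < i' + j'"
    then have le: "i + j + 1 \<le> i' + j'" by (simp add: num_Suc_le)
    have "(i + j + 1) * (i + j + 1) \<le> (i' + j') * (i' + j')" using le le by (rule mult_mono) simp_all
    also have "\<dots> \<le> mpair i j" unfolding h by (simp add: mpair_def)
    also have "\<dots> = (i + j) * (i + j) + i" by (rule mpair_def)
    also have "(i + j + 1) * (i + j + 1) = (i + j) * (i + j) + (i + j + (i + j) + 1)"
      by (simp only: distrib_left distrib_right mult_1_left mult_1_right ac_simps)
    finally have "i + j + (i + j) + 1 \<le> i" by (simp only: add_le_cancel_left)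
    then show False using nn_nonneg[of i] nn_nonneg[of j] by (simp add: zify)
  qed
  have s: "i + j = i' + j'" using *[OF assms] *[OF assms[symmetric]] by simp
  then have "i = i'" using assms unfolding mpair_def by simp
  with s show ?thesis by simp
qed

lemma mpair_iff [simp]: "mpair i j = mpair i' j' \<longleftrightarrow> i = i' \<and> j = j'"
  using mpair_inj[of i j i' j'] by blast

lemma RF_mpair [rc]: "RF f \<Longrightarrow> RF g \<Longrightarrow> RF (\<lambda>e. mpair (f e) (g e))"
  unfolding mpair_def by (intro rc)

lemma mpair_bounds: "i \<le> mpair i j" "j \<le> mpair i j"
proof -
  show "i \<le> mpair i j" by (simp add: mpair_def)
  have "x \<le> x * x" for x :: mnum
  proof (cases "x = 0")
    case False
    then have "1 \<le> x" using num_Suc_le[of 0 x] by (simp add: zero_less_iff_neq_zero)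
    then show ?thesis using mult_left_mono[of 1 x x] by simp
  qed simp
  then have "i + j \<le> (i + j) * (i + j)" .
  then show "j \<le> mpair i j" using nn_nonneg[of i] by (simp add: mpair_def zify)
qed

definition colouring :: "mnum set \<Rightarrow> bool" where
  "colouring F \<longleftrightarrow> (\<forall>x\<in>F. \<exists>i j. 0 < i \<and> j < 2 \<and> x = mpair i j) \<and>
    (\<forall>i j k. mpair i j \<in> F \<and> mpair i k \<in> F \<longrightarrow> j = k) \<and> (\<forall>i>0. \<exists>j. mpair i j \<in> F)"

lemma sat_is_colouring: "sat NM e B (is_colouring F) \<longleftrightarrow> colouring (B F)"
  unfolding is_colouring_def colouring_def
  by (simp add: one_add_one Ball_def zero_less_iff_neq_zero) blast

lemma sat_is_apart: "sat NM e B (is_apart H) \<longleftrightarrow> apart (B H)"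
  unfolding is_apart_def apart_def by simp

lemma sat_is_monochromatic: "sat NM e B (is_monochromatic F a b H) \<longleftrightarrow>
    (\<exists>j<2. \<forall>n. fs (tv NM e a) (B H) n \<or> fs (tv NM e b) (B H) n \<longrightarrow> mpair n j \<in> B F)"
  unfolding is_monochromatic_def by (simp add: one_add_one) blast

lemma sat_HT: "sat NM e B HT_exists_ab_apart \<longleftrightarrow> (\<forall>F\<in>NS. colouring F \<longrightarrow>
    (\<exists>H\<in>NS. (\<forall>x\<in>H. 0 < x) \<and> (\<forall>x. \<exists>y>x. y \<in> H) \<and> apart H \<and>
      (\<exists>a b. 0 < a \<and> a < b \<and> (\<exists>j<2. \<forall>n. fs a H n \<or> fs b H n \<longrightarrow> mpair n j \<in> F))))"
  unfolding HT_exists_ab_apart_def is_positive_def is_infinite_def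
  by (simp add: sat_is_colouring sat_is_apart sat_is_monochromatic zero_less_iff_neq_zero,
      intro ball_cong bex_cong imp_cong refl, blast)

section \<open>From the Hindman principle to \<open>ACA\<^sub>0\<close>\<close>

locale witness_relation =
  fixes T :: "mnum \<Rightarrow> mnum \<Rightarrow> bool"
  assumes T: "Rc (\<lambda>e. T (e 0) (e (Suc 0)))"
begin

lemma Rc_T: "RF f \<Longrightarrow> RF g \<Longrightarrow> Rc (\<lambda>e. T (f e) (g e))"
  by (rule Rc_comp2[OF T])

definition first_wit :: "mnum \<Rightarrow> mnum \<Rightarrow> bool" where
  "first_wit x y \<longleftrightarrow> T x y \<and> (\<forall>z<x. \<not> T z y)"

text \<open>For positive \<open>n\<close> this is \<open>y < \<lambda>(n)\<close>, stated by
  digits.\<close>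

definition zu :: "mnum \<Rightarrow> mnum \<Rightarrow> bool" where
  "zu n y \<longleftrightarrow> (\<forall>k<y + 1. \<not> dig n k)"

text \<open>
  The digit \<open>i\<close> of \<open>n\<close> is important if the first witness \<open>x\<close> of some \<open>y < \<lambda>(n)\<close> lies between the
  preceding digit of \<open>n\<close> and \<open>i\<close>.
\<close>

definition imp :: "mnum \<Rightarrow> mnum \<Rightarrow> bool" where
  "imp n i \<longleftrightarrow> dig n i \<and> (\<exists>y<i. \<exists>x<i. zu n y \<and> first_wit x y \<and> (\<forall>k<i. x < k \<longrightarrow> \<not> dig n k))"

text \<open>All quantifiers are bounded in terms of the digit and \<open>y\<close>, so importance is
  recursive in the parameters of \<open>T\<close> even if \<open>K\<close> is not a set of the
  model.\<close>

lemma Rc_imp_digit: "Rc (\<lambda>e. imp (e 0) (e (Suc 0)))"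
  unfolding imp_def zu_def first_wit_def by (intro rc Rc_T)

text \<open>\<open>C n i\<close> is the parity of the number of important digits of \<open>n\<close>
  below \<open>i\<close>, kept as a value 0 or 1. The colour of \<open>n\<close> will be
  \<open>C n n\<close>, because every digit position of \<open>n\<close> is smaller than
  \<open>n\<close>.\<close>

definition C :: "mnum \<Rightarrow> mnum \<Rightarrow> mnum" where
  "C = (SOME C. RF (\<lambda>e. C (e 0) (e (Suc 0))) \<and> (\<forall>n. C n 0 = 0) \<and>
    (\<forall>n i. C n (i + 1) = (if imp n i then 1 - C n i else C n i)))"

lemma C: "RF (\<lambda>e. C (e 0) (e (Suc 0)))" "C n 0 = 0" "C n (i + 1) = (if imp n i then 1 - C n i else C n i)"
proof -
  obtain C' where "RF (\<lambda>e. C' (e 0) (e (Suc 0)))" "\<And>n. C' n 0 = 0"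
    "\<And>n i. C' n (i + 1) = (if imp n i then 1 - C' n i else C' n i)"
  proof (rule primitive_recursion[of "\<lambda>_. 0" "\<lambda>n i x. if imp n i then 1 - x else x"])
    show "RF (\<lambda>e. 0)" "RF (\<lambda>e. if imp (e 0) (e (Suc 0)) then 1 - e (Suc (Suc 0)) else e (Suc (Suc 0)))"
      by (intro rc Rc_imp_digit)+
  qed (rule that)
  then have "\<exists>C. RF (\<lambda>e. C (e 0) (e (Suc 0))) \<and> (\<forall>n. C n 0 = 0) \<and>
    (\<forall>n i. C n (i + 1) = (if imp n i then 1 - C n i else C n i))" by blast
  from someI_ex[OF this, folded C_def]
  show "RF (\<lambda>e. C (e 0) (e (Suc 0)))" "C n 0 = 0" "C n (i + 1) = (if imp n i then 1 - C n i else C n i)"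
    by blast+
qed

lemma RF_C: "RF f \<Longrightarrow> RF g \<Longrightarrow> RF (\<lambda>e. C (f e) (g e))"
  by (rule RF_comp2[OF C(1)])

lemma C_values: "C n i = 0 \<or> C n i = 1"
proof (induction i rule: Rc_induct)
  case Rc
  show ?case by (intro rc RF_C)
qed (auto simp: C num_diff_0)

lemma C_stable:
  assumes "\<And>i. u \<le> i \<Longrightarrow> i < u' \<Longrightarrow> \<not> imp n i" "u \<le> u'"
  shows "C n u' = C n u"
proof -
  have "u + k \<le> u' \<longrightarrow> C n (u + k) = C n u" for k
  proof (induction k rule: Rc_induct)
    case Rc
    show ?case by (intro rc RF_C)
  next
    case (Suc k)
    show ?case
    proof
      assume "u + (k + 1) \<le> u'"
      then have "u + k < u'" by (simp add: zify)
      then show "C n (u + (k + 1)) = C n u"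
        using Suc assms(1)[of "u + k"] C(3)[of n "u + k"] by (simp add: add.assoc less_imp_le)
    qed
  qed simp
  then show ?thesis using assms(2) num_le_iff by auto
qed

lemma zu_bound: "zu n y \<Longrightarrow> dig n k \<Longrightarrow> y < k"
  unfolding zu_def num_less_Suc by (meson leI)

lemma first_wit_exists: assumes "T x y" obtains z where "first_wit z y" "z \<le> x"
proof -
  have "Rc (\<lambda>e. T (e 0) y)" by (intro Rc_T rc)
  then obtain z where z: "T z y" "\<And>u. u < z \<Longrightarrow> \<not> T u y" 
    using Rc_least[of "\<lambda>x. T x y" x] assms by blast
  then have "z \<le> x" using assms leI by blast
  then show ?thesis using that z unfolding first_wit_def by blast
qed

lemma colour_flip:
  assumes "0 < n" "zu n y" "T x y" "\<And>x. x < n \<Longrightarrow> \<not> T x y"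
  shows "\<exists>v. \<forall>w. 0 < w \<and> pw v dvd w \<longrightarrow> C (n + w) (n + w) \<noteq> C n n"
proof -
  \<comment> \<open>Some \<open>y < n\<close> may have no witness, so ordinary collection does not
    apply; \<open>V\<close> bounds the first witness of each \<open>y < n\<close> that has
    one.\<close>
  obtain V where V: "\<forall>y<n. (\<exists>x. T x y) \<longrightarrow> (\<exists>x<V. T x y)"
    using strong_collection[OF Rc_Sg[OF T]] by blast
  have fV: "x < V" if f: "first_wit x y" "y < n" for x y
  proof -
    obtain x' where "x' < V" "T x' y" using V f unfolding first_wit_def by blast
    then show ?thesis using f(1) unfolding first_wit_def by (meson leI le_less_trans)
  qed
  obtain x1 where x1: "first_wit x1 y" using first_wit_exists assms(3) by blast
  then have x1n: "n \<le> x1" using assms(4) unfolding first_wit_def by (meson leI)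
  obtain k0 where k0: "dig n k0" using ex_dig assms(1) by blast
  have k0n: "k0 < n" using dig_bound k0 .
  have zn: "y' < n" if "zu n y'" for y' using zu_bound[OF that k0] k0n by order
  have x1V: "x1 < V" using fV[OF x1 zn[OF assms(2)]] .
  \<comment> \<open>The digits of \<open>w\<close> then start above all digits of \<open>n\<close>
    and above all first witnesses of numbers below \<open>n\<close>.\<close>
  define v where "v = n + V"
  have nv: "n \<le> v" "V \<le> v" by (simp_all add: v_def)
  have npw: "n < pw v" using nv(1) pw_gt[of v] by order
  have "C (n + w) (n + w) \<noteq> C n n" if w: "0 < w" "pw v dvd w" for w
  proof -
    define N where "N = n + w"
    have dN: "dig N k \<longleftrightarrow> (if k < v then dig n k else dig w k)" for k
      unfolding N_def by (rule dig_add[OF npw w(2)])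
    have dn: "\<not> dig n k" if "n \<le> k" for k using dig_ge[OF pw_gt that] .
    have "Rc (\<lambda>e. dig w (e 0))" by (intro rc)
    then obtain v0 where v0: "dig w v0" "\<And>k. k < v0 \<Longrightarrow> \<not> dig w k"
      using ex_dig[OF w(1)] Rc_least[of "dig w"] by metis
    have vv0: "v \<le> v0" using dig_dvd[OF w(2) v0(1)] .
    have "k0 < v" using k0n nv(1) by (rule less_le_trans)
    then have k0N: "dig N k0" using dN k0 by simp
    have zu: "zu N y' \<longleftrightarrow> zu n y'" for y'
    proof -
      have "dig N k \<longleftrightarrow> dig n k" if "k < y' + 1" "y' < k0" for k
      proof -
        have "k \<le> y'" using that(1) by (simp add: num_less_Suc)
        then have "k < v" using that(2) k0n nv(1) by order
        then show ?thesis using dN by simp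
      qed
      then show ?thesis using zu_bound[of N y' k0] zu_bound[of n y' k0] k0 k0N unfolding zu_def by blast
    qed
    have imp_eq: "imp N i \<longleftrightarrow> imp n i" if "i < v" for i
    proof -
      have "dig N k \<longleftrightarrow> dig n k" if "k \<le> i" for k using dN le_less_trans[OF that \<open>i < v\<close>] by simp
      then show ?thesis unfolding imp_def zu by (metis less_imp_le order_refl)
    qed
    have "i \<le> v \<longrightarrow> C N i = C n i" for i
    proof (induction i rule: Rc_induct)
      case Rc
      show ?case by (intro rc RF_C)
    next
      case (Suc i)
      then show ?case unfolding C(3) num_Suc_le[symmetric] using imp_eq by (auto simp: less_imp_le)
    qed (simp add: C)
    then have c1: "C N v = C n v" by simp
    have c2: "C n v = C n n" by (rule C_stable) (use dn nv imp_def in auto)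
    have c3: "C N v0 = C N v" by (rule C_stable) (use v0(2) dN vv0 imp_def in auto)
    have "dig N v0" using v0(1) dN[of v0] leD[OF vv0] by simp
    have "x1 < v0" using x1V nv(2) vv0 by order
    moreover have "y < v0" using zn[OF assms(2)] nv(1) vv0 by order
    moreover have "zu N y" using zu assms(2) by simp
    \<comment> \<open>Digits of \<open>n\<close> lie below \<open>n \<le> x1\<close> and those of
      \<open>w\<close> start at \<open>v0\<close>, so no digit separates \<open>x1\<close> from
      \<open>v0\<close>.\<close>
    moreover have "\<not> dig N k" if k: "k < v0" "x1 < k" for k
      using dN[of k] v0(2)[OF k(1)] dn[of k] x1n k(2) by auto
    ultimately have "imp N v0" unfolding imp_def using \<open>dig N v0\<close> x1 by blast
    then have c4: "C N (v0 + 1) = 1 - C N v0" by (simp add: C)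
    \<comment> \<open>Every relevant first witness is below \<open>V \<le> v0\<close>, so the digit
      \<open>v0\<close> separates it from any later digit, which is therefore not important.\<close>
    have c5: "C N N = C N (v0 + 1)"
    proof (rule C_stable)
      show "v0 + 1 \<le> N" using dig_bound[OF \<open>dig N v0\<close>] by (simp add: num_Suc_le)
      fix i assume i: "v0 + 1 \<le> i"
      show "\<not> imp N i"
      proof
        assume "imp N i"
        then obtain y' x' where *: "zu N y'" "first_wit x' y'" "\<forall>k<i. x' < k \<longrightarrow> \<not> dig N k"
          unfolding imp_def by blast
        have "x' < V" using fV[OF *(2) zn] *(1) zu by simp
        then have "x' < v0" using nv(2) vv0 by order
        moreover have "v0 < i" using i by (simp add: num_Suc_le)
        ultimately show False using *(3) \<open>dig N v0\<close> by blast
      qed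
    qed
    have "C N N = 1 - C n n" using c1 c2 c3 c4 c5 by simp
    then show ?thesis using C_values[of n n] unfolding N_def by auto
  qed
  then show ?thesis by blast
qed

end

text \<open>Taking the least larger successor turns the relation into a recursive function, which
  primitive recursion iterates from 0. The bound \<open>i < g i\<close> later makes the range of
  \<open>g\<close> recursive.\<close>

lemma iterate_relation:
  assumes N: "Rc (\<lambda>e. N (e 0) (e (Suc 0)))" and ex: "\<And>x. \<exists>y>x. N x y"
  obtains g where "RF (\<lambda>e. g (e 0))" "N 0 (g 0)" "\<And>i. N (g i) (g (i + 1))"
    "\<And>i j. i < j \<Longrightarrow> g i < g j" "\<And>i. i < g i"
proof -
  have N': "RF f \<Longrightarrow> RF g \<Longrightarrow> Rc (\<lambda>e. N (f e) (g e))" for f g by (rule Rc_comp2[OF N])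
  define nx where "nx x y \<longleftrightarrow> N x y \<and> x < y \<and> (\<forall>z<y. x < z \<longrightarrow> \<not> N x z)" for x y
  have ex: "\<exists>y. nx x y" for x
  proof -
    obtain y where y: "N x y \<and> x < y" using ex by blast
    have "Rc (\<lambda>e. N x (e 0) \<and> x < e 0)" by (intro rc N')
    then obtain z where z: "N x z \<and> x < z" "\<And>u. u < z \<Longrightarrow> \<not> (N x u \<and> x < u)"
      using Rc_least[of "\<lambda>y. N x y \<and> x < y" y] y by blast
    then show ?thesis unfolding nx_def by blast
  qed
  have uniq: "y = z" if "nx x y" "nx x z" for x y z
    using that unfolding nx_def by (meson linorder_neqE)
  define f where "f x = (THE y. nx x y)" for x
  have f: "y = f x \<longleftrightarrow> nx x y" for x y
    unfolding f_def using ex[of x] uniq by (metis the_equality)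
  have "RF (\<lambda>e. f (e 0))" by (rule RF_graph[OF _ f]) (unfold nx_def, intro rc N' Rc_Sg[OF N'])
  then have f': "RF h \<Longrightarrow> RF (\<lambda>e. f (h e))" for h by (rule RF_comp1)
  obtain F where F: "RF (\<lambda>e. F (e 0) (e (Suc 0)))" "\<And>p. F p 0 = f 0" "\<And>p i. F p (i + 1) = f (F p i)"
  proof (rule primitive_recursion[of "\<lambda>_. f 0" "\<lambda>p i x. f x"])
    show "RF (\<lambda>e. f 0)" "RF (\<lambda>e. f (e (Suc (Suc 0))))" by (intro rc f')+
  qed (rule that)
  define g where "g i = F 0 i" for i
  have RFg: "RF (\<lambda>e. g (e 0))" unfolding g_def by (rule RF_comp2[OF F(1)]) (intro rc)+
  then have g': "RF h \<Longrightarrow> RF (\<lambda>e. g (h e))" for h by (rule RF_comp1)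
  have nxf: "nx x (f x)" for x using f by blast
  have g0: "g 0 = f 0" and gS: "g (i + 1) = f (g i)" for i using F by (simp_all add: g_def)
  have step: "g i < g (i + 1)" for i unfolding gS using nxf[of "g i"] unfolding nx_def by blast
  have mono: "i < j \<longrightarrow> g i < g j" for i j
  proof (induction j rule: Rc_induct)
    case Rc
    show ?case by (intro rc g')
  next
    case (Suc j)
    then show ?case using step[of j] unfolding num_less_Suc le_less by (metis less_trans)
  qed simp
  have gt: "i < g i" for i
  proof (induction i rule: Rc_induct)
    case Rc
    show ?case by (intro rc g')
  next
    case 0
    show ?case using nxf[of 0] g0 unfolding nx_def by simp
  next
    case (Suc i)
    then have "i + 1 \<le> g i" by (simp only: num_Suc_le)
    also have "\<dots> < g (i + 1)" by (rule step)
    finally show ?case .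
  qed
  have "N 0 (g 0)" "\<And>i. N (g i) (g (i + 1))" unfolding g0 gS using nxf unfolding nx_def by blast+
  then show ?thesis using that RFg mono gt by blast
qed

lemma enumeration:
  assumes H: "H \<in> NS" "\<And>x. \<exists>y>x. y \<in> H"
  obtains g where "RF (\<lambda>e. g (e 0))" "\<And>i. g i \<in> H" "\<And>i j. i < j \<Longrightarrow> g i < g j" "\<And>i. i < g i"
proof -
  have "Rc (\<lambda>e. e (Suc 0) \<in> H)" by (intro rc H)
  then obtain g where g: "RF (\<lambda>e. g (e 0))" "g 0 \<in> H" "\<And>i. g (i + 1) \<in> H"
    "\<And>i j. i < j \<Longrightarrow> g i < g j" "\<And>i. i < g i"
    using iterate_relation[of "\<lambda>x y. y \<in> H"] H(2) by metis
  then have "g i \<in> H" for i using num_cases[of i] by metis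
  then show ?thesis using that g by blast
qed

text \<open>The number \<open>l\<close> of summands may be nonstandard, so a sum is presented by
  recursive functions for the summands and the partial sums, which are then coded.\<close>

lemma fs_intro:
  assumes "RF (\<lambda>e. s (e 0))" "RF (\<lambda>e. Q (e 0))"
    and "\<And>i. i < l \<Longrightarrow> s i \<in> H" "\<And>i j. i < j \<Longrightarrow> j < l \<Longrightarrow> s i \<noteq> s j"
    and "Q 0 = 0" "\<And>i. i < l \<Longrightarrow> Q (i + 1) = Q i + s i"
  shows "fs l H (Q l)"
proof -
  obtain c d where cd: "\<And>i. i < l \<Longrightarrow> bt c d i = s i" using beta_lemma[OF assms(1), of l] by blast
  obtain c' d' where cd': "\<And>i. i < l + 1 \<Longrightarrow> bt c' d' i = Q i" using beta_lemma[OF assms(2), of "l + 1"] by blast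
  have "ssum c d l (Q l)" unfolding ssum_def
  proof (intro exI conjI allI impI)
    show "bt c' d' 0 = 0" using cd'[of 0] assms(5) by (simp add: num_less_Suc)
    show "bt c' d' l = Q l" using cd'[of l] by (simp add: num_less_Suc)
    fix i assume i: "i < l"
    then have "i < l + 1" "i + 1 < l + 1" by (simp_all add: zify)
    then show "bt c' d' (i + 1) = bt c' d' i + bt c d i" using cd' cd[OF i] assms(6)[OF i] by simp
  qed
  moreover have "bt c d i \<noteq> bt c d k" if "i < l" "k < l" "i \<noteq> k" for i k
    using that cd assms(4) by (metis linorder_neqE)
  ultimately show ?thesis unfolding fs_def using cd assms(3) by (intro exI[of _ c] exI[of _ d]) simp
qed

lemma HT_imp_Sigma1_CA:
  assumes HT: "sat NM e B HT_exists_ab_apart" and T: "Rc (\<lambda>e. T (e 0) (e (Suc 0)))"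
  shows "{y. \<exists>x. T x y} \<in> NS"
proof -
  interpret witness_relation T by standard (rule T)
  \<comment> \<open>Since \<open>n \<le> mpair n j\<close>, the search for \<open>n\<close> is
    bounded and \<open>F\<close> is recursive.\<close>
  define F where "F = {z. \<exists>n<z + 1. 0 < n \<and> z = mpair n (C n n)}"
  have "F \<in> NS" unfolding F_def by (rule comprehension_Rc) (intro rc RF_C)
  have memF: "mpair n j \<in> F \<longleftrightarrow> 0 < n \<and> j = C n n" for n j
    unfolding F_def by (auto simp: num_less_Suc mpair_bounds)
  have "colouring F" unfolding colouring_def
  proof (intro conjI ballI allI impI)
    fix z assume "z \<in> F"
    then obtain n where "0 < n" "z = mpair n (C n n)" unfolding F_def by blast
    moreover have "C n n < 2" using C_values[of n n] by auto
    ultimately show "\<exists>i j. 0 < i \<and> j < 2 \<and> z = mpair i j" by blast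
  qed (use memF in auto)
  then obtain H a b j where H: "H \<in> NS" "\<forall>x\<in>H. 0 < x" "\<forall>x. \<exists>y>x. y \<in> H" "apart H"
    and ab: "0 < a" "a < b" and mono: "\<forall>n. fs a H n \<or> fs b H n \<longrightarrow> mpair n j \<in> F"
    using HT[unfolded sat_HT, rule_format, OF \<open>F \<in> NS\<close>] by blast
  obtain g where g: "RF (\<lambda>e. g (e 0))" "\<And>i. g i \<in> H" "\<And>i j. i < j \<Longrightarrow> g i < g j" "\<And>i. i < g i"
    using enumeration[OF H(1)] H(3) by metis
  have g': "RF h \<Longrightarrow> RF (\<lambda>e. g (h e))" for h by (rule RF_comp1[OF g(1)])
  \<comment> \<open>\<open>Sm t i\<close> is the sum of the \<open>i\<close> consecutive elements of
    \<open>H\<close> from \<open>g t\<close> on.\<close>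
  obtain Sm where Sm: "RF (\<lambda>e. Sm (e 0) (e (Suc 0)))" "\<And>t. Sm t 0 = 0" "\<And>t i. Sm t (i + 1) = Sm t i + g (t + i)"
  proof (rule primitive_recursion[of "\<lambda>_. 0" "\<lambda>t i x. x + g (t + i)"])
    show "RF (\<lambda>e. 0)" "RF (\<lambda>e. e (Suc (Suc 0)) + g (e 0 + e (Suc 0)))" by (intro rc g')+
  qed (rule that)
  have Sm': "RF h \<Longrightarrow> RF k \<Longrightarrow> RF (\<lambda>e. Sm (h e) (k e))" for h k by (rule RF_comp2[OF Sm(1)])
  have Sm_pos: "0 < Sm t i" if pos: "0 < i" for t i
  proof -
    obtain k where "i = k + 1" using pos num_cases[of i] by auto
    then show ?thesis using Sm(3)[of t k] g(4)[of "t + k"] by (simp add: zero_less_iff_neq_zero) (metis not_less_zero)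
  qed
  \<comment> \<open>Apartness of \<open>g (pw v)\<close>, which exceeds \<open>pw v\<close>, and the
    later element \<open>g i\<close> gives a power of 2 above \<open>pw v\<close> that divides
    \<open>g i\<close>.\<close>
  have dvd_g: "pw v dvd g i" if "pw v < i" for v i
  proof -
    have "g (pw v) < g i" using g(3) that by blast
    then obtain v' where v': "g (pw v) < pw v'" "pw v' dvd g i" using apart_dvd[OF H(4) g(2) g(2)] by blast
    then have "pw v < pw v'" using g(4)[of "pw v"] by order
    then have "pw v dvd pw v'" by (intro pw_dvd) (simp add: pw_less_iff)
    then show ?thesis using v'(2) dvd_trans by blast
  qed
  have dvd_Sm: "pw v dvd Sm t i" if "pw v < t" for v t i
  proof (induction i rule: Sg_induct)
    case Sg
    show ?case by (intro rc Sm')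
  next
    case (Suc i)
    have "pw v < t + i" using that nn_nonneg[of i] by (simp add: zify)
    then show ?case unfolding Sm(3) using Suc dvd_g by simp
  qed (simp add: Sm)
  have fsa: "fs a H (Sm t a)" for t
  proof (rule fs_intro[of "\<lambda>i. g (t + i)" "Sm t"])
    show "RF (\<lambda>e. g (t + e 0))" "RF (\<lambda>e. Sm t (e 0))" by (intro rc g' Sm')+
    show "g (t + i) \<noteq> g (t + k)" if "i < k" for i k using g(3)[of "t + i" "t + k"] that by simp
    show "g (t + i) \<in> H" for i by (rule g(2))
    show "Sm t 0 = 0" "Sm t (i + 1) = Sm t i + g (t + i)" for i by (rule Sm)+
  qed
  \<comment> \<open>The block from \<open>t'\<close> begins only after the block from
    \<open>t\<close> has ended, so all \<open>b\<close> summands differ.\<close>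
  have fsb: "fs b H (Sm t a + Sm t' (b - a))" if "t + a \<le> t'" for t t'
  proof -
    define s where "s i = (if i < a then g (t + i) else g (t' + (i - a)))" for i
    define Q where "Q i = (if i < a then Sm t i else Sm t a + Sm t' (i - a))" for i
    have "fs b H (Q b)"
    proof (rule fs_intro[of s Q])
      show "RF (\<lambda>e. s (e 0))" "RF (\<lambda>e. Q (e 0))" unfolding s_def Q_def by (intro rc g' Sm')+
      show "s i \<in> H" for i unfolding s_def using g(2) by simp
      show "Q 0 = 0" using ab(1) by (simp add: Q_def Sm)
      show "Q (i + 1) = Q i + s i" for i
      proof (cases "i < a")
        case True
        show ?thesis
        proof (cases "i + 1 < a")
          case True
          then show ?thesis using \<open>i < a\<close> by (simp add: Q_def s_def Sm)
        next
          case False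
          then have "i + 1 = a" using \<open>i < a\<close> by (simp add: zify)
          then show ?thesis using \<open>i < a\<close> Sm(3)[of t i] by (simp add: Q_def s_def Sm(2))
        qed
      next
        case False
        then obtain k where k: "i = a + k" using num_le_iff by (auto simp: not_less)
        then have "\<not> i + 1 < a" using nn_nonneg[of k] by (simp add: zify)
        moreover have "i - a = k" "i + 1 - a = k + 1" unfolding k by (simp_all add: add.assoc)
        ultimately show ?thesis using False by (simp add: Q_def s_def Sm add.assoc)
      qed
      show "s i \<noteq> s k" if "i < k" for i k
      proof (cases "k < a")
        case True
        then have "i < a" using that by order
        then show ?thesis using that True g(3)[of "t + i" "t + k"] unfolding s_def by simp
      next
        case k: False
        show ?thesis
        proof (cases "i < a")
          case True
          then have "t + i < t' + (k - a)" using \<open>t + a \<le> t'\<close> nn_nonneg[of "k - a"] by (simp add: zify)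
          then show ?thesis using True k g(3) unfolding s_def by fastforce
        next
          case False
          then have "t' + (i - a) < t' + (k - a)" using that k by (simp add: zify nn_diff)
          then show ?thesis using False k g(3) unfolding s_def by fastforce
        qed
      qed
    qed
    moreover have "Q b = Sm t a + Sm t' (b - a)" using less_not_sym[OF ab(2)] by (simp add: Q_def)
    ultimately show ?thesis by simp
  qed
  have key: "\<exists>x<Sm t a. T x y" if wit: "T x y" "pw (y + 1) dvd Sm t a" for x y t
  proof (rule ccontr)
    assume c: "\<not> (\<exists>x<Sm t a. T x y)"
    let ?n = "Sm t a"
    have n: "0 < ?n" using Sm_pos ab(1) by blast
    have "zu ?n y" unfolding zu_def using dig_dvd[OF wit(2)] leD by blast
    then obtain v where v: "\<forall>w. 0 < w \<and> pw v dvd w \<longrightarrow> C (?n + w) (?n + w) \<noteq> C ?n ?n"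
      using colour_flip[OF n _ wit(1)] c by blast
    \<comment> \<open>This lies beyond the \<open>a\<close> summands already used, and beyond index
      \<open>pw v\<close>, after which all elements are divisible by \<open>pw v\<close>.\<close>
    define t' where "t' = t + a + pw v + 1"
    have t': "t + a \<le> t'" "pw v < t'" unfolding t'_def
      using nn_nonneg[of t] nn_nonneg[of a] nn_nonneg[of "pw v"] by (simp_all add: zify)
    let ?w = "Sm t' (b - a)"
    have "0 < b - a" using ab(2) by (simp add: zify nn_diff less_imp_le)
    then have "0 < ?w" by (rule Sm_pos)
    moreover have "pw v dvd ?w" using dvd_Sm t'(2) by blast
    ultimately have "C (?n + ?w) (?n + ?w) \<noteq> C ?n ?n" using v by blast
    moreover have "mpair ?n j \<in> F" "mpair (?n + ?w) j \<in> F" using mono fsa fsb[OF t'(1)] by blast+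
    ultimately show False using memF by simp
  qed
  \<comment> \<open>To decide \<open>y\<close>, look for a sum of \<open>a\<close> elements
    divisible by \<open>pw (y + 1)\<close>; by \<open>key\<close>, if \<open>y\<close> has a witness
    at all it has one below that sum. The index \<open>pw (y + 1) + 1\<close> shows that the search
    succeeds.\<close>
  have neg: "(\<not> (\<exists>x. T x y)) \<longleftrightarrow> (\<exists>t. pw (y + 1) dvd Sm t a \<and> (\<forall>x<Sm t a. \<not> T x y))" for y
    using key[of _ y] dvd_Sm[of "y + 1" "pw (y + 1) + 1" a] num_less_Suc by (metis order_refl)
  show ?thesis
  proof (rule comprehension_Sg)
    show "Sg (\<lambda>e. \<exists>x. T x (e 0))" by (intro rc Rc_Sg[OF Rc_T])
    show "Sg (\<lambda>e. \<not> (\<exists>x. T x (e 0)))" unfolding neg by (intro rc Rc_T Sm')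
  qed
qed

text \<open>A formula has finitely many variables. This matters because environments are infinite,
  while comprehension speaks of single numbers.\<close>

lemma Sg_depends:
  assumes "Sg P"
  obtains p where "\<And>e e'. (\<And>n. n < p \<Longrightarrow> e n = e' n) \<Longrightarrow> P e = P e'"
proof -
  obtain R where R: "Dl R" "\<And>e. P e \<longleftrightarrow> (\<exists>x. R (x ## e))" using assms unfolding Sg_def by blast
  obtain \<tau> B \<theta> where *: "Drep \<tau> B \<theta> R" using R(1) unfolding Dl_def by blast
  obtain q where q: "fits q q \<theta>" using fits_ex by blast
  have "\<exists>p. \<forall>n<q. \<forall>e e'. (\<forall>i<p. e i = e' i) \<longrightarrow> \<tau> n e = \<tau> n e'"
  proof (induction q)
    case (Suc q)
    then obtain p where p: "\<forall>n<q. \<forall>e e'. (\<forall>i<p. e i = e' i) \<longrightarrow> \<tau> n e = \<tau> n e'" by blast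
    have "atm (\<tau> q)" using * unfolding Drep_def by blast
    then obtain m where m: "\<And>e e'. e m = e' m \<Longrightarrow> \<tau> q e = \<tau> q e'" unfolding atm_def by metis
    have "\<tau> n e = \<tau> n e'" if "n < Suc q" "\<forall>i<max p (Suc m). e i = e' i" for n e e'
    proof (cases "n = q")
      case True
      then show ?thesis using m[of e e'] that(2) by simp
    next
      case False
      then have "n < q" using that(1) by simp
      moreover have "\<forall>i<p. e i = e' i" using that(2) by simp
      ultimately show ?thesis using p by blast
    qed
    then show ?case by blast
  qed simp
  then obtain p where p: "\<forall>n<q. \<forall>e e'. (\<forall>i<p. e i = e' i) \<longrightarrow> \<tau> n e = \<tau> n e'" by blast
  have dep: "R e = R e'" if "\<And>i. i < p \<Longrightarrow> e i = e' i" for e e'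
  proof -
    have "sat NM (\<lambda>n. \<tau> n e) B \<theta> = sat NM (\<lambda>n. \<tau> n e') B \<theta>" 
      by (rule sat_cong[OF q]) (use p that in blast)+
    then show ?thesis using * unfolding Drep_def by blast
  qed
  have "P e = P e'" if "\<And>n. n < p \<Longrightarrow> e n = e' n" for e e'
  proof -
    have "R (x ## e) = R (x ## e')" for x by (rule dep) (use that in \<open>auto split: nat.split\<close>)
    then show ?thesis using R(2) by simp
  qed
  then show ?thesis using that by blast
qed

section \<open>From \<open>\<Sigma>\<^sup>0\<^sub>1\<close> comprehension to arithmetical
  comprehension\<close>

locale sigma1_CA =
  assumes CA: "\<And>P. Sg (\<lambda>e. P (e 0)) \<Longrightarrow> {x. P x} \<in> NS"
begin

text \<open>The first two variables are merged by pairing until a single one remains, for which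
  comprehension is available. The term \<open>t\<close> carries out the pairing.\<close>

lemma Sg_coded:
  assumes "Sg P" "\<And>e e'. (\<And>n. n < Suc p \<Longrightarrow> e n = e' n) \<Longrightarrow> P e = P e'"
  shows "\<exists>X\<in>NS. \<exists>t. \<forall>e. P e \<longleftrightarrow> tv NM e t \<in> X"
  using assms
proof (induction p arbitrary: P)
  case 0
  define g :: "nat \<Rightarrow> env \<Rightarrow> mnum" where "g = (\<lambda>e. e 0) ## (\<lambda>n e. 0)"
  have "atm (g n)" for n by (auto simp: g_def atm_def split: nat.split)
  then have "Sg (\<lambda>e. P (\<lambda>n. g n e))" using Sg_subst_atm[OF 0(1)] by blast
  moreover have "P (\<lambda>n. g n e) = P (e 0 ## (\<lambda>n. 0))" for e by (rule 0(2)) (simp add: g_def)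
  ultimately have "{x. P (x ## (\<lambda>n. 0))} \<in> NS" by (intro CA) simp
  moreover have "P e = P (e 0 ## (\<lambda>n. 0))" for e by (rule 0(2)) simp
  ultimately show ?case
    by (intro bexI[of _ "{x. P (x ## (\<lambda>n. 0))}"] exI[of _ "Var 0"]) auto
next
  case (Suc p)
  define P' where "P' e \<longleftrightarrow> (\<exists>a b. e 0 = mpair a b \<and> P (a ## b ## (\<lambda>n. e (Suc n))))" for e
  have "Sg (\<lambda>e. P (\<lambda>n. e ((Suc 0 ## 0 ## (\<lambda>n. Suc (Suc (Suc n)))) n)))" by (rule Sg_shift[OF Suc.prems(1)])
  moreover have "(\<lambda>n. e ((Suc 0 ## 0 ## (\<lambda>n. Suc (Suc (Suc n)))) n)) =
    e (Suc 0) ## e 0 ## (\<lambda>n. e (Suc (Suc (Suc n))))" for e :: env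
    by (auto split: nat.split)
  ultimately have "Sg (\<lambda>e. P (e (Suc 0) ## e 0 ## (\<lambda>n. e (Suc (Suc (Suc n))))))" by simp
  then have "Sg P'" unfolding P'_def by (intro rc)
  moreover have "P' e = P' e'" if "\<And>n. n < Suc p \<Longrightarrow> e n = e' n" for e e'
  proof -
    have "P (a ## b ## (\<lambda>n. e (Suc n))) = P (a ## b ## (\<lambda>n. e' (Suc n)))" for a b
      by (rule Suc.prems(2)) (use that in \<open>auto split: nat.split\<close>)
    then show ?thesis unfolding P'_def using that[of 0] by simp
  qed
  ultimately obtain X t where X: "X \<in> NS" "\<And>e. P' e \<longleftrightarrow> tv NM e t \<in> X" using Suc.IH[of P'] by blast
  let ?\<sigma> = "pair (Var 0) (Var (Suc 0)) ## (\<lambda>n. Var (Suc (Suc n)))"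
  have "P e \<longleftrightarrow> tv NM e (tsub ?\<sigma> t) \<in> X" for e
  proof -
    have "(\<lambda>n. tv NM e (?\<sigma> n)) = mpair (e 0) (e (Suc 0)) ## (\<lambda>n. e (Suc (Suc n)))"
      by (rule ext) (auto split: nat.split)
    then have "tv NM e (tsub ?\<sigma> t) \<in> X \<longleftrightarrow> P' (mpair (e 0) (e (Suc 0)) ## (\<lambda>n. e (Suc (Suc n))))"
      by (simp add: tv_tsub X(2))
    also have "\<dots> \<longleftrightarrow> P (e 0 ## e (Suc 0) ## (\<lambda>n. e (Suc (Suc n))))" unfolding P'_def by auto
    finally show ?thesis by (simp add: cons_eta2)
  qed
  then show ?case using X(1) by blast
qed

lemma RF_tv: "RF (\<lambda>e. tv NM e t)"
proof (rule Tm_RF)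
  have "Trep (\<lambda>n e. e n) t (\<lambda>e. tv NM e t)" by (auto simp: Trep_def atm_def)
  then show "Tm (\<lambda>e. tv NM e t)" unfolding Tm_def by blast
qed

text \<open>With the set \<open>X\<close> as parameter the predicate becomes recursive. Hence number
  quantifiers preserve \<open>Rc\<close>, and induction on formulas reaches all arithmetical
  ones.\<close>

lemma Sg_Rc: assumes "Sg P" shows "Rc P"
proof -
  obtain p where p: "\<And>e e'. (\<And>n. n < p \<Longrightarrow> e n = e' n) \<Longrightarrow> P e = P e'" using Sg_depends[OF assms] by metis
  have "P e = P e'" if "\<And>n. n < Suc p \<Longrightarrow> e n = e' n" for e e' by (rule p) (use that in simp)
  from Sg_coded[OF assms this] obtain X t where X: "X \<in> NS" "\<And>e. P e \<longleftrightarrow> tv NM e t \<in> X" by blast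
  have "Rc (\<lambda>e. tv NM e t \<in> X)" by (intro rc X RF_tv)
  moreover have "P = (\<lambda>e. tv NM e t \<in> X)" using X(2) by (rule ext)
  ultimately show ?thesis by simp
qed

lemma Rc_ex: "Rc (\<lambda>e. P (e 0) (\<lambda>n. e (Suc n))) \<Longrightarrow> Rc (\<lambda>e. \<exists>x. P x e)"
  by (rule Sg_Rc, rule Sg_ex, rule Rc_Sg)

lemma Rc_all: "Rc (\<lambda>e. P (e 0) (\<lambda>n. e (Suc n))) \<Longrightarrow> Rc (\<lambda>e. \<forall>x. P x e)"
  using Rc_not[OF Rc_ex[OF Rc_not, of P]] by simp

lemma Rc_sat:
  assumes "arithmetical \<phi>" "\<And>n. B n \<in> NS"
  shows "Rc (\<lambda>e. sat NM e B \<phi>)"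
  using assms(1)
proof (induction \<phi>)
  case Fls
  show ?case using Dl_Rc[OF Dl_False] by simp
next
  case (All \<phi>)
  have "Rc (\<lambda>e. sat NM (e 0 ## (\<lambda>n. e (Suc n))) B \<phi>)" using All by simp
  then show ?case unfolding sat.simps by (rule Rc_all)
qed (auto intro!: rc RF_tv assms(2))

lemma ACA0_holds: "\<forall>\<phi>\<in>ACA0. sat NM e B \<phi>"
  unfolding ACA0_def
proof (subst sat_closures)
  show "sets NM \<noteq> {}" by (simp add: NS_nonempty)
  have "sat NM e B \<phi>" if "\<phi> \<in> basic_axioms" "\<And>n. B n \<in> NS" for \<phi> e B
    by (rule RCA0_axiom) (use that in auto)
  moreover have "sat NM e B (induction (Var 0 \<^bold>\<in> 0))" if B: "\<And>n. B n \<in> NS" for e B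
    unfolding sat_induction
  proof (intro impI allI, elim conjE)
    fix x assume *: "sat NM (zr NM ## e) B (Var 0 \<^bold>\<in> 0)"
      "\<forall>x. sat NM (x ## e) B (Var 0 \<^bold>\<in> 0) \<longrightarrow> sat NM (ad NM x (un NM) ## e) B (Var 0 \<^bold>\<in> 0)"
    have "x \<in> B 0"
    proof (induction x rule: Rc_induct)
      case Rc
      show ?case by (intro rc B)
    qed (use * in auto)
    then show "sat NM (x ## e) B (Var 0 \<^bold>\<in> 0)" by simp
  qed
  moreover have "sat NM e B (comprehension \<phi>)" if "arithmetical \<phi>" "\<And>n. B n \<in> NS" for \<phi> e B
  proof -
    have "Sg (\<lambda>d. sat NM d B \<phi>)" using Rc_sat[OF that] by (rule Rc_Sg)
    define g :: "nat \<Rightarrow> env \<Rightarrow> mnum" where "g = (\<lambda>d. d 0) ## (\<lambda>n d. e n)"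
    have "atm (g n)" for n by (auto simp: g_def atm_def split: nat.split)
    then have "Sg (\<lambda>d. sat NM (\<lambda>n. g n d) B \<phi>)" using Sg_subst_atm[OF \<open>Sg (\<lambda>d. sat NM d B \<phi>)\<close>, of g] by blast
    moreover have "(\<lambda>n. g n d) = d 0 ## e" for d by (rule ext) (auto simp: g_def split: nat.split)
    ultimately have "{x. sat NM (x ## e) B \<phi>} \<in> NS" by (intro CA) simp
    then show ?thesis unfolding sat_comprehension NM_simps by (rule bexI[rotated]) simp
  qed
  ultimately show "\<forall>\<phi>\<in>basic_axioms \<union> {induction (Var 0 \<^bold>\<in> 0)} \<union> {comprehension \<phi> |\<phi>. arithmetical \<phi>}.
    \<forall>e B. (\<forall>n. B n \<in> sets NM) \<longrightarrow> sat NM e B \<phi>" by auto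
qed

end

lemma HT_imp_ACA0:
  assumes "sat NM e B HT_exists_ab_apart"
  shows "\<forall>\<phi>\<in>ACA0. sat NM e B \<phi>"
proof -
  interpret sigma1_CA
  proof
    fix P :: "mnum \<Rightarrow> bool"
    assume "Sg (\<lambda>e. P (e 0))"
    then obtain R where R: "Dl R" "\<And>e. P (e 0) \<longleftrightarrow> (\<exists>x. R (x ## e))" unfolding Sg_def by blast
    define g :: "nat \<Rightarrow> env \<Rightarrow> mnum" where "g = (\<lambda>e. e 0) ## (\<lambda>e. e (Suc 0)) ## (\<lambda>n e. 0)"
    have "atm (g n)" for n by (auto simp: g_def atm_def split: nat.split)
    then have "Dl (\<lambda>e. R (\<lambda>n. g n e))" using R(1) by (rule Dl_atm_subst[rotated])
    moreover have "(\<lambda>n. g n e) = e 0 ## e (Suc 0) ## (\<lambda>_. 0)" for e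
      by (rule ext) (auto simp: g_def split: nat.split)
    ultimately have "Rc (\<lambda>e. R (e 0 ## e (Suc 0) ## (\<lambda>_. 0)))" by (simp add: Dl_Rc)
    from HT_imp_Sigma1_CA[of e B "\<lambda>x y. R (x ## y ## (\<lambda>_. 0))", OF assms this]
    have "{y. \<exists>x. R (x ## y ## (\<lambda>_. 0))} \<in> NS" .
    moreover have "(\<exists>x. R (x ## y ## (\<lambda>_. 0))) \<longleftrightarrow> P y" for y using R(2)[of "y ## (\<lambda>_. 0)"] by simp
    ultimately show "{x. P x} \<in> NS" by simp
  qed
  show ?thesis by (rule ACA0_holds)
qed

section \<open>From \<open>ACA\<^sub>0\<close> to the Hindman principle\<close>

lemma Delta00_arithmetical: "\<phi> \<in> Delta00 \<Longrightarrow> arithmetical \<phi>"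
  by (induction rule: Delta00.induct) (auto simp: AllLess_def ExLess_def)

lemma ACA0_sigma1_CA:
  assumes "\<forall>\<phi>\<in>ACA0. sat NM e B \<phi>"
  shows "sigma1_CA"
proof
  fix P :: "mnum \<Rightarrow> bool"
  assume "Sg (\<lambda>e. P (e 0))"
  then obtain \<theta> B' e' where *: "\<theta> \<in> Delta00" "\<And>n. B' n \<in> NS" "\<And>y. P y \<longleftrightarrow> sat NM (y ## e') B' (Ex \<theta>)"
    by (rule Sg_formula1) (rule that)
  have "\<forall>\<phi>\<in>basic_axioms \<union> {induction (Var 0 \<^bold>\<in> 0)} \<union> {comprehension \<phi> |\<phi>. arithmetical \<phi>}.
    \<forall>e B. (\<forall>n. B n \<in> sets NM) \<longrightarrow> sat NM e B \<phi>"
    using assms unfolding ACA0_def by (subst (asm) sat_closures) (simp_all add: NS_nonempty)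
  moreover have "arithmetical (Ex \<theta>)" using Delta00_arithmetical[OF *(1)] by simp
  ultimately have "sat NM e' B' (comprehension (Ex \<theta>))" using *(2) by (simp only: NM_simps) blast
  then obtain X where "X \<in> NS" "\<And>x. x \<in> X \<longleftrightarrow> P x" unfolding sat_comprehension *(3) by auto
  moreover from this have "X = {x. P x}" by auto
  ultimately show "{x. P x} \<in> NS" by simp
qed

context sigma1_CA
begin

text \<open>
  The digits of \<open>st p\<close> decide for each \<open>q < p\<close> whether to stay inside or outside of \<open>R q\<close>, so that
  unboundedly many elements of \<open>A\<close> comply.
\<close>

lemma cohesive:
  assumes R: "Rc (\<lambda>e. R (e 0) (e (Suc 0)))" and A: "A \<in> NS" "\<And>x. \<exists>y>x. y \<in> A"
  obtains D \<sigma> where "D \<in> NS" "D \<subseteq> A" "\<And>x. \<exists>y>x. y \<in> D" "Rc (\<lambda>e. \<sigma> (e 0))"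
    "\<And>m. \<exists>b. \<forall>k\<in>D. b \<le> k \<longrightarrow> (\<forall>p<m. R p k \<longleftrightarrow> \<sigma> p)"
proof -
  have R': "RF f \<Longrightarrow> RF g \<Longrightarrow> Rc (\<lambda>e. R (f e) (g e))" for f g by (rule Rc_comp2[OF R])
  \<comment> \<open>\<open>s\<close> records the decisions for \<open>q < p\<close>; the question is
    whether staying inside \<open>R p\<close> is compatible with them unboundedly often. It is
    decidable because number quantifiers preserve \<open>Rc\<close> here.\<close>
  define inf where "inf p s \<longleftrightarrow> (\<forall>z. \<exists>k. z < k \<and> k \<in> A \<and> (\<forall>q<p. R q k \<longleftrightarrow> dig s q) \<and> R p k)" for p s
  have Rc_inf: "Rc (\<lambda>e. inf (e 0) (e (Suc 0)))" unfolding inf_def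
    by (rule Rc_all, rule Rc_ex) (intro rc R' A)
  have inf': "RF f \<Longrightarrow> RF g \<Longrightarrow> Rc (\<lambda>e. inf (f e) (g e))" for f g by (rule Rc_comp2[OF Rc_inf])
  obtain F where F: "RF (\<lambda>e. F (e 0) (e (Suc 0)))" "\<And>u. F u 0 = 0"
    "\<And>u p. F u (p + 1) = (if inf p (F u p) then F u p + pw p else F u p)"
  proof (rule primitive_recursion[of "\<lambda>_. 0" "\<lambda>u p x. if inf p x then x + pw p else x"])
    show "RF (\<lambda>e. 0)" "RF (\<lambda>e. if inf (e (Suc 0)) (e (Suc (Suc 0))) then e (Suc (Suc 0)) + pw (e (Suc 0)) else e (Suc (Suc 0)))"
      by (intro rc inf')+
  qed (rule that)
  define st where "st p = F 0 p" for p
  have st': "RF f \<Longrightarrow> RF (\<lambda>e. st (f e))" for f unfolding st_def by (intro RF_comp2[OF F(1)] rc)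
  have st: "st 0 = 0" "st (p + 1) = (if inf p (st p) then st p + pw p else st p)" for p
    using F(2,3) by (simp_all add: st_def)
  have st_less: "st p < pw p" for p
  proof (induction p rule: Rc_induct)
    case Rc
    show ?case by (intro rc st')
  next
    case (Suc p)
    then show ?case using pw_pos[of p] by (simp add: st pw zify)
  qed (simp add: st pw)
  have nodig: "\<not> dig (st p) p" for p by (rule dig_ge[OF st_less]) simp
  have dig_st: "dig (st (p + 1)) q \<longleftrightarrow> dig (st p) q \<or> (q = p \<and> inf p (st p))" for p q
    using dig_set(1)[OF nodig, of p q] by (auto simp: st)
  define \<sigma> where "\<sigma> q \<longleftrightarrow> dig (st (q + 1)) q" for q
  have \<sigma>': "RF f \<Longrightarrow> Rc (\<lambda>e. \<sigma> (f e))" for f unfolding \<sigma>_def by (intro rc st')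
  have stable: "q < p \<longrightarrow> (dig (st p) q \<longleftrightarrow> \<sigma> q)" for p q
  proof (induction p rule: Rc_induct)
    case Rc
    show ?case by (intro rc st' \<sigma>')
  next
    case (Suc p)
    show ?case
    proof
      assume "q < p + 1"
      then have "q < p \<or> q = p" by (simp add: num_less_Suc le_less)
      then show "dig (st (p + 1)) q \<longleftrightarrow> \<sigma> q" using Suc dig_st[of p q] by (auto simp: \<sigma>_def)
    qed
  qed simp
  have \<sigma>_iff: "\<sigma> p \<longleftrightarrow> inf p (st p)" for p unfolding \<sigma>_def dig_st using nodig by blast
  have unb: "\<forall>z. \<exists>k. z < k \<and> k \<in> A \<and> (\<forall>q<p. R q k \<longleftrightarrow> \<sigma> q)" for p
  proof (induction p rule: Rc_induct)
    case Rc
    show ?case by (rule Rc_all, rule Rc_ex) (intro rc R' A \<sigma>')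
  next
    case 0
    show ?case using A(2) by auto
  next
    case (Suc p)
    have inf: "inf p (st p) \<longleftrightarrow> (\<forall>z. \<exists>k. z < k \<and> k \<in> A \<and> (\<forall>q<p. R q k \<longleftrightarrow> \<sigma> q) \<and> R p k)"
      unfolding inf_def using stable by blast
    show ?case
    proof
      fix z
      have "\<exists>k. z < k \<and> k \<in> A \<and> (\<forall>q<p. R q k \<longleftrightarrow> \<sigma> q) \<and> (R p k \<longleftrightarrow> \<sigma> p)"
      proof (cases "\<sigma> p")
        case True
        then show ?thesis using inf \<sigma>_iff by blast
      next
        case False
        \<comment> \<open>Beyond some \<open>z'\<close> every element complying with the earlier
          decisions is outside \<open>R p\<close>, as \<open>\<sigma> p\<close> now demands.\<close>
        then obtain z' where z': "\<And>k. z' < k \<Longrightarrow> k \<in> A \<Longrightarrow> (\<forall>q<p. R q k \<longleftrightarrow> \<sigma> q) \<Longrightarrow> \<not> R p k"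
          using inf \<sigma>_iff by blast
        obtain k where k: "max z z' < k" "k \<in> A" "\<forall>q<p. R q k \<longleftrightarrow> \<sigma> q" using Suc by blast
        then show ?thesis using z' False by auto
      qed
      then obtain k where "z < k" "k \<in> A" "\<forall>q<p. R q k \<longleftrightarrow> \<sigma> q" "R p k \<longleftrightarrow> \<sigma> p" by blast
      then show "\<exists>k. z < k \<and> k \<in> A \<and> (\<forall>q<p + 1. R q k \<longleftrightarrow> \<sigma> q)"
        unfolding num_less_Suc le_less by blast
    qed
  qed
  define ok where "ok n k \<longleftrightarrow> n < k \<and> k \<in> A \<and> (\<forall>q<n. R q k \<longleftrightarrow> \<sigma> q)" for n k
  define kn where "kn n k \<longleftrightarrow> ok n k \<and> (\<forall>j<k. \<not> ok n j)" for n k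
  have ok': "RF f \<Longrightarrow> RF g \<Longrightarrow> Rc (\<lambda>e. ok (f e) (g e))" for f g
  proof (rule Rc_comp2[of ok])
    show "Rc (\<lambda>e. ok (e 0) (e (Suc 0)))" unfolding ok_def by (intro rc R' A \<sigma>')
  qed
  have kn': "RF f \<Longrightarrow> RF g \<Longrightarrow> Rc (\<lambda>e. kn (f e) (g e))" for f g
  proof (rule Rc_comp2[of kn])
    show "Rc (\<lambda>e. kn (e 0) (e (Suc 0)))" unfolding kn_def by (intro rc ok')
  qed
  have kn_ex: "\<exists>k. kn n k" for n
  proof -
    obtain k where "ok n k" using unb unfolding ok_def by blast
    moreover have "Rc (\<lambda>e. ok n (e 0))" by (intro ok' rc)
    ultimately obtain k where "ok n k" "\<And>j. j < k \<Longrightarrow> \<not> ok n j" using Rc_least[of "ok n"] by blast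
    then show ?thesis unfolding kn_def by blast
  qed
  have kn_unique: "k = k'" if "kn n k" "kn n k'" for n k k'
    using that unfolding kn_def by (meson linorder_neqE)
  \<comment> \<open>The least admissible element is taken for each \<open>n\<close>; as it exceeds
    \<open>n\<close>, the search for \<open>n\<close> is bounded.\<close>
  define D where "D = {k. \<exists>n<k. kn n k}"
  show ?thesis
  proof (rule that)
    show "D \<in> NS" unfolding D_def by (rule comprehension_Rc) (intro rc kn')
    show "D \<subseteq> A" unfolding D_def kn_def ok_def by blast
    show "\<exists>y>x. y \<in> D" for x using kn_ex[of x] unfolding D_def kn_def ok_def by blast
    show "Rc (\<lambda>e. \<sigma> (e 0))" by (intro \<sigma>' rc)
    fix m
    \<comment> \<open>Only the elements taken for some \<open>n < m\<close> can disagree with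
      \<open>\<sigma>\<close> below \<open>m\<close>, and collection bounds them.\<close>
    have "\<exists>b. \<forall>n<m. \<exists>k<b. kn n k" by (rule collection) (intro Rc_Sg kn' rc, rule kn_ex)
    then obtain b where b: "\<forall>n<m. \<exists>k<b. kn n k" by blast
    have "R p k \<longleftrightarrow> \<sigma> p" if k: "k \<in> D" "b \<le> k" "p < m" for k p
    proof -
      obtain n where n: "kn n k" using k(1) unfolding D_def by blast
      have "\<not> n < m" using b kn_unique[OF n] k(2) leD by blast
      then have "p < n" using k(3) by order
      then show ?thesis using n unfolding kn_def ok_def by blast
    qed
    then show "\<exists>b. \<forall>k\<in>D. b \<le> k \<longrightarrow> (\<forall>p<m. R p k \<longleftrightarrow> \<sigma> p)" by blast
  qed
qed

text \<open>
  Three cohesive sets make the colours of sums of three, two and one powers of \<open>2\<close> converge, one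
  variable at a time.
\<close>

lemma homogeneous_123:
  assumes c: "Rc (\<lambda>e. c (e 0))"
  obtains H d1 d2 d3 where "H \<in> NS" "\<And>x. \<exists>y>x. y \<in> H"
    "\<And>x. x \<in> H \<Longrightarrow> c (pw x) \<longleftrightarrow> d1"
    "\<And>x y. x \<in> H \<Longrightarrow> y \<in> H \<Longrightarrow> x < y \<Longrightarrow> c (pw x + pw y) \<longleftrightarrow> d2"
    "\<And>x y z. x \<in> H \<Longrightarrow> y \<in> H \<Longrightarrow> z \<in> H \<Longrightarrow> x < y \<Longrightarrow> y < z \<Longrightarrow> c (pw x + pw y + pw z) \<longleftrightarrow> d3"
proof -
  have c': "RF f \<Longrightarrow> Rc (\<lambda>e. c (f e))" for f by (rule Rc_comp1[OF c])
  \<comment> \<open>Row \<open>mpair i j\<close> gives the colour of the sum as a function of the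
    third exponent; its limit along \<open>D1\<close> is
    \<open>\<sigma>1 (mpair i j)\<close>.\<close>
  define R1 where "R1 p k \<longleftrightarrow> (\<exists>i<p + 1. \<exists>j<p + 1. p = mpair i j \<and> c (pw i + pw j + pw k))" for p k
  have Rc1: "Rc (\<lambda>e. R1 (e 0) (e (Suc 0)))" unfolding R1_def by (intro rc c')
  have R1: "R1 (mpair i j) k \<longleftrightarrow> c (pw i + pw j + pw k)" for i j k
    unfolding R1_def by (auto simp: num_less_Suc mpair_bounds)
  have "Rc (\<lambda>e. e 0 = e 0)" by (intro rc)
  then have U: "UNIV \<in> NS" using comprehension_Rc[of "\<lambda>x. x = x"] by simp
  have U2: "\<exists>y>x. y \<in> UNIV" for x :: mnum
    by (rule exI[of _ "x + 1"]) (simp add: num_less_Suc)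
  obtain D1 \<sigma>1 where D1: "D1 \<in> NS" "D1 \<subseteq> UNIV" "\<And>x. \<exists>y>x. y \<in> D1" "Rc (\<lambda>e. \<sigma>1 (e 0))"
    "\<And>m. \<exists>b. \<forall>k\<in>D1. b \<le> k \<longrightarrow> (\<forall>p<m. R1 p k \<longleftrightarrow> \<sigma>1 p)"
    by (rule cohesive[OF Rc1 U U2]) (rule that)
  have \<sigma>1': "RF f \<Longrightarrow> Rc (\<lambda>e. \<sigma>1 (f e))" for f by (rule Rc_comp1[OF D1(4)])
  \<comment> \<open>The second component of an index is a tag: 0 for the colours of sums of two
    powers, 1 for the limits left by the first stage.\<close>
  define R2 where "R2 p k \<longleftrightarrow> (\<exists>i<p + 1. (p = mpair i 0 \<and> c (pw i + pw k)) \<or> (p = mpair i 1 \<and> \<sigma>1 (mpair i k)))" for p k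
  have Rc2: "Rc (\<lambda>e. R2 (e 0) (e (Suc 0)))" unfolding R2_def by (intro rc c' \<sigma>1')
  have R2: "R2 (mpair i 0) k \<longleftrightarrow> c (pw i + pw k)" "R2 (mpair i 1) k \<longleftrightarrow> \<sigma>1 (mpair i k)" for i k
    unfolding R2_def by (auto simp: num_less_Suc mpair_bounds)
  obtain D2 \<sigma>2 where D2: "D2 \<in> NS" "D2 \<subseteq> D1" "\<And>x. \<exists>y>x. y \<in> D2" "Rc (\<lambda>e. \<sigma>2 (e 0))"
    "\<And>m. \<exists>b. \<forall>k\<in>D2. b \<le> k \<longrightarrow> (\<forall>p<m. R2 p k \<longleftrightarrow> \<sigma>2 p)"
    by (rule cohesive[OF Rc2 D1(1,3)]) (rule that)
  have \<sigma>2': "RF f \<Longrightarrow> Rc (\<lambda>e. \<sigma>2 (f e))" for f by (rule Rc_comp1[OF D2(4)])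
  \<comment> \<open>Rows 0, 1, 2 hold what remains of the sums of one, two and three powers; their
    limits are the final colours.\<close>
  define R3 where "R3 p k \<longleftrightarrow> (p = 0 \<and> c (pw k)) \<or> (p = 1 \<and> \<sigma>2 (mpair k 0)) \<or> (p = 2 \<and> \<sigma>2 (mpair k 1))" for p k :: mnum
  have Rc3: "Rc (\<lambda>e. R3 (e 0) (e (Suc 0)))" unfolding R3_def by (intro rc c' \<sigma>2')
  have "(1::mnum) \<noteq> 2" "(2::mnum) \<noteq> 1" "(2::mnum) \<noteq> 0" by (simp_all add: zify)
  then have R3: "R3 0 k \<longleftrightarrow> c (pw k)" "R3 1 k \<longleftrightarrow> \<sigma>2 (mpair k 0)" "R3 2 k \<longleftrightarrow> \<sigma>2 (mpair k 1)" for k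
    unfolding R3_def by auto
  obtain D3 \<sigma>3 where D3: "D3 \<in> NS" "D3 \<subseteq> D2" "\<And>x. \<exists>y>x. y \<in> D3" "Rc (\<lambda>e. \<sigma>3 (e 0))"
    "\<And>m. \<exists>b. \<forall>k\<in>D3. b \<le> k \<longrightarrow> (\<forall>p<m. R3 p k \<longleftrightarrow> \<sigma>3 p)"
    by (rule cohesive[OF Rc3 D2(1,3)]) (rule that)
  obtain b0 where b0: "\<forall>k\<in>D3. b0 \<le> k \<longrightarrow> (\<forall>p<3. R3 p k \<longleftrightarrow> \<sigma>3 p)" using D3(5) by blast
  have lt3: "(0::mnum) < 3" "(1::mnum) < 3" "(2::mnum) < 3" by (simp_all add: zify)
  \<comment> \<open>Exceeds every index with first component at most \<open>x\<close> and second at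
    most \<open>x + 1\<close>; the extra 1 admits the tag 1 when \<open>x = 0\<close>.\<close>
  define M where "M x = (x + x + 1) * (x + x + 1) + x + 1" for x :: mnum
  have M: "mpair i j < M x" if "i \<le> x" "j \<le> x + 1" for i j x
  proof -
    have "i + j \<le> x + x + 1" using add_mono[OF that] by (simp add: add.assoc)
    then have "(i + j) * (i + j) \<le> (x + x + 1) * (x + x + 1)" by (intro mult_mono) simp_all
    then have "mpair i j \<le> (x + x + 1) * (x + x + 1) + x" unfolding mpair_def using that(1) by (rule add_mono)
    then show ?thesis unfolding M_def by (simp only: num_less_Suc)
  qed
  \<comment> \<open>A successor of \<open>x\<close> lies past the points of convergence of all rows
    with index below \<open>M x\<close>, and past the common bound \<open>b0\<close> of the last
    three rows. Iteration thins \<open>D3\<close> until the limits are attained exactly.\<close>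
  define N where "N x h \<longleftrightarrow> h \<in> D3 \<and> b0 \<le> h \<and>
    (\<forall>k. k \<in> D1 \<and> h \<le> k \<longrightarrow> (\<forall>p<M x. R1 p k \<longleftrightarrow> \<sigma>1 p)) \<and>
    (\<forall>k. k \<in> D2 \<and> h \<le> k \<longrightarrow> (\<forall>p<M x. R2 p k \<longleftrightarrow> \<sigma>2 p))" for x h
  have R1': "RF f \<Longrightarrow> RF g \<Longrightarrow> Rc (\<lambda>e. R1 (f e) (g e))" for f g by (rule Rc_comp2[OF Rc1])
  have R2': "RF f \<Longrightarrow> RF g \<Longrightarrow> Rc (\<lambda>e. R2 (f e) (g e))" for f g by (rule Rc_comp2[OF Rc2])
  have RcN: "Rc (\<lambda>e. N (e 0) (e (Suc 0)))" unfolding N_def M_def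
    by (intro Rc_and; (rule Rc_all)?) (intro rc R1' R2' \<sigma>1' \<sigma>2' D1 D2 D3)+
  have Nex: "\<exists>y>x. N x y" for x
  proof -
    obtain b1 where b1: "\<forall>k\<in>D1. b1 \<le> k \<longrightarrow> (\<forall>p<M x. R1 p k \<longleftrightarrow> \<sigma>1 p)" using D1(5) by blast
    obtain b2 where b2: "\<forall>k\<in>D2. b2 \<le> k \<longrightarrow> (\<forall>p<M x. R2 p k \<longleftrightarrow> \<sigma>2 p)" using D2(5) by blast
    obtain y where y: "max (max x b0) (max b1 b2) < y" "y \<in> D3" using D3(3) by blast
    then have "x < y" "b0 \<le> y" "b1 \<le> y" "b2 \<le> y" by auto
    then have "N x y" unfolding N_def using y(2) b1 b2 by (meson order_trans)
    then show ?thesis using \<open>x < y\<close> by blast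
  qed
  obtain g where g: "RF (\<lambda>e. g (e 0))" "N 0 (g 0)" "\<And>i. N (g i) (g (i + 1))"
    "\<And>i j. i < j \<Longrightarrow> g i < g j" "\<And>i. i < g i"
    by (rule iterate_relation[OF RcN Nex]) (rule that)
  have g': "RF f \<Longrightarrow> RF (\<lambda>e. g (f e))" for f by (rule RF_comp1[OF g(1)])
  define H where "H = {y. \<exists>i<y. y = g i}"
  have H: "y \<in> H \<longleftrightarrow> (\<exists>i. y = g i)" for y unfolding H_def using g(5) by auto
  have "\<exists>x. N x (g i)" for i using g(2) g(3) num_cases[of i] by metis
  then have g_in: "g i \<in> D3" "b0 \<le> g i" for i unfolding N_def by blast+
  have step: "N x y" if xy: "x \<in> H" "y \<in> H" "x < y" for x y
  proof -
    obtain i j where ij: "x = g i" "y = g j" using xy H by blast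
    have "i < j" using xy(3) g(4)[of j i] unfolding ij by (metis less_asym linorder_neqE)
    then have "i + 1 \<le> j" by (simp only: num_Suc_le)
    then have "i + 1 < j \<or> i + 1 = j" by (simp only: le_less)
    then have "g (i + 1) \<le> g j" using g(4)[of "i + 1" j] by auto
    then show ?thesis using g(3)[of i] g_in[of j] unfolding N_def ij by (meson order_trans)
  qed
  have in3: "x \<in> D3" "x \<in> D2" "x \<in> D1" "b0 \<le> x" if "x \<in> H" for x
  proof -
    show "x \<in> D3" "b0 \<le> x" using that g_in H by auto
    then show "x \<in> D2" "x \<in> D1" using D3(2) D2(2) by blast+
  qed
  have d1: "c (pw x) \<longleftrightarrow> \<sigma>3 0" if "x \<in> H" for x
    using b0 in3[OF that] lt3(1) R3(1) by blast
  have d2: "c (pw x + pw y) \<longleftrightarrow> \<sigma>3 1" if xy: "x \<in> H" "y \<in> H" "x < y" for x y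
  proof -
    have "c (pw x + pw y) \<longleftrightarrow> R2 (mpair x 0) y" by (simp add: R2)
    also have "\<dots> \<longleftrightarrow> \<sigma>2 (mpair x 0)"
      using step[OF xy] in3[OF xy(2)] M[of x x 0] unfolding N_def by simp
    also have "\<dots> \<longleftrightarrow> \<sigma>3 1" using b0 in3[OF xy(1)] lt3(2) R3(2) by blast
    finally show ?thesis .
  qed
  \<comment> \<open>The limits are unwound from the last variable to the first, through
    \<open>R1\<close>, \<open>R2\<close> and \<open>R3\<close>. The index \<open>mpair x y\<close>
    is controlled by the step from \<open>y\<close> to \<open>z\<close>, hence by
    \<open>M y\<close>.\<close>
  have d3: "c (pw x + pw y + pw z) \<longleftrightarrow> \<sigma>3 2" if xyz: "x \<in> H" "y \<in> H" "z \<in> H" "x < y" "y < z" for x y z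
  proof -
    have "x \<le> y" "y \<le> y + 1" using xyz(4) by (simp_all add: less_imp_le)
    then have m: "mpair x y < M y" by (rule M)
    have "c (pw x + pw y + pw z) \<longleftrightarrow> R1 (mpair x y) z" by (simp add: R1)
    also have "\<dots> \<longleftrightarrow> \<sigma>1 (mpair x y)"
      using step[OF xyz(2,3,5)] in3[OF xyz(3)] m unfolding N_def by blast
    also have "\<dots> \<longleftrightarrow> R2 (mpair x 1) y" by (simp add: R2)
    also have "\<dots> \<longleftrightarrow> \<sigma>2 (mpair x 1)"
      using step[OF xyz(1,2,4)] in3[OF xyz(2)] M[of x x 1] unfolding N_def by simp
    also have "\<dots> \<longleftrightarrow> \<sigma>3 2" using b0 in3[OF xyz(1)] lt3(3) R3(3) by blast
    finally show ?thesis .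
  qed
  have "H \<in> NS" unfolding H_def by (rule comprehension_Rc) (intro rc g')
  moreover have "\<exists>y>x. y \<in> H" for x using g(5)[of x] H by blast
  ultimately show ?thesis using that d1 d2 d3 by blast
qed

end

section \<open>Unfolding coded sums of one, two and three elements\<close>

lemma ssum_Suc:
  assumes "ssum c d (l + 1) n"
  obtains m where "ssum c d l m" "n = m + bt c d l"
proof -
  obtain c' d' where *: "bt c' d' 0 = 0" "\<forall>i<l + 1. bt c' d' (i + 1) = bt c' d' i + bt c d i" "bt c' d' (l + 1) = n"
    using assms unfolding ssum_def by blast
  have "\<forall>i<l. bt c' d' (i + 1) = bt c' d' i + bt c d i" using *(2) by (simp add: num_less_Suc less_imp_le)
  then have "ssum c d l (bt c' d' l)" unfolding ssum_def using *(1) by blast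
  moreover have "n = bt c' d' l + bt c d l" using *(2,3) by (simp add: num_less_Suc)
  ultimately show ?thesis by (rule that)
qed

lemma two_three: "(2::mnum) = 1 + 1" "(3::mnum) = 1 + 1 + 1" by (simp_all add: zify)

lemma fs_1: assumes "fs 1 H n" shows "n \<in> H"
  using assms unfolding fs_def ssum_1 by auto

lemma fs_2: assumes "fs 2 H n" obtains x y where "x \<in> H" "y \<in> H" "x \<noteq> y" "n = x + y"
proof -
  obtain c d where *: "\<forall>i<2. bt c d i \<in> H" "\<forall>i<2. \<forall>k<2. i \<noteq> k \<longrightarrow> bt c d i \<noteq> bt c d k" "ssum c d 2 n"
    using assms unfolding fs_def by blast
  have l: "(0::mnum) < 2" "(1::mnum) < 2" "(0::mnum) \<noteq> 1" by simp_all
  obtain m where "ssum c d 1 m" "n = m + bt c d 1" using *(3) ssum_Suc unfolding two_three by blast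
  then have "n = bt c d 0 + bt c d 1" by (simp add: ssum_1)
  then show ?thesis using that * l by metis
qed

lemma fs_3:
  assumes "fs 3 H n"
  obtains x y z where "x \<in> H" "y \<in> H" "z \<in> H" "x \<noteq> y" "x \<noteq> z" "y \<noteq> z" "n = x + y + z"
proof -
  obtain c d where *: "\<forall>i<3. bt c d i \<in> H" "\<forall>i<3. \<forall>k<3. i \<noteq> k \<longrightarrow> bt c d i \<noteq> bt c d k" "ssum c d 3 n"
    using assms unfolding fs_def by blast
  have l: "(0::mnum) < 3" "(1::mnum) < 3" "(2::mnum) < 3" "(0::mnum) \<noteq> 1" "(0::mnum) \<noteq> 2" "(1::mnum) \<noteq> 2"
    by (simp_all add: zify)
  obtain m where m: "ssum c d (1 + 1) m" "n = m + bt c d (1 + 1)" using *(3) ssum_Suc unfolding two_three by blast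
  obtain m' where "ssum c d 1 m'" "m = m' + bt c d 1" using m(1) ssum_Suc by blast
  then have "n = bt c d 0 + bt c d 1 + bt c d 2" using m(2) by (simp add: ssum_1)
  then show ?thesis using that[of "bt c d 0" "bt c d 1" "bt c d 2"] * l by blast
qed

lemma ACA0_imp_HT:
  assumes "\<forall>\<phi>\<in>ACA0. sat NM e B \<phi>"
  shows "sat NM e B HT_exists_ab_apart"
  unfolding sat_HT
proof (intro ballI impI)
  interpret sigma1_CA using ACA0_sigma1_CA[OF assms] .
  fix F assume F: "F \<in> NS" "colouring F"
  define c where "c n \<longleftrightarrow> mpair n 1 \<in> F" for n
  have "Rc (\<lambda>e. c (e 0))" unfolding c_def by (intro rc F)
  then obtain H d1 d2 d3 where H: "H \<in> NS" "\<And>x. \<exists>y>x. y \<in> H"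
    and d1: "\<And>x. x \<in> H \<Longrightarrow> c (pw x) \<longleftrightarrow> d1"
    and d2: "\<And>x y. x \<in> H \<Longrightarrow> y \<in> H \<Longrightarrow> x < y \<Longrightarrow> c (pw x + pw y) \<longleftrightarrow> d2"
    and d3: "\<And>x y z. x \<in> H \<Longrightarrow> y \<in> H \<Longrightarrow> z \<in> H \<Longrightarrow> x < y \<Longrightarrow> y < z \<Longrightarrow> c (pw x + pw y + pw z) \<longleftrightarrow> d3"
    by (rule homogeneous_123) (rule that)
  define K where "K = pw ` H"
  have "K = {y. \<exists>h<y. h \<in> H \<and> y = pw h}" unfolding K_def using pw_gt by auto
  moreover have "{y. \<exists>h<y. h \<in> H \<and> y = pw h} \<in> NS" by (rule comprehension_Rc) (intro rc H)
  ultimately have "K \<in> NS" by simp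
  have pos: "\<forall>x\<in>K. 0 < x" unfolding K_def using pw_pos by auto
  have inf: "\<forall>x. \<exists>y>x. y \<in> K"
  proof
    fix x
    obtain y where "x < y" "y \<in> H" using H(2) by blast
    then show "\<exists>y>x. y \<in> K" unfolding K_def using pw_gt[of y] by (meson imageI less_trans)
  qed
  \<comment> \<open>\<open>c\<close> records colour 1 only; otherwise the colour is 0, because a
    colouring is total with values below 2.\<close>
  have col: "mpair n (if d then 1 else 0) \<in> F" if n: "0 < n" "c n \<longleftrightarrow> d" for n d
  proof (cases d)
    case True
    then show ?thesis using n unfolding c_def by simp
  next
    case False
    obtain j where j: "mpair n j \<in> F" using F(2) n(1) unfolding colouring_def by blast
    then have "j < 2" using F(2) unfolding colouring_def by (metis mpair_iff)
    then have "j \<le> 1" unfolding two_three by (simp only: num_less_Suc)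
    moreover have "j \<noteq> 1" using j n(2) False unfolding c_def by blast
    ultimately have "j < 0 + 1" by simp
    then have "j = 0" by (simp only: num_less_Suc le_zero_eq)
    then show ?thesis using j False by simp
  qed
  have c1: "c n \<longleftrightarrow> d1" "0 < n" if "fs 1 K n" for n
    using fs_1[OF that] d1 pos unfolding K_def by auto
  have c2: "c n \<longleftrightarrow> d2" "0 < n" if fs: "fs 2 K n" for n
  proof -
    obtain u v where "u \<in> K" "v \<in> K" "u \<noteq> v" "n = u + v" by (rule fs_2[OF fs])
    then obtain x y where xy: "x \<in> H" "y \<in> H" "x \<noteq> y" "n = pw x + pw y" unfolding K_def by blast
    then show "c n \<longleftrightarrow> d2" using d2[of x y] d2[of y x] by (metis add.commute linorder_neqE)
    show "0 < n" unfolding xy(4) using pw_pos[of x] by (simp add: add_pos_nonneg)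
  qed
  have c3: "c n \<longleftrightarrow> d3" "0 < n" if fs: "fs 3 K n" for n
  proof -
    obtain u v w where "u \<in> K" "v \<in> K" "w \<in> K" "u \<noteq> v" "u \<noteq> w" "v \<noteq> w" "n = u + v + w"
      by (rule fs_3[OF fs])
    then obtain x y z where xyz: "x \<in> H" "y \<in> H" "z \<in> H" "x \<noteq> y" "x \<noteq> z" "y \<noteq> z" "n = pw x + pw y + pw z"
      unfolding K_def by blast
    \<comment> \<open>A coded sum lists its summands in any order, whereas homogeneity was obtained
      for increasing exponents.\<close>
    consider "x < y" "y < z" | "x < z" "z < y" | "y < x" "x < z" | "y < z" "z < x" | "z < x" "x < y" | "z < y" "y < x"
      using xyz(4-6) by (metis linorder_neqE)
    then show "c n \<longleftrightarrow> d3"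
    proof cases
      case 1 then show ?thesis using d3[of x y z] xyz by simp
    next
      case 2 then show ?thesis using d3[of x z y] xyz by (simp add: ac_simps)
    next
      case 3 then show ?thesis using d3[of y x z] xyz by (simp add: ac_simps)
    next
      case 4 then show ?thesis using d3[of y z x] xyz by (simp add: ac_simps)
    next
      case 5 then show ?thesis using d3[of z x y] xyz by (simp add: ac_simps)
    next
      case 6 then show ?thesis using d3[of z y x] xyz by (simp add: ac_simps)
    qed
    show "0 < n" unfolding xyz(7) using pw_pos[of x] by (simp add: add_pos_nonneg)
  qed
  have l: "(0::mnum) < 1" "(0::mnum) < 2" "(1::mnum) < 2" "(1::mnum) < 3" "(2::mnum) < 3" by (simp_all add: zify)
  have two: "(if d then 1 else 0) < (2::mnum)" for d using l by simp
  have fin: "\<exists>j<2. \<forall>n. fs a K n \<or> fs b K n \<longrightarrow> mpair n j \<in> F"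
    if "\<And>n. fs a K n \<or> fs b K n \<Longrightarrow> 0 < n \<and> (c n \<longleftrightarrow> d)" for a b d
    using that col two[of d] by (intro exI[of _ "if d then 1 else 0"]) blast
  have "\<exists>a b. 0 < a \<and> a < b \<and> (\<exists>j<2. \<forall>n. fs a K n \<or> fs b K n \<longrightarrow> mpair n j \<in> F)"
  proof -
    consider "d1 = d2" | "d1 = d3" | "d2 = d3" by blast
    then show ?thesis
    proof cases
      case 1
      then have "\<exists>j<2. \<forall>n. fs 1 K n \<or> fs 2 K n \<longrightarrow> mpair n j \<in> F" by (intro fin[of _ _ d1]) (use c1 c2 in blast)
      then show ?thesis using l by blast
    next
      case 2
      then have "\<exists>j<2. \<forall>n. fs 1 K n \<or> fs 3 K n \<longrightarrow> mpair n j \<in> F" by (intro fin[of _ _ d1]) (use c1 c3 in blast)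
      then show ?thesis using l by blast
    next
      case 3
      then have "\<exists>j<2. \<forall>n. fs 2 K n \<or> fs 3 K n \<longrightarrow> mpair n j \<in> F" by (intro fin[of _ _ d2]) (use c2 c3 in blast)
      then show ?thesis using l by blast
    qed
  qed
  then show "\<exists>H\<in>NS. (\<forall>x\<in>H. 0 < x) \<and> (\<forall>x. \<exists>y>x. y \<in> H) \<and> apart H \<and>
      (\<exists>a b. 0 < a \<and> a < b \<and> (\<exists>j<2. \<forall>n. fs a H n \<or> fs b H n \<longrightarrow> mpair n j \<in> F))"
    using \<open>K \<in> NS\<close> pos inf apart_pw[of H] unfolding K_def by blast
qed

theorem theorem4:
  shows "equivalent_over RCA0 {HT_exists_ab_apart} ACA0"
  using HT_imp_ACA0 ACA0_imp_HT by (intro equivalence_from_NM) blast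

end
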